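(* Let $G$ be the HLS groupoid associated with an approximated group $(\Gamma,(K_n)_{n\in\mathbb N})$, $\Gamma$ countable, and suppose $G$ has topological property (T). Let $\pi$ be a continuous unitary representation of $G$. Then $\pi$ is amenable if and only if its restriction $\tilde\pi$ to $\Gamma=\Gamma_\infty$ has a (non-zero) finite-dimensional subrepresentation.
   Context: HLS groupoid. An approximated group $(\Gamma,(K_n)_{n\in\mathbb N})$ is a discrete group $\Gamma$ with a decreasing sequence of finite-index normal subgroups $K_n$ with $\bigcap_nK_n=\{e\}$. Put $\Gamma_n=\Gamma/K_n$ with quotient map $q_n:\Gamma\to\Gamma_n$, and $\Gamma_\infty=\Gamma$, $q_\infty=\mathrm{id}_\Gamma$. The HLS groupoid is $G=\bigsqcup_{n\in\mathbb N\cup\{\infty\}}\{n\}\times\Gamma_n$, with topology generated by the singletons $\{(n,g)\}$, $n\in\mathbb N$, $g\in\Gamma_n$, and the sets $\{(n,q_n(g)):n\in\mathbb N\cup\{\infty\},\,n>N\}$, $g\in\Gamma$, $N\in\mathbb N$. Its unit space is $G^0=\{(n,e):n\in\mathbb N\cup\{\infty\}\}$, $d(n,g)=r(n,g)=(n,e)$, $(n,g)(n,h)=(n,gh)$, $(n,g)^{-1}=(n,g^{-1})$. It is a locally compact Hausdorff second countable étale groupoid with compact unit space. Topological property (T) (Dell'Aiera–Willett). For an étale groupoid $G$ with compact unit space, $C_c(G)$ is the convolution $*$-algebra; $\Psi:C_c(G)\to C(G^0)$ is $\Psi(f)(u)=\sum_{g\in G^u}f(g)$ where $G^u=r^{-1}(u)$;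 $\|f\|_I=\max\{\sup_u\sum_{g\in G^u}|f(g)|,\ \sup_u\sum_{g\in G_u}|f(g)|\}$ with $G_u=d^{-1}(u)$. For a (nondegenerate) $*$-representation of $C_c(G)$ on a Hilbert space $\mathcal H$, a vector $v$ is constant if $fv=\Psi(f)v$ for all $f\in C_c(G)$. $G$ has topological property (T) if there are a compact $K\subseteq G$ and $c>0$ such that for every such representation and every $v$ orthogonal to the constant vectors there is $f\in C_c(G)$ supported in $K$ with $\|f\|_I\le1$ and $\|fv-\Psi(f)v\|\ge c\|v\|$. Representations. A continuous Hilbert bundle over $G^0$ is a continuous field $\{\mathcal H_u\}_{u\in G^0}$ of separable Hilbert spaces; $C_0(G^0,\mathcal H)$ is its space of continuous sections vanishing at infinity. A continuous unitary representation $(\mathcal H^\pi,\pi)$ of $G$ is a continuous Hilbert bundle over $G^0$ with unitaries $\pi(x):\mathcal H^\pi_{d(x)}\to\mathcal H^\pi_{r(x)}$ such that $\pi(u)=\mathrm{id}$ for $u\in G^0$, $\pi(xy)=\pi(x)\pi(y)$, $\pi(x)^{-1}=\pi(x^{-1})$, and $x\mapsto\langle\pi(x)\xi(d(x)),\eta(r(x))\rangle$ is continuous for $\xi,\eta\in C_0(G^0,\mathcal H^\pi)$. All representations are assumed to have all fibers non-zero and $C_0(G^0,\mathcal H^\pi)$ countably generated as a Hilbert $C_0(G^0)$-module. Amenable representation. For $T$ adjointable on $C_0(G^0,\mathcal H^\pi)$, $T_u$ is its localization on $\mathcal H^\pi_u$, $(T\xi)(u)=T_u\xi(u)$. $T$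 is Hilbert–Schmidt if $u\mapsto\operatorname{Tr}(|T_u|^2)$ lies in $C_0(G^0)$; $\|T_u\|_2=\operatorname{Tr}(|T_u|^2)^{1/2}$, $\|T\|_2=\sup_u\|T_u\|_2$. Put $x\cdot T_{d(x)}=\pi(x)T_{d(x)}\pi(x^{-1})$. $\pi$ is amenable if there is a net $\{T^i\}$ of Hilbert–Schmidt operators on $C_0(G^0,\mathcal H^\pi)$ with $\|T^i\|_2\le1$, $\|T^i_u\|_2\to1$ uniformly on compact subsets of $G^0$, and $\langle x\cdot T^i_{d(x)},T^i_{r(x)}\rangle\to1$ (Hilbert–Schmidt inner product) uniformly on compact subsets of $G$. *)

theory Defs
  imports "HOL-Analysis.Analysis" "HOL-Algebra.Coset" "HOL-Library.Function_Algebras"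
    "HOL-Library.Extended_Nat"
begin

section \<open>Complex Hilbert spaces on subspaces of a complex vector space\<close>

class complex_vector = ab_group_add +
  fixes scaleC :: "complex \<Rightarrow> 'a \<Rightarrow> 'a"  (infixr \<open>*\<^sub>C\<close> 75)
  assumes scaleC_add_right: "c *\<^sub>C (x + y) = c *\<^sub>C x + c *\<^sub>C y"
    and scaleC_add_left: "(b + c) *\<^sub>C x = b *\<^sub>C x + c *\<^sub>C x"
    and scaleC_scaleC: "b *\<^sub>C c *\<^sub>C x = (b * c) *\<^sub>C x"
    and scaleC_one: "1 *\<^sub>C x = x"

global_interpretation complex_vector: vector_space "scaleC :: complex \<Rightarrow> 'a \<Rightarrow> 'a::complex_vector"
  by unfold_locales (simp_all add: scaleC_add_right scaleC_add_left scaleC_scaleC scaleC_one)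

instantiation complex :: complex_vector
begin
definition scaleC_complex :: "complex \<Rightarrow> complex \<Rightarrow> complex" where
  "scaleC_complex c z = c * z"
instance
  by standard (simp_all add: scaleC_complex_def algebra_simps)
end

instantiation "fun" :: (type, complex_vector) complex_vector
begin
definition scaleC_fun :: "complex \<Rightarrow> ('a \<Rightarrow> 'b) \<Rightarrow> 'a \<Rightarrow> 'b" where
  "scaleC_fun c f = (\<lambda>x. c *\<^sub>C f x)"
instance
  by standard
    (simp_all add: scaleC_fun_def fun_eq_iff scaleC_add_right scaleC_add_left scaleC_scaleC scaleC_one)
end

text \<open>
  A Hilbert space is given by a linear subspace of an ambient complex vector space together with its
  own inner product, linear in the first argument.  Nothing relates the inner product to the
  ambient type, and different Hilbert spaces in the same ambient type may overlap.  Since any family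
  of vector spaces embeds into its algebraic direct sum, families of Hilbert spaces over one
  ambient type are as general as arbitrary families.
\<close>

record 'v inner_space =
  vecs :: "'v set"
  ip :: "'v \<Rightarrow> 'v \<Rightarrow> complex"

definition hnorm :: "('v, 'm) inner_space_scheme \<Rightarrow> 'v \<Rightarrow> real" where
  "hnorm H v = sqrt (Re (ip H v v))"

definition hilbert_space :: "'v::complex_vector inner_space \<Rightarrow> bool" where
  "hilbert_space H \<longleftrightarrow>
     complex_vector.subspace (vecs H) \<and>
     (\<forall>u\<in>vecs H. \<forall>v\<in>vecs H. \<forall>w\<in>vecs H. ip H (u + v) w = ip H u w + ip H v w) \<and>
     (\<forall>c. \<forall>v\<in>vecs H. \<forall>w\<in>vecs H. ip H (c *\<^sub>C v) w = c * ip H v w) \<and>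
     (\<forall>v\<in>vecs H. \<forall>w\<in>vecs H. ip H w v = cnj (ip H v w)) \<and>
     (\<forall>v\<in>vecs H. 0 \<le> Re (ip H v v)) \<and>
     (\<forall>v\<in>vecs H. ip H v v = 0 \<longrightarrow> v = 0) \<and>
     (\<forall>s :: nat \<Rightarrow> 'v. range s \<subseteq> vecs H \<and>
        (\<forall>\<epsilon>>0. \<exists>N. \<forall>m\<ge>N. \<forall>n\<ge>N. hnorm H (s m - s n) < \<epsilon>) \<longrightarrow>
        (\<exists>l\<in>vecs H. (\<lambda>n. hnorm H (s n - l)) \<longlonglongrightarrow> 0))"

definition dense_in :: "'v::complex_vector inner_space \<Rightarrow> 'v set \<Rightarrow> bool" where
  "dense_in H S \<longleftrightarrow> S \<subseteq> vecs H \<and> (\<forall>v\<in>vecs H. \<forall>\<epsilon>>0. \<exists>w\<in>S. hnorm H (v - w) < \<epsilon>)"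

definition separable_hilbert :: "'v::complex_vector inner_space \<Rightarrow> bool" where
  "separable_hilbert H \<longleftrightarrow> hilbert_space H \<and> (\<exists>S. countable S \<and> dense_in H S)"

definition linear_between ::
  "'v::complex_vector inner_space \<Rightarrow> 'v inner_space \<Rightarrow> ('v \<Rightarrow> 'v) \<Rightarrow> bool" where
  "linear_between H H' A \<longleftrightarrow>
     A ` vecs H \<subseteq> vecs H' \<and>
     (\<forall>v\<in>vecs H. \<forall>w\<in>vecs H. A (v + w) = A v + A w) \<and>
     (\<forall>c. \<forall>v\<in>vecs H. A (c *\<^sub>C v) = c *\<^sub>C A v)"

definition bounded_operator :: "'v::complex_vector inner_space \<Rightarrow> ('v \<Rightarrow> 'v) \<Rightarrow> bool" where
  "bounded_operator H A \<longleftrightarrow>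
     linear_between H H A \<and> (\<exists>C. \<forall>v\<in>vecs H. hnorm H (A v) \<le> C * hnorm H v)"

definition unitary_between ::
  "'v::complex_vector inner_space \<Rightarrow> 'v inner_space \<Rightarrow> ('v \<Rightarrow> 'v) \<Rightarrow> bool" where
  "unitary_between H H' U \<longleftrightarrow>
     linear_between H H' U \<and> U ` vecs H = vecs H' \<and>
     (\<forall>v\<in>vecs H. \<forall>w\<in>vecs H. ip H' (U v) (U w) = ip H v w)"

definition orthonormal_basis :: "'v::complex_vector inner_space \<Rightarrow> 'v set \<Rightarrow> bool" where
  "orthonormal_basis H E \<longleftrightarrow>
     E \<subseteq> vecs H \<and> (\<forall>e\<in>E. \<forall>e'\<in>E. ip H e e' = (if e = e' then 1 else 0)) \<and>
     dense_in H (complex_vector.span E)"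

definition op_adjoint :: "'v::complex_vector inner_space \<Rightarrow> ('v \<Rightarrow> 'v) \<Rightarrow> 'v \<Rightarrow> 'v" where
  "op_adjoint H A w = (THE z. z \<in> vecs H \<and> (\<forall>v\<in>vecs H. ip H (A v) w = ip H v z))"

text \<open>The trace does not depend on the orthonormal basis it is computed in.\<close>

definition chosen_basis :: "'v::complex_vector inner_space \<Rightarrow> 'v set" where
  "chosen_basis H = (SOME E. orthonormal_basis H E)"

definition op_trace :: "'v::complex_vector inner_space \<Rightarrow> ('v \<Rightarrow> 'v) \<Rightarrow> complex" where
  "op_trace H A = (\<Sum>\<^sub>\<infinity>e\<in>chosen_basis H. ip H (A e) e)"

definition has_finite_trace :: "'v::complex_vector inner_space \<Rightarrow> ('v \<Rightarrow> 'v) \<Rightarrow> bool" where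
  "has_finite_trace H A \<longleftrightarrow> (\<lambda>e. ip H (A e) e) summable_on chosen_basis H"

definition abs_square :: "'v::complex_vector inner_space \<Rightarrow> ('v \<Rightarrow> 'v) \<Rightarrow> 'v \<Rightarrow> 'v" where
  "abs_square H A = op_adjoint H A \<circ> A"

definition hs_norm :: "'v::complex_vector inner_space \<Rightarrow> ('v \<Rightarrow> 'v) \<Rightarrow> real" where
  "hs_norm H A = sqrt (Re (op_trace H (abs_square H A)))"

definition hs_inner :: "'v::complex_vector inner_space \<Rightarrow> ('v \<Rightarrow> 'v) \<Rightarrow> ('v \<Rightarrow> 'v) \<Rightarrow> complex" where
  "hs_inner H A A' = op_trace H (op_adjoint H A' \<circ> A)"


section \<open>Groupoids and the convolution algebra\<close>

text \<open>
  The arrows are the points of the topology \<open>gtop\<close>.  The product is only meaningful for pairs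
  \<open>x\<close>, \<open>y\<close> with \<open>gsrc x = grng y\<close>.
\<close>

record 'g groupoid =
  gtop :: "'g topology"
  gunits :: "'g set"
  gsrc :: "'g \<Rightarrow> 'g"
  grng :: "'g \<Rightarrow> 'g"
  gmul :: "'g \<Rightarrow> 'g \<Rightarrow> 'g"
  ginv :: "'g \<Rightarrow> 'g"

definition arrows :: "'g groupoid \<Rightarrow> 'g set" where
  "arrows G = topspace (gtop G)"

definition unit_top :: "'g groupoid \<Rightarrow> 'g topology" where
  "unit_top G = subtopology (gtop G) (gunits G)"

definition rng_fiber :: "'g groupoid \<Rightarrow> 'g \<Rightarrow> 'g set" where
  "rng_fiber G u = {x \<in> arrows G. grng G x = u}"

definition src_fiber :: "'g groupoid \<Rightarrow> 'g \<Rightarrow> 'g set" where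
  "src_fiber G u = {x \<in> arrows G. gsrc G x = u}"

definition supp :: "'g groupoid \<Rightarrow> ('g \<Rightarrow> complex) \<Rightarrow> 'g set" where
  "supp G f = gtop G closure_of {x \<in> arrows G. f x \<noteq> 0}"

text \<open>Functions on the arrows are represented by functions on the type that vanish elsewhere.\<close>

definition Cc :: "'g groupoid \<Rightarrow> ('g \<Rightarrow> complex) set" where
  "Cc G = {f. continuous_map (gtop G) euclidean f \<and> compactin (gtop G) (supp G f) \<and>
              (\<forall>x. x \<notin> arrows G \<longrightarrow> f x = 0)}"

definition convolution ::
  "'g groupoid \<Rightarrow> ('g \<Rightarrow> complex) \<Rightarrow> ('g \<Rightarrow> complex) \<Rightarrow> 'g \<Rightarrow> complex" where
  "convolution G f h = (\<lambda>x. if x \<in> arrows G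
     then (\<Sum>\<^sub>\<infinity>y\<in>rng_fiber G (grng G x). f y * h (gmul G (ginv G y) x)) else 0)"

definition involution :: "'g groupoid \<Rightarrow> ('g \<Rightarrow> complex) \<Rightarrow> 'g \<Rightarrow> complex" where
  "involution G f = (\<lambda>x. if x \<in> arrows G then cnj (f (ginv G x)) else 0)"

text \<open>
  \<open>Psi G f\<close> is a function on the unit space, which is open and compact, and is extended by zero to
  an element of \<open>Cc G\<close>; this is how functions on the unit space act in a representation.
\<close>

definition Psi :: "'g groupoid \<Rightarrow> ('g \<Rightarrow> complex) \<Rightarrow> 'g \<Rightarrow> complex" where
  "Psi G f = (\<lambda>u. if u \<in> gunits G then (\<Sum>\<^sub>\<infinity>x\<in>rng_fiber G u. f x) else 0)"

definition I_norm :: "'g groupoid \<Rightarrow> ('g \<Rightarrow> complex) \<Rightarrow> real" where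
  "I_norm G f = max (SUP u\<in>gunits G. \<Sum>\<^sub>\<infinity>x\<in>rng_fiber G u. norm (f x))
                    (SUP u\<in>gunits G. \<Sum>\<^sub>\<infinity>x\<in>src_fiber G u. norm (f x))"

definition star_representation ::
  "'g groupoid \<Rightarrow> 'v::complex_vector inner_space \<Rightarrow> (('g \<Rightarrow> complex) \<Rightarrow> 'v \<Rightarrow> 'v) \<Rightarrow> bool" where
  "star_representation G H \<Phi> \<longleftrightarrow>
     (\<forall>f\<in>Cc G. bounded_operator H (\<Phi> f)) \<and>
     (\<forall>f\<in>Cc G. \<forall>h\<in>Cc G. \<forall>v\<in>vecs H. \<Phi> (f + h) v = \<Phi> f v + \<Phi> h v) \<and>
     (\<forall>c. \<forall>f\<in>Cc G. \<forall>v\<in>vecs H. \<Phi> (c *\<^sub>C f) v = c *\<^sub>C \<Phi> f v) \<and>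
     (\<forall>f\<in>Cc G. \<forall>h\<in>Cc G. \<forall>v\<in>vecs H. \<Phi> (convolution G f h) v = \<Phi> f (\<Phi> h v)) \<and>
     (\<forall>f\<in>Cc G. \<forall>v\<in>vecs H. \<forall>w\<in>vecs H. ip H (\<Phi> f v) w = ip H v (\<Phi> (involution G f) w)) \<and>
     dense_in H (complex_vector.span {\<Phi> f v | f v. f \<in> Cc G \<and> v \<in> vecs H})"

definition constant_vectors ::
  "'g groupoid \<Rightarrow> 'v::complex_vector inner_space \<Rightarrow> (('g \<Rightarrow> complex) \<Rightarrow> 'v \<Rightarrow> 'v) \<Rightarrow> 'v set" where
  "constant_vectors G H \<Phi> = {v \<in> vecs H. \<forall>f\<in>Cc G. \<Phi> f v = \<Phi> (Psi G f) v}"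

text \<open>
  HOL cannot quantify over all Hilbert spaces at once, so the definition ranges over those whose
  vectors lie in \<open>nat \<Rightarrow> complex\<close>, with arbitrary inner products.  Up to isomorphism these
  include all separable Hilbert spaces.  For a second
  countable groupoid with compact unit space this loses nothing: a vector \<open>v\<close> lies in the
  separable closed invariant subspace generated by the \<open>\<Phi> f v\<close>, and the constant vectors of that
  subspace are constant in the whole space, so the condition only has to be tested there.
\<close>

definition topological_property_T :: "'g groupoid \<Rightarrow> bool" where
  "topological_property_T G \<longleftrightarrow>
     (\<exists>C c. compactin (gtop G) C \<and> 0 < c \<and>
        (\<forall>(H :: (nat \<Rightarrow> complex) inner_space) \<Phi>.
           hilbert_space H \<and> star_representation G H \<Phi> \<longrightarrow>
           (\<forall>v\<in>vecs H. (\<forall>w\<in>constant_vectors G H \<Phi>. ip H v w = 0) \<longrightarrow>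
              (\<exists>f\<in>Cc G. supp G f \<subseteq> C \<and> I_norm G f \<le> 1 \<and>
                 c * hnorm H v \<le> hnorm H (\<Phi> f v - \<Phi> (Psi G f) v)))))"


section \<open>Continuous Hilbert bundles and unitary representations\<close>

text \<open>
  \<open>sect\<close> is the space of all continuous sections; sections are functions on the type that vanish
  off the unit space.
\<close>

record ('g, 'v) hilbert_bundle =
  fib :: "'g \<Rightarrow> 'v inner_space"
  sect :: "('g \<Rightarrow> 'v) set"

definition all_sections ::
  "'g groupoid \<Rightarrow> ('g, 'v::complex_vector) hilbert_bundle \<Rightarrow> ('g \<Rightarrow> 'v) set" where
  "all_sections G B = {\<xi>. (\<forall>u\<in>gunits G. \<xi> u \<in> vecs (fib B u)) \<and> (\<forall>u. u \<notin> gunits G \<longrightarrow> \<xi> u = 0)}"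

text \<open>Dixmier's axioms for a continuous field of Hilbert spaces.\<close>

definition continuous_hilbert_bundle ::
  "'g groupoid \<Rightarrow> ('g, 'v::complex_vector) hilbert_bundle \<Rightarrow> bool" where
  "continuous_hilbert_bundle G B \<longleftrightarrow>
     (\<forall>u\<in>gunits G. separable_hilbert (fib B u)) \<and>
     sect B \<subseteq> all_sections G B \<and> complex_vector.subspace (sect B) \<and>
     (\<forall>u\<in>gunits G. dense_in (fib B u) ((\<lambda>\<xi>. \<xi> u) ` sect B)) \<and>
     (\<forall>\<xi>\<in>sect B. continuous_map (unit_top G) euclideanreal (\<lambda>u. hnorm (fib B u) (\<xi> u))) \<and>
     (\<forall>\<xi>\<in>all_sections G B.
        (\<forall>u\<in>gunits G. \<forall>\<epsilon>>0. \<exists>\<eta>\<in>sect B. \<exists>U. openin (unit_top G) U \<and> u \<in> U \<and>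
           (\<forall>w\<in>U. hnorm (fib B w) (\<xi> w - \<eta> w) < \<epsilon>)) \<longrightarrow> \<xi> \<in> sect B)"

definition C0_function :: "'x topology \<Rightarrow> ('x \<Rightarrow> 'b::real_normed_vector) \<Rightarrow> bool" where
  "C0_function X f \<longleftrightarrow> continuous_map X euclidean f \<and>
     (\<forall>\<epsilon>>0. compactin X {x \<in> topspace X. \<epsilon> \<le> norm (f x)})"

definition C0_sections ::
  "'g groupoid \<Rightarrow> ('g, 'v::complex_vector) hilbert_bundle \<Rightarrow> ('g \<Rightarrow> 'v) set" where
  "C0_sections G B = {\<xi> \<in> sect B. C0_function (unit_top G) (\<lambda>u. hnorm (fib B u) (\<xi> u))}"

definition countably_generated ::
  "'g groupoid \<Rightarrow> ('g, 'v::complex_vector) hilbert_bundle \<Rightarrow> bool" where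
  "countably_generated G B \<longleftrightarrow>
     (\<exists>S. countable S \<and> S \<subseteq> C0_sections G B \<and>
        (\<forall>\<xi>\<in>C0_sections G B. \<forall>\<epsilon>>0.
           \<exists>\<eta>\<in>complex_vector.span
               {\<lambda>u. f u *\<^sub>C \<sigma> u | f \<sigma>. C0_function (unit_top G) f \<and> \<sigma> \<in> S}.
             \<forall>u\<in>gunits G. hnorm (fib B u) (\<xi> u - \<eta> u) < \<epsilon>))"

definition continuous_unitary_rep ::
  "'g groupoid \<Rightarrow> ('g, 'v::complex_vector) hilbert_bundle \<Rightarrow> ('g \<Rightarrow> 'v \<Rightarrow> 'v) \<Rightarrow> bool" where
  "continuous_unitary_rep G B \<pi> \<longleftrightarrow>
     continuous_hilbert_bundle G B \<and>
     (\<forall>u\<in>gunits G. vecs (fib B u) \<noteq> {0}) \<and> countably_generated G B \<and>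
     (\<forall>x\<in>arrows G. unitary_between (fib B (gsrc G x)) (fib B (grng G x)) (\<pi> x)) \<and>
     (\<forall>u\<in>gunits G. \<forall>v\<in>vecs (fib B u). \<pi> u v = v) \<and>
     (\<forall>x\<in>arrows G. \<forall>y\<in>arrows G. gsrc G x = grng G y \<longrightarrow>
        (\<forall>v\<in>vecs (fib B (gsrc G y)). \<pi> (gmul G x y) v = \<pi> x (\<pi> y v))) \<and>
     (\<forall>x\<in>arrows G.
        (\<forall>v\<in>vecs (fib B (gsrc G x)). \<pi> (ginv G x) (\<pi> x v) = v) \<and>
        (\<forall>w\<in>vecs (fib B (grng G x)). \<pi> x (\<pi> (ginv G x) w) = w)) \<and>
     (\<forall>\<xi>\<in>C0_sections G B. \<forall>\<eta>\<in>C0_sections G B.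
        continuous_map (gtop G) euclidean
          (\<lambda>x. ip (fib B (grng G x)) (\<pi> x (\<xi> (gsrc G x))) (\<eta> (grng G x))))"


section \<open>Amenable representations\<close>

definition adjointable ::
  "'g groupoid \<Rightarrow> ('g, 'v::complex_vector) hilbert_bundle \<Rightarrow> (('g \<Rightarrow> 'v) \<Rightarrow> 'g \<Rightarrow> 'v) \<Rightarrow> bool" where
  "adjointable G B T \<longleftrightarrow>
     T ` C0_sections G B \<subseteq> C0_sections G B \<and>
     (\<exists>S. S ` C0_sections G B \<subseteq> C0_sections G B \<and>
        (\<forall>\<xi>\<in>C0_sections G B. \<forall>\<eta>\<in>C0_sections G B. \<forall>u\<in>gunits G.
           ip (fib B u) (T \<xi> u) (\<eta> u) = ip (fib B u) (\<xi> u) (S \<eta> u)))"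

text \<open>
  For adjointable \<open>T\<close> the value \<open>T \<xi> u\<close> depends on \<open>\<xi>\<close> only through \<open>\<xi> u\<close>, and every vector of
  the fiber at \<open>u\<close> is of the form \<open>\<xi> u\<close>.
\<close>

definition localization ::
  "'g groupoid \<Rightarrow> ('g, 'v::complex_vector) hilbert_bundle \<Rightarrow> (('g \<Rightarrow> 'v) \<Rightarrow> 'g \<Rightarrow> 'v) \<Rightarrow>
   'g \<Rightarrow> 'v \<Rightarrow> 'v" where
  "localization G B T u v = (THE w. \<exists>\<xi>\<in>C0_sections G B. \<xi> u = v \<and> w = T \<xi> u)"

definition hilbert_schmidt ::
  "'g groupoid \<Rightarrow> ('g, 'v::complex_vector) hilbert_bundle \<Rightarrow> (('g \<Rightarrow> 'v) \<Rightarrow> 'g \<Rightarrow> 'v) \<Rightarrow> bool" where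
  "hilbert_schmidt G B T \<longleftrightarrow>
     adjointable G B T \<and>
     (\<forall>u\<in>gunits G. has_finite_trace (fib B u) (abs_square (fib B u) (localization G B T u))) \<and>
     C0_function (unit_top G)
       (\<lambda>u. op_trace (fib B u) (abs_square (fib B u) (localization G B T u)))"

definition hs_sup_norm ::
  "'g groupoid \<Rightarrow> ('g, 'v::complex_vector) hilbert_bundle \<Rightarrow> (('g \<Rightarrow> 'v) \<Rightarrow> 'g \<Rightarrow> 'v) \<Rightarrow> real" where
  "hs_sup_norm G B T = (SUP u\<in>gunits G. hs_norm (fib B u) (localization G B T u))"

definition translate_op ::
  "'g groupoid \<Rightarrow> ('g \<Rightarrow> 'v \<Rightarrow> 'v) \<Rightarrow> 'g \<Rightarrow> ('v \<Rightarrow> 'v) \<Rightarrow> 'v \<Rightarrow> 'v" where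
  "translate_op G \<pi> x A = \<pi> x \<circ> A \<circ> \<pi> (ginv G x)"

text \<open>
  A net of operators is represented by the proper filter generated by its tails.  Conversely every
  proper filter arises from a net in this way, so index sets of arbitrary size are covered.
\<close>

definition amenable_rep ::
  "'g groupoid \<Rightarrow> ('g, 'v::complex_vector) hilbert_bundle \<Rightarrow> ('g \<Rightarrow> 'v \<Rightarrow> 'v) \<Rightarrow> bool" where
  "amenable_rep G B \<pi> \<longleftrightarrow>
     (\<exists>F :: (('g \<Rightarrow> 'v) \<Rightarrow> 'g \<Rightarrow> 'v) filter. F \<noteq> bot \<and>
        (\<forall>\<^sub>F T in F. hilbert_schmidt G B T \<and> hs_sup_norm G B T \<le> 1) \<and>
        (\<forall>C. compactin (unit_top G) C \<longrightarrow>
           uniform_limit C (\<lambda>T u. hs_norm (fib B u) (localization G B T u)) (\<lambda>_. 1) F) \<and>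
        (\<forall>C. compactin (gtop G) C \<longrightarrow>
           uniform_limit C
             (\<lambda>T x. hs_inner (fib B (grng G x))
                (translate_op G \<pi> x (localization G B T (gsrc G x)))
                (localization G B T (grng G x)))
             (\<lambda>_. 1) F))"


section \<open>The HLS groupoid of an approximated group\<close>

locale approximated_group = group \<Gamma> for \<Gamma> :: "('a, 'm) monoid_scheme" (structure) +
  fixes K :: "nat \<Rightarrow> 'a set"
  assumes K_normal: "K n \<lhd> \<Gamma>"
    and K_finite_index: "finite (rcosets K n)"
    and K_decreasing: "K (Suc n) \<subseteq> K n"
    and K_inter: "(\<Inter>n. K n) = {\<one>}"

text \<open>
  \<open>Level n A\<close> is the arrow \<open>(n, A)\<close> with \<open>A\<close> in the quotient group at level \<open>n\<close>, and
  \<open>Limit g\<close> is \<open>(\<infinity>, g)\<close>.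
\<close>

datatype 'a hls = Level nat "'a set" | Limit 'a

definition hls_point ::
  "('a, 'm) monoid_scheme \<Rightarrow> (nat \<Rightarrow> 'a set) \<Rightarrow> enat \<Rightarrow> 'a \<Rightarrow> 'a hls" where
  "hls_point \<Gamma> K n g = (case n of enat k \<Rightarrow> Level k (K k #>\<^bsub>\<Gamma>\<^esub> g) | \<infinity> \<Rightarrow> Limit g)"

definition hls_topology ::
  "('a, 'm) monoid_scheme \<Rightarrow> (nat \<Rightarrow> 'a set) \<Rightarrow> 'a hls topology" where
  "hls_topology \<Gamma> K = topology_generated_by
     ({{Level n A} | n A. A \<in> carrier (\<Gamma> Mod K n)} \<union>
      {{hls_point \<Gamma> K n g | n. enat N < n} | g N. g \<in> carrier \<Gamma>})"

fun hls_unit :: "('a, 'm) monoid_scheme \<Rightarrow> (nat \<Rightarrow> 'a set) \<Rightarrow> 'a hls \<Rightarrow> 'a hls" where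
  "hls_unit \<Gamma> K (Level n A) = Level n \<one>\<^bsub>\<Gamma> Mod K n\<^esub>"
| "hls_unit \<Gamma> K (Limit g) = Limit \<one>\<^bsub>\<Gamma>\<^esub>"

fun hls_mul :: "('a, 'm) monoid_scheme \<Rightarrow> (nat \<Rightarrow> 'a set) \<Rightarrow> 'a hls \<Rightarrow> 'a hls \<Rightarrow> 'a hls" where
  "hls_mul \<Gamma> K (Level n A) (Level m A') =
     (if n = m then Level n (A \<otimes>\<^bsub>\<Gamma> Mod K n\<^esub> A') else undefined)"
| "hls_mul \<Gamma> K (Limit g) (Limit h) = Limit (g \<otimes>\<^bsub>\<Gamma>\<^esub> h)"
| "hls_mul \<Gamma> K _ _ = undefined"

fun hls_inv :: "('a, 'm) monoid_scheme \<Rightarrow> (nat \<Rightarrow> 'a set) \<Rightarrow> 'a hls \<Rightarrow> 'a hls" where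
  "hls_inv \<Gamma> K (Level n A) = Level n (inv\<^bsub>\<Gamma> Mod K n\<^esub> A)"
| "hls_inv \<Gamma> K (Limit g) = Limit (inv\<^bsub>\<Gamma>\<^esub> g)"

definition hls_groupoid ::
  "('a, 'm) monoid_scheme \<Rightarrow> (nat \<Rightarrow> 'a set) \<Rightarrow> 'a hls groupoid" where
  "hls_groupoid \<Gamma> K =
     \<lparr>gtop = hls_topology \<Gamma> K,
      gunits = {hls_point \<Gamma> K n \<one>\<^bsub>\<Gamma>\<^esub> | n. True},
      gsrc = hls_unit \<Gamma> K,
      grng = hls_unit \<Gamma> K,
      gmul = hls_mul \<Gamma> K,
      ginv = hls_inv \<Gamma> K\<rparr>"


section \<open>Restriction to the limit group\<close>

definition limit_fiber ::
  "('a, 'm) monoid_scheme \<Rightarrow> ('a hls, 'v) hilbert_bundle \<Rightarrow> 'v inner_space" where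
  "limit_fiber \<Gamma> B = fib B (Limit \<one>\<^bsub>\<Gamma>\<^esub>)"

definition limit_rep :: "('a hls \<Rightarrow> 'v \<Rightarrow> 'v) \<Rightarrow> 'a \<Rightarrow> 'v \<Rightarrow> 'v" where
  "limit_rep \<pi> g = \<pi> (Limit g)"

definition has_finite_dim_subrep ::
  "('a, 'm) monoid_scheme \<Rightarrow> 'v::complex_vector inner_space \<Rightarrow> ('a \<Rightarrow> 'v \<Rightarrow> 'v) \<Rightarrow> bool" where
  "has_finite_dim_subrep \<Gamma> H \<rho> \<longleftrightarrow>
     (\<exists>V. complex_vector.subspace V \<and> V \<subseteq> vecs H \<and> V \<noteq> {0} \<and>
        (\<exists>E. finite E \<and> V = complex_vector.span E) \<and>
        (\<forall>g\<in>carrier \<Gamma>. \<rho> g ` V \<subseteq> V))"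

end

theory Submission
  imports Defs
begin

text \<open>
  For the forward direction, restriction to the limit group turns unitary representations of \<open>\<Gamma>\<close> into
  representations of \<open>Cc\<close>, so topological property (T) of the groupoid gives property (T) of \<open>\<Gamma>\<close>.
  Amenability provides almost invariant vectors for the conjugation action of \<open>\<Gamma>\<close> on the
  Hilbert--Schmidt operators of the limit fiber, hence a nonzero invariant operator \<open>T\<close>, and the
  eigenspace of \<open>T\<^sup>* T\<close> for its largest eigenvalue is finite-dimensional and invariant.

  Conversely, let \<open>V\<close> be a finite-dimensional invariant subspace of the limit fiber, and extend an
  orthonormal basis of \<open>V\<close> to continuous sections.  The normalized sums of the rank-one operators along
  these sections are almost invariant near the limit.  At the finitely many remaining levels they are
  replaced by exactly invariant operators, obtained by summing the rank-one operators along an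
  orbit of the finite quotient group.
\<close>

section \<open>Hilbert spaces on subspaces\<close>

text \<open>\<open>topological_property_T\<close> speaks only about Hilbert spaces inside
  \<open>nat \<Rightarrow> complex\<close>, whereas the Hilbert-Schmidt operators of the limit fiber
  live in \<open>'v \<Rightarrow> 'v\<close>. Separability bridges the gap: an operator is
  determined by its matrix coefficients along a dense sequence, and this linear injection carries
  the Hilbert space structure over. The largest eigenvalue comes from a limit: once
  \<open>T\<^sup>* T\<close> is divided by its norm, its even powers converge in the Hilbert-Schmidt
  norm to a nonzero operator whose values are fixed vectors. In the converse everything reduces to
  inner products of sections, because the Hilbert-Schmidt inner product of two sums of rank-one
  operators is the sum of the squared moduli of the inner products of their vectors
  (\<open>gram\<close>). Continuity of matrix coefficients thus controls norms and translates near
  the limit, but nothing at a fixed finite level. A compact set of arrows leaves a given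
  neighbourhood of its limit arrows at finitely many levels only; this is why a sequence of
  operators, each corrected on one more level, yields uniform convergence.\<close>

lemma span_finite_subset:
  assumes "z \<in> complex_vector.span E"
  shows "\<exists>F. finite F \<and> F \<subseteq> E \<and> z \<in> complex_vector.span F"
proof -
  obtain t r where t: "finite t" "t \<subseteq> E" "z = (\<Sum>a\<in>t. r a *\<^sub>C a)"
    using assms unfolding complex_vector.span_explicit by blast
  then have "z \<in> complex_vector.span t"
    by (auto intro: complex_vector.span_sum complex_vector.span_scale complex_vector.span_base)
  with t show ?thesis by blast
qed

locale hilb =
  fixes H :: "'v::complex_vector inner_space"
  assumes hilbert: "hilbert_space H"
begin

lemma subspace: "complex_vector.subspace (vecs H)"
  using hilbert by (simp add: hilbert_space_def)

lemma zero_in [simp]: "0 \<in> vecs H"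
  and add_in [simp]: "v \<in> vecs H \<Longrightarrow> w \<in> vecs H \<Longrightarrow> v + w \<in> vecs H"
  and diff_in [simp]: "v \<in> vecs H \<Longrightarrow> w \<in> vecs H \<Longrightarrow> v - w \<in> vecs H"
  and scale_in [simp]: "v \<in> vecs H \<Longrightarrow> c *\<^sub>C v \<in> vecs H"
  and sum_in: "(\<And>i. i \<in> I \<Longrightarrow> f i \<in> vecs H) \<Longrightarrow> sum f I \<in> vecs H"
  using subspace
  by (auto simp: complex_vector.subspace_0 complex_vector.subspace_add complex_vector.subspace_diff
      complex_vector.subspace_neg complex_vector.subspace_scale intro: complex_vector.subspace_sum)

lemma span_in: "A \<subseteq> vecs H \<Longrightarrow> complex_vector.span A \<subseteq> vecs H"
  using subspace by (rule complex_vector.span_minimal[rotated])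

lemma ip_axioms:
  "\<forall>u\<in>vecs H. \<forall>v\<in>vecs H. \<forall>w\<in>vecs H. ip H (u + v) w = ip H u w + ip H v w"
  "\<forall>c. \<forall>v\<in>vecs H. \<forall>w\<in>vecs H. ip H (c *\<^sub>C v) w = c * ip H v w"
  "\<forall>v\<in>vecs H. \<forall>w\<in>vecs H. ip H w v = cnj (ip H v w)"
  "\<forall>v\<in>vecs H. 0 \<le> Re (ip H v v)"
  "\<forall>v\<in>vecs H. ip H v v = 0 \<longrightarrow> v = 0"
  "\<forall>s :: nat \<Rightarrow> 'v. range s \<subseteq> vecs H \<and>
     (\<forall>\<epsilon>>0. \<exists>N. \<forall>m\<ge>N. \<forall>n\<ge>N. hnorm H (s m - s n) < \<epsilon>) \<longrightarrow>
     (\<exists>l\<in>vecs H. (\<lambda>n. hnorm H (s n - l)) \<longlonglongrightarrow> 0)"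
  using hilbert unfolding hilbert_space_def by - (elim conjE, assumption)+

lemma ip_add_left: "u \<in> vecs H \<Longrightarrow> v \<in> vecs H \<Longrightarrow> w \<in> vecs H \<Longrightarrow> ip H (u + v) w = ip H u w + ip H v w"
  using ip_axioms(1) by blast

lemma ip_scale_left: "v \<in> vecs H \<Longrightarrow> w \<in> vecs H \<Longrightarrow> ip H (c *\<^sub>C v) w = c * ip H v w"
  using ip_axioms(2) by blast

lemma ip_cnj: "v \<in> vecs H \<Longrightarrow> w \<in> vecs H \<Longrightarrow> ip H w v = cnj (ip H v w)"
  using ip_axioms(3) by blast

lemma ip_nonneg: "v \<in> vecs H \<Longrightarrow> 0 \<le> Re (ip H v v)"
  using ip_axioms(4) by blast

lemma ip_eq_0: "v \<in> vecs H \<Longrightarrow> ip H v v = 0 \<Longrightarrow> v = 0"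
  using ip_axioms(5) by blast

lemma complete:
  assumes "\<And>n::nat. s n \<in> vecs H" "\<And>\<epsilon>. \<epsilon> > 0 \<Longrightarrow> \<exists>N. \<forall>m\<ge>N. \<forall>n\<ge>N. hnorm H (s m - s n) < \<epsilon>"
  obtains l where "l \<in> vecs H" "(\<lambda>n. hnorm H (s n - l)) \<longlonglongrightarrow> 0"
proof -
  have "range s \<subseteq> vecs H" using assms(1) by auto
  then have "\<exists>l\<in>vecs H. (\<lambda>n. hnorm H (s n - l)) \<longlonglongrightarrow> 0"
    by (intro ip_axioms(6)[rule_format] conjI allI impI assms(2))
  then show ?thesis using that by (elim bexE)
qed

lemma ip_add_right: "u \<in> vecs H \<Longrightarrow> v \<in> vecs H \<Longrightarrow> w \<in> vecs H \<Longrightarrow> ip H w (u + v) = ip H w u + ip H w v"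
  by (metis add_in complex_cnj_add ip_add_left ip_cnj)

lemma ip_scale_right: "v \<in> vecs H \<Longrightarrow> w \<in> vecs H \<Longrightarrow> ip H w (c *\<^sub>C v) = cnj c * ip H w v"
  by (metis complex_cnj_mult ip_cnj ip_scale_left scale_in)

lemma ip_zero_left [simp]: "w \<in> vecs H \<Longrightarrow> ip H 0 w = 0"
  using ip_add_left[of 0 0 w] by simp

lemma ip_zero_right [simp]: "w \<in> vecs H \<Longrightarrow> ip H w 0 = 0"
  using ip_add_right[of 0 0 w] by simp

lemma ip_diff_left: "u \<in> vecs H \<Longrightarrow> v \<in> vecs H \<Longrightarrow> w \<in> vecs H \<Longrightarrow> ip H (u - v) w = ip H u w - ip H v w"
  using ip_add_left[of "u - v" v w] by simp

lemma ip_diff_right: "u \<in> vecs H \<Longrightarrow> v \<in> vecs H \<Longrightarrow> w \<in> vecs H \<Longrightarrow> ip H w (u - v) = ip H w u - ip H w v"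
  using ip_add_right[of "u - v" v w] by simp

lemma ip_sum_left:
  "(\<And>i. i \<in> I \<Longrightarrow> f i \<in> vecs H) \<Longrightarrow> w \<in> vecs H \<Longrightarrow> ip H (sum f I) w = (\<Sum>i\<in>I. ip H (f i) w)"
  by (induction I rule: infinite_finite_induct) (auto simp: ip_add_left sum_in)

lemma ip_sum_right:
  "(\<And>i. i \<in> I \<Longrightarrow> f i \<in> vecs H) \<Longrightarrow> w \<in> vecs H \<Longrightarrow> ip H w (sum f I) = (\<Sum>i\<in>I. ip H w (f i))"
  by (induction I rule: infinite_finite_induct) (auto simp: ip_add_right sum_in)

lemma norm_nonneg [simp]: "v \<in> vecs H \<Longrightarrow> 0 \<le> hnorm H v"
  by (simp add: hnorm_def ip_nonneg)

lemma norm_sq: "v \<in> vecs H \<Longrightarrow> (hnorm H v)\<^sup>2 = Re (ip H v v)"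
  by (simp add: hnorm_def ip_nonneg)

lemma ip_self: "v \<in> vecs H \<Longrightarrow> ip H v v = of_real ((hnorm H v)\<^sup>2)"
  using ip_cnj[of v v] by (simp add: norm_sq complex_eq_iff)

lemma norm_eq_0 [simp]: "v \<in> vecs H \<Longrightarrow> hnorm H v = 0 \<longleftrightarrow> v = 0"
  using ip_self[of v] ip_eq_0[of v] by (auto simp: hnorm_def)

lemma norm_zero [simp]: "hnorm H 0 = 0"
  by simp

lemma ip_mult_cnj:
  "v \<in> vecs H \<Longrightarrow> w \<in> vecs H \<Longrightarrow> ip H v w * ip H w v = of_real ((cmod (ip H v w))\<^sup>2)"
  using ip_cnj[of v w] by (simp only: complex_norm_square)

lemma norm_pos: "v \<in> vecs H \<Longrightarrow> v \<noteq> 0 \<Longrightarrow> 0 < hnorm H v"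
  using norm_nonneg norm_eq_0 by (metis less_eq_real_def)

lemma norm_scale: "v \<in> vecs H \<Longrightarrow> hnorm H (c *\<^sub>C v) = cmod c * hnorm H v"
proof -
  assume v: "v \<in> vecs H"
  have "ip H (c *\<^sub>C v) (c *\<^sub>C v) = c * cnj c * ip H v v"
    using v by (simp add: ip_scale_left ip_scale_right)
  also have "\<dots> = of_real ((cmod c)\<^sup>2 * (hnorm H v)\<^sup>2)"
    by (simp only: complex_norm_square[symmetric] ip_self[OF v] of_real_mult)
  finally have "hnorm H (c *\<^sub>C v) = sqrt ((cmod c * hnorm H v)\<^sup>2)"
    unfolding hnorm_def[of H "c *\<^sub>C v"] by (simp add: power_mult_distrib)
  then show ?thesis using v by simp
qed

lemma norm_diff_sq:
  "v \<in> vecs H \<Longrightarrow> w \<in> vecs H \<Longrightarrow>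
   (hnorm H (v - w))\<^sup>2 = (hnorm H v)\<^sup>2 + (hnorm H w)\<^sup>2 - 2 * Re (ip H v w)"
  using ip_cnj[of v w] by (simp add: norm_sq ip_diff_left ip_diff_right)

lemma norm_add_sq:
  "v \<in> vecs H \<Longrightarrow> w \<in> vecs H \<Longrightarrow>
   (hnorm H (v + w))\<^sup>2 = (hnorm H v)\<^sup>2 + (hnorm H w)\<^sup>2 + 2 * Re (ip H v w)"
  using ip_cnj[of v w] by (simp add: norm_sq ip_add_left ip_add_right)

lemma norm_minus_commute: "v \<in> vecs H \<Longrightarrow> w \<in> vecs H \<Longrightarrow> hnorm H (v - w) = hnorm H (w - v)"
  using norm_scale[of "v - w" "-1"] by (simp add: scaleC_one)

lemma cauchy_schwarz:
  assumes v: "v \<in> vecs H" and w: "w \<in> vecs H"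
  shows "cmod (ip H v w) \<le> hnorm H v * hnorm H w"
proof (cases "w = 0")
  case False
  define n where "n = (hnorm H w)\<^sup>2"
  have n: "n > 0" using norm_pos[OF w False] by (simp add: n_def)
  define c where "c = ip H v w / of_real n"
  have "0 \<le> (hnorm H (v - c *\<^sub>C w))\<^sup>2" by simp
  also have "\<dots> = (hnorm H v)\<^sup>2 + (cmod c)\<^sup>2 * n - 2 * Re (cnj c * ip H v w)"
    using v w by (simp add: norm_diff_sq norm_scale ip_scale_right power_mult_distrib n_def)
  also have "cnj c * ip H v w = of_real ((cmod (ip H v w))\<^sup>2 / n)"
    unfolding c_def by (simp add: complex_norm_square mult.commute del: of_real_power)
  also have "(cmod c)\<^sup>2 * n = (cmod (ip H v w))\<^sup>2 / n"
    using n by (simp add: c_def norm_divide power_divide power2_eq_square)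
  finally have "(cmod (ip H v w))\<^sup>2 \<le> (hnorm H v)\<^sup>2 * n"
    using n by (simp add: field_simps)
  then show ?thesis
    using v w by (simp add: n_def power_mult_distrib[symmetric] power2_le_iff_abs_le)
qed (use v in simp)

lemma norm_triangle:
  assumes v: "v \<in> vecs H" and w: "w \<in> vecs H"
  shows "hnorm H (v + w) \<le> hnorm H v + hnorm H w"
proof (rule power2_le_imp_le)
  have "Re (ip H v w) \<le> hnorm H v * hnorm H w"
    using cauchy_schwarz[OF v w] complex_Re_le_cmod order_trans by blast
  then show "(hnorm H (v + w))\<^sup>2 \<le> (hnorm H v + hnorm H w)\<^sup>2"
    using v w by (simp add: norm_add_sq power2_sum)
qed (use v w in simp)

lemma norm_triangle_sub:
  assumes "u \<in> vecs H" "v \<in> vecs H" "w \<in> vecs H"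
  shows "hnorm H (u - w) \<le> hnorm H (u - v) + hnorm H (v - w)"
  using norm_triangle[of "u - v" "v - w"] assms by simp

lemma norm_triangle_diff:
  assumes "u \<in> vecs H" "v \<in> vecs H"
  shows "\<bar>hnorm H u - hnorm H v\<bar> \<le> hnorm H (u - v)"
  using norm_triangle[of "u - v" v] norm_triangle[of "v - u" u] norm_minus_commute[of u v] assms by simp

lemma norm_sum_le:
  "(\<And>i. i \<in> I \<Longrightarrow> f i \<in> vecs H) \<Longrightarrow> hnorm H (sum f I) \<le> (\<Sum>i\<in>I. hnorm H (f i))"
proof (induction I rule: infinite_finite_induct)
  case (insert x F)
  then show ?case using norm_triangle[of "f x" "sum f F"] by (auto simp: sum_in)
qed auto

lemma eqI_ip:
  assumes "u \<in> vecs H" "v \<in> vecs H" "\<And>w. w \<in> vecs H \<Longrightarrow> ip H u w = ip H v w"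
  shows "u = v"
  using ip_eq_0[of "u - v"] assms by (simp add: ip_diff_left)

lemma ip_tendsto:
  assumes s: "\<And>n. s n \<in> vecs H" "l \<in> vecs H" "w \<in> vecs H" "((\<lambda>n. hnorm H (s n - l)) \<longlongrightarrow> 0) F"
  shows "((\<lambda>n. ip H (s n) w) \<longlongrightarrow> ip H l w) F"
proof -
  have "((\<lambda>n. hnorm H (s n - l) * hnorm H w) \<longlongrightarrow> 0) F"
    using tendsto_mult[OF s(4) tendsto_const[of "hnorm H w"]] by simp
  moreover have "norm (ip H (s n) w - ip H l w) \<le> hnorm H (s n - l) * hnorm H w" for n
    using cauchy_schwarz[of "s n - l" w] s by (simp add: ip_diff_left)
  ultimately have "((\<lambda>n. ip H (s n) w - ip H l w) \<longlongrightarrow> 0) F"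
    by (rule Lim_null_comparison[OF always_eventually[OF allI], rotated])
  then show ?thesis by (rule LIM_zero_cancel)
qed

lemma norm_tendsto:
  assumes s: "\<And>n. s n \<in> vecs H" "l \<in> vecs H" "((\<lambda>n. hnorm H (s n - l)) \<longlongrightarrow> 0) F"
  shows "((\<lambda>n. hnorm H (s n)) \<longlongrightarrow> hnorm H l) F"
proof -
  have "((\<lambda>n. hnorm H (s n) - hnorm H l) \<longlongrightarrow> 0) F"
    by (rule Lim_null_comparison[OF always_eventually[OF allI] s(3)])
      (use norm_triangle_diff s in simp)
  then show ?thesis by (rule LIM_zero_cancel)
qed

lemma limit_unique:
  fixes s :: "nat \<Rightarrow> 'v"
  assumes "\<And>n. s n \<in> vecs H" "l \<in> vecs H" "l' \<in> vecs H"
    "(\<lambda>n. hnorm H (s n - l)) \<longlonglongrightarrow> 0" "(\<lambda>n. hnorm H (s n - l')) \<longlonglongrightarrow> 0"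
  shows "l = l'"
  using assms by (intro eqI_ip) (blast intro: LIMSEQ_unique ip_tendsto)+

text \<open>Needed where only norms are known to be preserved: it upgrades the norm identity for the
  conjugation action to one for inner products.\<close>

lemma ip_polarize:
  assumes "u \<in> vecs H" "v \<in> vecs H"
  shows "ip H u v = Complex (((hnorm H (u + v))\<^sup>2 - (hnorm H (u - v))\<^sup>2) / 4)
    (((hnorm H (u + \<i> *\<^sub>C v))\<^sup>2 - (hnorm H (u - \<i> *\<^sub>C v))\<^sup>2) / 4)"
  using assms by (simp add: norm_add_sq norm_diff_sq ip_scale_right complex_eq_iff)

subsection \<open>Orthonormal sets\<close>

definition ortho :: "'v set \<Rightarrow> bool" where
  "ortho E \<longleftrightarrow> E \<subseteq> vecs H \<and> (\<forall>e\<in>E. \<forall>e'\<in>E. ip H e e' = (if e = e' then 1 else 0))"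

lemma orthoD: "ortho E \<Longrightarrow> e \<in> E \<Longrightarrow> e \<in> vecs H"
  and ortho_ip: "ortho E \<Longrightarrow> e \<in> E \<Longrightarrow> e' \<in> E \<Longrightarrow> ip H e e' = (if e = e' then 1 else 0)"
  by (auto simp: ortho_def)

lemma ortho_norm: "ortho E \<Longrightarrow> e \<in> E \<Longrightarrow> hnorm H e = 1"
  by (simp add: hnorm_def ortho_ip)

definition proj :: "'v set \<Rightarrow> 'v \<Rightarrow> 'v" where
  "proj F v = (\<Sum>e\<in>F. ip H v e *\<^sub>C e)"

lemma proj_in: "ortho F \<Longrightarrow> proj F v \<in> vecs H"
  by (auto simp: proj_def intro!: sum_in dest: orthoD)

lemma proj_span: "proj F v \<in> complex_vector.span F"
  unfolding proj_def
  by (intro complex_vector.span_sum complex_vector.span_scale complex_vector.span_base)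

lemma ip_proj:
  assumes "ortho F" "v \<in> vecs H" "w \<in> vecs H"
  shows "ip H (proj F v) w = (\<Sum>e\<in>F. ip H v e * ip H e w)"
  unfolding proj_def using assms
  by (subst ip_sum_left) (auto simp: ip_scale_left orthoD intro!: sum.cong)

lemma ip_proj_base:
  assumes "ortho F" "finite F" "v \<in> vecs H" "e \<in> F"
  shows "ip H (proj F v) e = ip H v e"
  using assms by (simp add: ip_proj orthoD ortho_ip if_distrib cong: if_cong)

lemma span_orthogonal:
  assumes F: "F \<subseteq> vecs H" and z: "z \<in> vecs H" "\<And>e. e \<in> F \<Longrightarrow> ip H z e = 0"
    and w: "w \<in> complex_vector.span F"
  shows "ip H z w = 0"
proof -
  have "w \<in> vecs H \<and> ip H z w = 0"
    using w by (induction rule: complex_vector.span_induct_alt)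
      (use F z in \<open>auto simp: ip_add_right ip_scale_right\<close>)
  then show ?thesis ..
qed

lemma ip_sub_proj:
  assumes "ortho F" "finite F" "v \<in> vecs H" "w \<in> complex_vector.span F"
  shows "ip H (v - proj F v) w = 0"
proof (rule span_orthogonal[OF _ _ _ assms(4)])
  show "F \<subseteq> vecs H" using assms(1) by (simp add: ortho_def)
  show "v - proj F v \<in> vecs H" using assms(3) proj_in[OF assms(1)] by simp
  show "ip H (v - proj F v) e = 0" if "e \<in> F" for e
    using that assms proj_in[OF assms(1)] orthoD[OF assms(1) that]
    by (simp add: ip_diff_left ip_proj_base)
qed

text \<open>Pythagoras: \<open>v - proj F v\<close> is orthogonal to the span of \<open>F\<close>,
  hence to \<open>w - proj F v\<close>.\<close>

lemma proj_best:
  assumes F: "ortho F" "finite F" and v: "v \<in> vecs H" and w: "w \<in> complex_vector.span F"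
  shows "hnorm H (v - proj F v) \<le> hnorm H (v - w)"
proof (rule power2_le_imp_le)
  have w': "w \<in> vecs H" using span_in[of F] F(1) w by (auto simp: ortho_def)
  have "w - proj F v \<in> complex_vector.span F"
    using w proj_span by (rule complex_vector.span_diff)
  then have "ip H (v - proj F v) (w - proj F v) = 0" by (rule ip_sub_proj[OF F v])
  then have "(hnorm H (v - w))\<^sup>2 = (hnorm H (v - proj F v))\<^sup>2 + (hnorm H (w - proj F v))\<^sup>2"
    using norm_diff_sq[of "v - proj F v" "w - proj F v"] v w' proj_in[OF F(1)] by simp
  then show "(hnorm H (v - proj F v))\<^sup>2 \<le> (hnorm H (v - w))\<^sup>2" by simp
qed (use v span_in[of F] F(1) w in \<open>auto simp: ortho_def\<close>)

lemma proj_id: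
  assumes F: "ortho F" "finite F" and v: "v \<in> complex_vector.span F"
  shows "proj F v = v"
proof -
  have v': "v \<in> vecs H" using span_in[of F] F(1) v by (auto simp: ortho_def)
  have "hnorm H (v - proj F v) \<le> 0" using proj_best[OF F v' v] by simp
  then have "hnorm H (v - proj F v) = 0"
    using v' proj_in[OF F(1)] by (intro antisym norm_nonneg) auto
  then show ?thesis using v' proj_in[OF F(1)] by simp
qed

text \<open>One Gram-Schmidt step: normalize the residual of \<open>v\<close> after projection,
  unless it vanishes, in which case \<open>F\<close> itself serves.\<close>

lemma ortho_extend:
  assumes F: "ortho F" "finite F" and v: "v \<in> vecs H"
  shows "\<exists>F'. F \<subseteq> F' \<and> finite F' \<and> ortho F' \<and> complex_vector.span F' = complex_vector.span (insert v F)"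
proof (cases "v \<in> complex_vector.span F")
  case True
  then show ?thesis using F complex_vector.span_redundant by blast
next
  case False
  define z where "z = v - proj F v"
  have z: "z \<in> vecs H" using v F proj_in by (simp add: z_def)
  have z0: "z \<noteq> 0" using False proj_span by (metis eq_iff_diff_eq_0 z_def)
  define n where "n = hnorm H z"
  have n: "n > 0" using norm_pos z z0 by (simp add: n_def)
  define e where "e = of_real (1 / n) *\<^sub>C z"
  have e: "e \<in> vecs H" using z by (simp add: e_def)
  have ee: "ip H e e = 1"
    using e n z by (simp add: ip_self[OF e]) (simp add: e_def norm_scale norm_divide flip: n_def)
  have ef: "ip H e f = 0" if "f \<in> F" for f
    using that ip_sub_proj[OF F v complex_vector.span_base] z orthoD[OF F(1)]
    by (simp add: e_def ip_scale_left flip: z_def)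
  have fe: "ip H f e = 0" if "f \<in> F" for f
    using ef[OF that] ip_cnj[of e f] e orthoD[OF F(1) that] by simp
  have "ortho (insert e F)"
    using F(1) e ee ef fe by (auto simp: ortho_def)
  moreover have "complex_vector.span (insert e F) = complex_vector.span (insert v F)"
  proof (rule complex_vector.span_eq[THEN iffD2], intro conjI)
    have m: "F \<subseteq> complex_vector.span (insert x F)" "proj F v \<in> complex_vector.span (insert x F)"
      "x \<in> complex_vector.span (insert x F)" for x
      using complex_vector.span_superset[of "insert x F"] proj_span[of F v]
        complex_vector.span_mono[of F "insert x F"] by auto
    have "e \<in> complex_vector.span (insert v F)"
      unfolding e_def z_def by (intro complex_vector.span_scale complex_vector.span_diff m)
    then show "insert e F \<subseteq> complex_vector.span (insert v F)" using m by auto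
    have "v = of_real n *\<^sub>C e + proj F v"
      using n by (simp add: e_def z_def scaleC_scaleC scaleC_one)
    moreover have "of_real n *\<^sub>C e + proj F v \<in> complex_vector.span (insert e F)"
      by (intro complex_vector.span_scale complex_vector.span_add m)
    ultimately have "v \<in> complex_vector.span (insert e F)" by simp
    then show "insert v F \<subseteq> complex_vector.span (insert e F)" using m by auto
  qed
  ultimately show ?thesis using F(2) by (intro exI[of _ "insert e F"]) auto
qed

lemma finite_ortho_basis:
  assumes "finite A" "A \<subseteq> vecs H"
  shows "\<exists>F. finite F \<and> ortho F \<and> complex_vector.span F = complex_vector.span A"
  using assms
proof (induction A)
  case empty
  show ?case by (intro exI[of _ "{}"]) (simp add: ortho_def)
next
  case (insert x A)
  then obtain F where F: "finite F" "ortho F" "complex_vector.span F = complex_vector.span A" by auto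
  with ortho_extend[of F x] insert.prems obtain F' where
    F': "finite F'" "ortho F'" "complex_vector.span F' = complex_vector.span (insert x F)" by auto
  then show ?case using F(3) by (auto simp: complex_vector.span_insert)
qed

section \<open>Orthonormal bases of separable spaces and Parseval's identity\<close>

lemma basis_ortho: "orthonormal_basis H E \<longleftrightarrow> ortho E \<and> dense_in H (complex_vector.span E)"
  by (auto simp: orthonormal_basis_def ortho_def)

lemma dense_superset:
  "dense_in H S \<Longrightarrow> S \<subseteq> S' \<Longrightarrow> S' \<subseteq> vecs H \<Longrightarrow> dense_in H S'"
  unfolding dense_in_def by blast

text \<open>Gram-Schmidt along a dense sequence: dependent choice yields increasing finite
  orthonormal sets whose spans absorb one more term each time, and their union is a basis. This
  existence is what gives the \<open>SOME\<close> in \<open>chosen_basis\<close> a meaning.\<close>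

lemma separable_basis:
  assumes "separable_hilbert H"
  shows "\<exists>E. orthonormal_basis H E"
proof -
  obtain S where S: "countable S" "dense_in H S" using assms by (auto simp: separable_hilbert_def)
  have "S \<noteq> {}" using S(2) zero_in zero_less_one[where ?'a = real] unfolding dense_in_def by blast
  then obtain s :: "nat \<Rightarrow> 'v" where s: "range s = S"
    using S(1) range_from_nat_into[of S] that by blast
  have sH: "s n \<in> vecs H" for n using S(2) s by (auto simp: dense_in_def)
  define P where "P n F \<longleftrightarrow> finite F \<and> ortho F \<and> (\<forall>i<n. s i \<in> complex_vector.span F)" for n F
  have "\<exists>F'. P (Suc n) F' \<and> F \<subseteq> F'" if F: "P n F" for n F
  proof -
    obtain F' where F': "F \<subseteq> F'" "finite F'" "ortho F'"
      "complex_vector.span F' = complex_vector.span (insert (s n) F)"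
      using ortho_extend[OF _ _ sH] F unfolding P_def by meson
    have "s n \<in> complex_vector.span F'"
      unfolding F'(4) by (simp add: complex_vector.span_base)
    moreover have "s i \<in> complex_vector.span F'" if "i < n" for i
      using that F complex_vector.span_mono[OF F'(1)] unfolding P_def by auto
    ultimately show ?thesis using F' by (auto simp: P_def less_Suc_eq)
  qed
  moreover have "P 0 {}" by (simp add: P_def ortho_def)
  ultimately have "\<exists>F. \<forall>n. P n (F n) \<and> F n \<subseteq> F (Suc n)"
    by (intro dependent_nat_choice) blast+
  then obtain F where F: "\<And>n. P n (F n)" "\<And>n. F n \<subseteq> F (Suc n)" by blast
  have mono: "F m \<subseteq> F n" if "m \<le> n" for m n using lift_Suc_mono_le[of F] F(2) that by auto
  define E where "E = (\<Union>n. F n)"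
  have oE: "ortho E"
    unfolding ortho_def
  proof (intro conjI ballI)
    show "E \<subseteq> vecs H" using F(1) unfolding E_def P_def ortho_def by blast
    fix e e' assume "e \<in> E" "e' \<in> E"
    then obtain m n where mn: "e \<in> F m" "e' \<in> F n" by (auto simp: E_def)
    then have "e \<in> F (max m n)" "e' \<in> F (max m n)"
      using mono[of m "max m n"] mono[of n "max m n"] by auto
    then show "ip H e e' = (if e = e' then 1 else 0)"
      using F(1)[of "max m n"] by (auto simp: P_def ortho_ip)
  qed
  have SE: "S \<subseteq> complex_vector.span E"
  proof -
    have "s n \<in> complex_vector.span E" for n
      using F(1)[of "Suc n"] complex_vector.span_mono[of "F (Suc n)" E] by (auto simp: P_def E_def)
    then show ?thesis using s by auto
  qed
  have "E \<subseteq> vecs H" using oE by (simp add: ortho_def)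
  then have "dense_in H (complex_vector.span E)"
    by (rule dense_superset[OF S(2) SE span_in])
  with oE show ?thesis unfolding basis_ortho by blast
qed

lemma chosen_basis: "separable_hilbert H \<Longrightarrow> orthonormal_basis H (chosen_basis H)"
  unfolding chosen_basis_def using separable_basis by (rule someI_ex)

text \<open>A finite partial sum is the inner product of a projection of \<open>v\<close> with
  \<open>w\<close>. Once the index set contains the finitely many vectors that carry a good
  approximation of \<open>v\<close>, best approximation bounds the error.\<close>

lemma parseval:
  assumes E: "orthonormal_basis H E" and v: "v \<in> vecs H" and w: "w \<in> vecs H"
  shows "((\<lambda>e. ip H v e * ip H e w) has_sum ip H v w) E"
proof -
  have oE: "ortho E" and dE: "dense_in H (complex_vector.span E)" using E by (auto simp: basis_ortho)
  have oF: "ortho F" if "F \<subseteq> E" for F using oE that unfolding ortho_def by blast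
  have "(sum (\<lambda>e. ip H v e * ip H e w) \<longlongrightarrow> ip H v w) (finite_subsets_at_top E)"
  proof (rule tendstoI)
    fix \<epsilon> :: real assume \<epsilon>: "\<epsilon> > 0"
    \<comment> \<open>The added 1 keeps the denominator positive when \<open>w = 0\<close>.\<close>
    define \<delta> where "\<delta> = \<epsilon> / (hnorm H w + 1)"
    have \<delta>: "\<delta> > 0" using \<epsilon> w by (simp add: \<delta>_def add_nonneg_pos)
    then obtain z where z: "z \<in> complex_vector.span E" "hnorm H (v - z) < \<delta>"
      using dE v unfolding dense_in_def by blast
    then obtain F0 where F0: "finite F0" "F0 \<subseteq> E" "z \<in> complex_vector.span F0"
      by (meson span_finite_subset)
    show "\<forall>\<^sub>F F in finite_subsets_at_top E. dist (\<Sum>e\<in>F. ip H v e * ip H e w) (ip H v w) < \<epsilon>"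
    proof (rule eventually_finite_subsets_at_top[THEN iffD2], intro exI conjI allI impI)
      show "finite F0" "F0 \<subseteq> E" by fact+
      fix F assume F: "finite F \<and> F0 \<subseteq> F \<and> F \<subseteq> E"
      then have "z \<in> complex_vector.span F" using F0(3) complex_vector.span_mono by blast
      then have d: "hnorm H (v - proj F v) < \<delta>"
        using proj_best[OF oF _ v, of F z] F z(2) by simp
      have pF: "proj F v \<in> vecs H" using oF F proj_in by blast
      have "dist (\<Sum>e\<in>F. ip H v e * ip H e w) (ip H v w) = cmod (ip H (v - proj F v) w)"
        using oF F v w pF by (simp add: dist_norm ip_diff_left ip_proj Real_Vector_Spaces.norm_minus_commute)
      also have "\<dots> \<le> hnorm H (v - proj F v) * hnorm H w"
        using cauchy_schwarz pF v w by simp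
      also have "\<dots> \<le> \<delta> * hnorm H w" using d w by (intro mult_right_mono) auto
      also have "\<dots> < \<delta> * (hnorm H w + 1)" using \<delta> by simp
      also have "\<dots> = \<epsilon>" using norm_nonneg[OF w] by (simp add: \<delta>_def)
      finally show "dist (\<Sum>e\<in>F. ip H v e * ip H e w) (ip H v w) < \<epsilon>" .
    qed
  qed
  then show ?thesis by (simp add: has_sum_def)
qed

lemma parseval_norm:
  assumes E: "orthonormal_basis H E" and v: "v \<in> vecs H"
  shows "((\<lambda>e. (cmod (ip H v e))\<^sup>2) has_sum (hnorm H v)\<^sup>2) E"
proof -
  have "((\<lambda>e. Re (ip H v e * ip H e v)) has_sum Re (ip H v v)) E"
    using has_sum_Re[OF parseval[OF E v v]] .
  moreover have "Re (ip H v e * ip H e v) = (cmod (ip H v e))\<^sup>2" if "e \<in> E" for e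
    using ip_mult_cnj[of v e] that v E by (auto simp: orthonormal_basis_def simp del: times_complex.sel)
  ultimately show ?thesis
    unfolding norm_sq[OF v] by (metis (no_types, lifting) has_sum_cong)
qed

lemma bessel:
  assumes F: "ortho F" "finite F" and v: "v \<in> vecs H"
  shows "(\<Sum>e\<in>F. (cmod (ip H v e))\<^sup>2) \<le> (hnorm H v)\<^sup>2"
proof -
  have p: "proj F v \<in> vecs H" using F proj_in by blast
  have "ip H (proj F v) v = (\<Sum>e\<in>F. of_real ((cmod (ip H v e))\<^sup>2))"
    unfolding ip_proj[OF F(1) v v] using F(1) v by (intro sum.cong refl ip_mult_cnj) (auto dest: orthoD)
  then have "Re (ip H (proj F v) v) = (\<Sum>e\<in>F. (cmod (ip H v e))\<^sup>2)"
    by (simp only: flip: of_real_sum) simp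
  moreover have "ip H (v - proj F v) (proj F v) = 0" using ip_sub_proj[OF F v proj_span] .
  then have "ip H v (proj F v) = ip H (proj F v) (proj F v)" using v p by (simp add: ip_diff_left)
  moreover have "0 \<le> (hnorm H (v - proj F v))\<^sup>2" by simp
  ultimately show ?thesis
    using norm_diff_sq[OF v p] norm_sq[OF p] ip_cnj[OF v p] by simp
qed

end

section \<open>Hilbert--Schmidt operators\<close>

text \<open>Valid for divergent families too, since then both infinite sums are 0 by
  convention.\<close>

lemma infsum_complex_of_real: "(\<Sum>\<^sub>\<infinity>x\<in>A. complex_of_real (f x)) = of_real (\<Sum>\<^sub>\<infinity>x\<in>A. f x)"
proof (cases "f summable_on A")
  case True
  then show ?thesis by (intro infsumI has_sum_of_real has_sum_infsum)
next
  case False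
  then have "\<not> (\<lambda>x. complex_of_real (f x)) summable_on A"
    using summable_on_Re[of "\<lambda>x. complex_of_real (f x)" A] by auto
  then show ?thesis using False by (simp add: infsum_not_exists)
qed

context hilb
begin

text \<open>An everywhere defined adjoint is the only regularity demanded of an operator: it forces
  linearity on \<open>vecs H\<close> (\<open>adj_add\<close>, \<open>adj_scale\<close>), and
  boundedness comes with summability (\<open>hs_bound\<close>). Values off \<open>vecs H\<close> are
  unconstrained.\<close>

definition adj :: "('v \<Rightarrow> 'v) \<Rightarrow> ('v \<Rightarrow> 'v) \<Rightarrow> bool" where
  "adj T S \<longleftrightarrow> (\<forall>v\<in>vecs H. T v \<in> vecs H) \<and> (\<forall>v\<in>vecs H. S v \<in> vecs H) \<and>
     (\<forall>v\<in>vecs H. \<forall>w\<in>vecs H. ip H (T v) w = ip H v (S w))"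

lemma adj_in [simp]: "adj T S \<Longrightarrow> v \<in> vecs H \<Longrightarrow> T v \<in> vecs H"
  and adj_in' [simp]: "adj T S \<Longrightarrow> v \<in> vecs H \<Longrightarrow> S v \<in> vecs H"
  and adj_ip: "adj T S \<Longrightarrow> v \<in> vecs H \<Longrightarrow> w \<in> vecs H \<Longrightarrow> ip H (T v) w = ip H v (S w)"
  by (simp_all add: adj_def)

lemma eqI_ip_right:
  assumes "u \<in> vecs H" "v \<in> vecs H" "\<And>w. w \<in> vecs H \<Longrightarrow> ip H w u = ip H w v"
  shows "u = v"
proof (rule eqI_ip[OF assms(1,2)])
  fix w assume w: "w \<in> vecs H"
  show "ip H u w = ip H v w"
    unfolding ip_cnj[OF w assms(1)] ip_cnj[OF w assms(2)] assms(3)[OF w] ..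
qed

lemma adj_sym: assumes "adj T S" shows "adj S T"
proof -
  have "ip H (S v) w = ip H v (T w)" if "v \<in> vecs H" "w \<in> vecs H" for v w
  proof -
    have "ip H (S v) w = cnj (ip H w (S v))" using that assms by (intro ip_cnj) simp_all
    also have "\<dots> = cnj (ip H (T w) v)" using adj_ip[OF assms that(2,1)] by simp
    also have "\<dots> = ip H v (T w)" using that assms by (intro ip_cnj[symmetric]) simp_all
    finally show ?thesis .
  qed
  then show ?thesis using assms unfolding adj_def by blast
qed

lemma adj_add: "adj T S \<Longrightarrow> v \<in> vecs H \<Longrightarrow> w \<in> vecs H \<Longrightarrow> T (v + w) = T v + T w"
  by (intro eqI_ip) (simp_all add: adj_ip ip_add_left)

lemma adj_scale: "adj T S \<Longrightarrow> v \<in> vecs H \<Longrightarrow> T (c *\<^sub>C v) = c *\<^sub>C T v"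
  by (intro eqI_ip) (simp_all add: adj_ip ip_scale_left)

lemma adj_diff: "adj T S \<Longrightarrow> v \<in> vecs H \<Longrightarrow> w \<in> vecs H \<Longrightarrow> T (v - w) = T v - T w"
  by (intro eqI_ip) (simp_all add: adj_ip ip_diff_left)

lemma adj_zero: "adj T S \<Longrightarrow> T 0 = 0"
  by (intro eqI_ip) (simp_all add: adj_ip)

lemma adj_comp: "adj T S \<Longrightarrow> adj T' S' \<Longrightarrow> adj (T \<circ> T') (S' \<circ> S)"
  unfolding adj_def by simp

lemma adj_plus: "adj T S \<Longrightarrow> adj T' S' \<Longrightarrow> adj (T + T') (S + S')"
  unfolding adj_def by (simp add: ip_add_left ip_add_right)

lemma adj_minus: "adj T S \<Longrightarrow> adj T' S' \<Longrightarrow> adj (T - T') (S - S')"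
  unfolding adj_def by (simp add: ip_diff_left ip_diff_right)

lemma adj_cmult: "adj T S \<Longrightarrow> adj (c *\<^sub>C T) (cnj c *\<^sub>C S)"
  unfolding adj_def by (simp add: scaleC_fun_def ip_scale_left ip_scale_right)

lemma op_adjoint_eq:
  assumes "adj T S" "w \<in> vecs H"
  shows "op_adjoint H T w = S w"
  unfolding op_adjoint_def
proof (rule the_equality)
  show "S w \<in> vecs H \<and> (\<forall>v\<in>vecs H. ip H (T v) w = ip H v (S w))"
    using assms by (simp add: adj_ip)
  fix z assume z: "z \<in> vecs H \<and> (\<forall>v\<in>vecs H. ip H (T v) w = ip H v z)"
  then show "z = S w"
    using assms by (intro eqI_ip_right) (auto simp: adj_ip)
qed

text \<open>The square of the Hilbert-Schmidt norm, computed in the basis \<open>E\<close>. A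
  divergent sum has the value 0, so \<open>hs2\<close> is informative only together with
  \<open>hs_sm\<close>.\<close>

definition hs2 :: "'v set \<Rightarrow> ('v \<Rightarrow> 'v) \<Rightarrow> real" where
  "hs2 E T = (\<Sum>\<^sub>\<infinity>e\<in>E. (hnorm H (T e))\<^sup>2)"

definition hs_sm :: "'v set \<Rightarrow> ('v \<Rightarrow> 'v) \<Rightarrow> bool" where
  "hs_sm E T \<longleftrightarrow> (\<lambda>e. (hnorm H (T e))\<^sup>2) summable_on E"

lemma hs2_nonneg [simp]: "0 \<le> hs2 E T"
  unfolding hs2_def by (intro infsum_nonneg) simp

lemma hs_has_sum: "hs_sm E T \<Longrightarrow> ((\<lambda>e. (hnorm H (T e))\<^sup>2) has_sum hs2 E T) E"
  unfolding hs_sm_def hs2_def by (rule has_sum_infsum)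

lemma basis_in: "orthonormal_basis H E \<Longrightarrow> e \<in> E \<Longrightarrow> e \<in> vecs H"
  by (auto simp: orthonormal_basis_def)

text \<open>Parseval expands each \<open>(hnorm H (S f))\<^sup>2\<close> into a sum over
  \<open>E\<close>; the finite sum over \<open>F\<close> is exchanged with it and Bessel's
  inequality is applied for each \<open>e\<close>. Since \<open>F\<close> may lie outside
  \<open>E\<close>, the lemma also bounds dimensions in \<open>finite_dim_fixed\<close>.\<close>

lemma hs_adj_bound:
  assumes E: "orthonormal_basis H E" and a: "adj T S" and s: "hs_sm E T"
    and F: "finite F" "ortho F"
  shows "(\<Sum>f\<in>F. (hnorm H (S f))\<^sup>2) \<le> hs2 E T"
proof -
  have 1: "((\<lambda>e. (cmod (ip H (T e) f))\<^sup>2) has_sum (hnorm H (S f))\<^sup>2) E" if f: "f \<in> F" for f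
  proof -
    have "cmod (ip H (S f) e) = cmod (ip H (T e) f)" if "e \<in> E" for e
      using basis_in[OF E that] orthoD[OF F(2) f] a ip_cnj[of "S f" e]
      by (simp add: adj_ip)
    then show ?thesis
      using parseval_norm[OF E, of "S f"] orthoD[OF F(2) f] a
      by (simp cong: has_sum_cong)
  qed
  have "((\<lambda>e. \<Sum>f\<in>F. (cmod (ip H (T e) f))\<^sup>2) has_sum (\<Sum>f\<in>F. (hnorm H (S f))\<^sup>2)) E"
    using F(1) 1
  proof (induction F)
    case (insert x F)
    then show ?case by (simp add: has_sum_add)
  qed simp
  moreover have "((\<lambda>e. (hnorm H (T e))\<^sup>2) has_sum hs2 E T) E"
    using s by (rule hs_has_sum)
  ultimately show ?thesis
    by (rule has_sum_mono) (use bessel[OF F(2,1)] a basis_in[OF E] in auto)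
qed

lemma hs_sm_adj:
  assumes E: "orthonormal_basis H E" and a: "adj T S" and s: "hs_sm E T"
  shows "hs_sm E S" "hs2 E S \<le> hs2 E T"
proof -
  have b: "(\<Sum>f\<in>F. (hnorm H (S f))\<^sup>2) \<le> hs2 E T" if "finite F" "F \<subseteq> E" for F
  proof (rule hs_adj_bound[OF E a s that(1)])
    show "ortho F" using E that(2) unfolding basis_ortho ortho_def by blast
  qed
  show 1: "hs_sm E S" unfolding hs_sm_def
    by (rule nonneg_bdd_above_summable_on) (auto intro!: bdd_aboveI2[where M = "hs2 E T"] b)
  show "hs2 E S \<le> hs2 E T" unfolding hs2_def[of E S]
    by (rule infsum_le_finite_sums[OF 1[unfolded hs_sm_def] b])
qed

lemma hs2_adj:
  assumes "orthonormal_basis H E" "adj T S" "hs_sm E T"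
  shows "hs2 E S = hs2 E T"
  using hs_sm_adj[OF assms] hs_sm_adj[OF assms(1) adj_sym[OF assms(2)]] by (simp add: antisym)

text \<open>The coefficient of \<open>T v\<close> at \<open>e\<close> is the inner product of
  \<open>v\<close> with \<open>S e\<close>; Cauchy-Schwarz and summation over \<open>E\<close> leave
  the Hilbert-Schmidt norm of \<open>S\<close>, which equals that of \<open>T\<close>.\<close>

lemma hs_bound:
  assumes E: "orthonormal_basis H E" and a: "adj T S" and s: "hs_sm E T" and v: "v \<in> vecs H"
  shows "hnorm H (T v) \<le> sqrt (hs2 E T) * hnorm H v"
proof -
  have S: "hs_sm E S" "hs2 E S = hs2 E T" using hs_sm_adj[OF E a s] hs2_adj[OF E a s] by auto
  have "((\<lambda>e. (cmod (ip H (T v) e))\<^sup>2) has_sum (hnorm H (T v))\<^sup>2) E"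
    using parseval_norm[OF E] a v by simp
  moreover have "((\<lambda>e. (hnorm H v)\<^sup>2 * (hnorm H (S e))\<^sup>2) has_sum (hnorm H v)\<^sup>2 * hs2 E T) E"
    using hs_has_sum[OF S(1)] unfolding S(2) by (rule has_sum_cmult_right)
  ultimately have "(hnorm H (T v))\<^sup>2 \<le> (hnorm H v)\<^sup>2 * hs2 E T"
  proof (rule has_sum_mono)
    fix e assume e: "e \<in> E"
    have "cmod (ip H (T v) e) \<le> hnorm H v * hnorm H (S e)"
      using cauchy_schwarz[of v "S e"] a v basis_in[OF E e] by (simp add: adj_ip)
    then show "(cmod (ip H (T v) e))\<^sup>2 \<le> (hnorm H v)\<^sup>2 * (hnorm H (S e))\<^sup>2"
      by (metis norm_ge_zero power_mono power_mult_distrib)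
  qed
  then show ?thesis
    using v a by - (rule power2_le_imp_le, simp_all add: power_mult_distrib mult.commute)
qed

lemma hs_sm_plus:
  assumes E: "orthonormal_basis H E" and "adj T S" "hs_sm E T" "adj T' S'" "hs_sm E T'"
  shows "hs_sm E (T + T')"
  unfolding hs_sm_def
proof (rule summable_on_comparison_test)
  show "(\<lambda>e. 2 * (hnorm H (T e))\<^sup>2 + 2 * (hnorm H (T' e))\<^sup>2) summable_on E"
    using assms unfolding hs_sm_def by (intro summable_on_add summable_on_cmult_right)
  fix e assume e: "e \<in> E"
  have "hnorm H (T e + T' e) \<le> hnorm H (T e) + hnorm H (T' e)"
    using norm_triangle assms basis_in[OF E e] by simp
  then have "(hnorm H (T e + T' e))\<^sup>2 \<le> (hnorm H (T e) + hnorm H (T' e))\<^sup>2"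
    using assms basis_in[OF E e] by (intro power_mono) auto
  also have "\<dots> \<le> 2 * (hnorm H (T e))\<^sup>2 + 2 * (hnorm H (T' e))\<^sup>2"
    using sum_squares_bound[of "hnorm H (T e)" "hnorm H (T' e)"] by (simp add: power2_sum)
  finally show "(hnorm H ((T + T') e))\<^sup>2 \<le> 2 * (hnorm H (T e))\<^sup>2 + 2 * (hnorm H (T' e))\<^sup>2"
    by simp
qed simp

lemma hs_sm_cmult:
  assumes E: "orthonormal_basis H E" and "adj T S" "hs_sm E T"
  shows "hs_sm E (c *\<^sub>C T)" "hs2 E (c *\<^sub>C T) = (cmod c)\<^sup>2 * hs2 E T"
proof -
  have e: "(hnorm H ((c *\<^sub>C T) e))\<^sup>2 = (cmod c)\<^sup>2 * (hnorm H (T e))\<^sup>2" if "e \<in> E" for e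
    using assms basis_in[OF E that] by (simp add: scaleC_fun_def norm_scale power_mult_distrib)
  show "hs_sm E (c *\<^sub>C T)"
    using assms(3) unfolding hs_sm_def
    by (subst summable_on_cong[OF e]) (auto intro: summable_on_cmult_right)
  show "hs2 E (c *\<^sub>C T) = (cmod c)\<^sup>2 * hs2 E T"
    unfolding hs2_def by (subst infsum_cong[OF e]) (auto simp: infsum_cmult_right')
qed

definition hsip :: "'v set \<Rightarrow> ('v \<Rightarrow> 'v) \<Rightarrow> ('v \<Rightarrow> 'v) \<Rightarrow> complex" where
  "hsip E T T' = (\<Sum>\<^sub>\<infinity>e\<in>E. ip H (T e) (T' e))"

lemma hsip_summable:
  assumes E: "orthonormal_basis H E" and "adj T S" "hs_sm E T" "adj T' S'" "hs_sm E T'"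
  shows "(\<lambda>e. ip H (T e) (T' e)) summable_on E"
proof (rule abs_summable_summable, rule summable_on_comparison_test)
  show "(\<lambda>e. (hnorm H (T e))\<^sup>2 + (hnorm H (T' e))\<^sup>2) summable_on E"
    using assms unfolding hs_sm_def by (intro summable_on_add)
  fix e assume e: "e \<in> E"
  have "cmod (ip H (T e) (T' e)) \<le> hnorm H (T e) * hnorm H (T' e)"
    using cauchy_schwarz assms basis_in[OF E e] by simp
  also have "\<dots> \<le> (hnorm H (T e))\<^sup>2 + (hnorm H (T' e))\<^sup>2"
    using sum_squares_bound[of "hnorm H (T e)" "hnorm H (T' e)"]
      sum_power2_ge_zero[of "hnorm H (T e)" "hnorm H (T' e)"] by linarith
  finally show "cmod (ip H (T e) (T' e)) \<le> (hnorm H (T e))\<^sup>2 + (hnorm H (T' e))\<^sup>2" .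
qed simp

text \<open>Operators are required to vanish off \<open>vecs H\<close>, so that equality of functions is equality
  of operators.\<close>

definition HS :: "'v set \<Rightarrow> ('v \<Rightarrow> 'v) inner_space" where
  "HS E = \<lparr>vecs = {T. (\<exists>S. adj T S) \<and> hs_sm E T \<and> (\<forall>v. v \<notin> vecs H \<longrightarrow> T v = 0)}, ip = hsip E\<rparr>"

lemma HS_vecs: "T \<in> vecs (HS E) \<longleftrightarrow> (\<exists>S. adj T S) \<and> hs_sm E T \<and> (\<forall>v. v \<notin> vecs H \<longrightarrow> T v = 0)"
  by (simp add: HS_def)

lemma HS_ip [simp]: "ip (HS E) = hsip E"
  by (simp add: HS_def)

lemma hsip_self:
  assumes E: "orthonormal_basis H E" and "adj T S"
  shows "hsip E T T = of_real (hs2 E T)"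
proof -
  have "hsip E T T = (\<Sum>\<^sub>\<infinity>e\<in>E. of_real ((hnorm H (T e))\<^sup>2))"
    unfolding hsip_def using adj_in[OF assms(2)] basis_in[OF E] by (intro infsum_cong ip_self) blast
  then show ?thesis
    unfolding hs2_def by (simp only: infsum_complex_of_real)
qed

lemma HS_norm:
  assumes E: "orthonormal_basis H E" and "adj T S"
  shows "hnorm (HS E) T = sqrt (hs2 E T)"
  unfolding hnorm_def by (simp add: hsip_self[OF assms])

lemma HS_subspace:
  assumes E: "orthonormal_basis H E"
  shows "complex_vector.subspace (vecs (HS E))"
proof (rule complex_vector.subspaceI)
  have "adj 0 0" unfolding adj_def by simp
  then show "0 \<in> vecs (HS E)" by (auto simp: HS_vecs hs_sm_def)
  fix T T' assume "T \<in> vecs (HS E)" "T' \<in> vecs (HS E)"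
  then show "T + T' \<in> vecs (HS E)"
    by (auto simp: HS_vecs intro: adj_plus hs_sm_plus[OF E])
next
  fix c T assume "T \<in> vecs (HS E)"
  then obtain S where S: "adj T S" "hs_sm E T" "\<forall>v. v \<notin> vecs H \<longrightarrow> T v = 0" by (auto simp: HS_vecs)
  have "\<forall>v. v \<notin> vecs H \<longrightarrow> (c *\<^sub>C T) v = 0" using S(3) by (simp add: scaleC_fun_def)
  then show "c *\<^sub>C T \<in> vecs (HS E)"
    unfolding HS_vecs using adj_cmult[OF S(1)] hs_sm_cmult[OF E S(1,2)] by blast
qed

text \<open>Operator norms are dominated by Hilbert-Schmidt norms, so both the \<open>T n\<close>
  and their adjoints converge pointwise. The limits again form an adjoint pair, and convergence in
  the Hilbert-Schmidt norm follows from bounds on finite partial sums.\<close>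

lemma HS_closed:
  assumes E: "orthonormal_basis H E"
    and Ts: "\<And>n::nat. T n \<in> vecs (HS E)"
    and C: "\<And>\<epsilon>. \<epsilon> > 0 \<Longrightarrow> \<exists>N. \<forall>m\<ge>N. \<forall>n\<ge>N. hnorm (HS E) (T m - T n) < \<epsilon>"
  shows "\<exists>L\<in>vecs (HS E). (\<lambda>n. hnorm (HS E) (T n - L)) \<longlonglongrightarrow> 0"
proof -
  have "\<forall>n. \<exists>S. adj (T n) S" using Ts by (simp add: HS_vecs)
  then obtain S where S: "\<And>n. adj (T n) (S n)" by metis
  have TI: "T n v \<in> vecs H" and SI: "S n v \<in> vecs H" if "v \<in> vecs H" for n v
    using that adj_in[OF S] adj_in'[OF S] by blast+
  have sm: "hs_sm E (T n)" for n using Ts by (simp add: HS_vecs)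
  have diff: "T m - T n \<in> vecs (HS E)" for m n
    using complex_vector.subspace_diff[OF HS_subspace[OF E]] Ts by blast
  then have smd: "hs_sm E (T m - T n)" for m n by (simp add: HS_vecs)
  have ad: "adj (T m - T n) (S m - S n)" for m n using adj_minus[OF S S] .
  have N: "hnorm (HS E) (T m - T n) = sqrt (hs2 E (T m - T n))" for m n by (rule HS_norm[OF E ad])
  have NS: "hs2 E (S m - S n) = hs2 E (T m - T n)" "hs_sm E (S m - S n)" for m n
    using hs2_adj[OF E ad smd] hs_sm_adj[OF E ad smd] by auto
  \<comment> \<open>Stated for an arbitrary family \<open>A\<close> because it serves for the
    operators as well as for their adjoints.\<close>
  have lim: "\<exists>l\<in>vecs H. (\<lambda>n. hnorm H (A n v - l)) \<longlonglongrightarrow> 0"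
    if v: "v \<in> vecs H" and A: "\<And>n. A n v \<in> vecs H"
      and b: "\<And>m n. hnorm H (A m v - A n v) \<le> hnorm (HS E) (T m - T n) * hnorm H v" for A :: "nat \<Rightarrow> 'v \<Rightarrow> 'v" and v
  proof (rule complete[of "\<lambda>n. A n v"])
    show "A n v \<in> vecs H" for n by (rule A)
    fix \<epsilon> :: real assume \<epsilon>: "\<epsilon> > 0"
    have p: "hnorm H v + 1 > 0" using v by (simp add: add_nonneg_pos)
    then obtain N where N: "\<And>m n. m \<ge> N \<Longrightarrow> n \<ge> N \<Longrightarrow> hnorm (HS E) (T m - T n) < \<epsilon> / (hnorm H v + 1)"
      using C[of "\<epsilon> / (hnorm H v + 1)"] \<epsilon> by auto
    show "\<exists>N. \<forall>m\<ge>N. \<forall>n\<ge>N. hnorm H (A m v - A n v) < \<epsilon>"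
    proof (intro exI[of _ N] allI impI)
      fix m n assume "m \<ge> N" "n \<ge> N"
      then have "hnorm H (A m v - A n v) \<le> \<epsilon> / (hnorm H v + 1) * hnorm H v"
        using N[of m n] b[of m n] v by (meson less_imp_le mult_right_mono norm_nonneg order_trans)
      also have "\<dots> < \<epsilon>" using \<epsilon> p by (simp add: field_simps)
      finally show "hnorm H (A m v - A n v) < \<epsilon>" .
    qed
  qed blast
  have bT: "hnorm H (T m v - T n v) \<le> hnorm (HS E) (T m - T n) * hnorm H v" if "v \<in> vecs H" for m n v
    using hs_bound[OF E ad smd that, of m n] unfolding N by simp
  have bS: "hnorm H (S m v - S n v) \<le> hnorm (HS E) (T m - T n) * hnorm H v" if "v \<in> vecs H" for m n v
    using hs_bound[OF E adj_sym[OF ad] NS(2) that, of m n] unfolding N NS(1) by simp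
  have "\<forall>v\<in>vecs H. \<exists>l\<in>vecs H. (\<lambda>n. hnorm H (T n v - l)) \<longlonglongrightarrow> 0"
    by (intro ballI lim bT TI)
  then obtain L0 where L0: "\<And>v. v \<in> vecs H \<Longrightarrow> L0 v \<in> vecs H"
    "\<And>v. v \<in> vecs H \<Longrightarrow> (\<lambda>n. hnorm H (T n v - L0 v)) \<longlonglongrightarrow> 0" by metis
  have "\<forall>v\<in>vecs H. \<exists>l\<in>vecs H. (\<lambda>n. hnorm H (S n v - l)) \<longlonglongrightarrow> 0"
    by (intro ballI lim bS SI)
  then obtain M where M: "\<And>v. v \<in> vecs H \<Longrightarrow> M v \<in> vecs H"
    "\<And>v. v \<in> vecs H \<Longrightarrow> (\<lambda>n. hnorm H (S n v - M v)) \<longlonglongrightarrow> 0" by metis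
  define L where "L v = (if v \<in> vecs H then L0 v else 0)" for v
  have L: "v \<in> vecs H \<Longrightarrow> L v \<in> vecs H" "v \<in> vecs H \<Longrightarrow> (\<lambda>n. hnorm H (T n v - L v)) \<longlonglongrightarrow> 0" for v
    using L0 by (auto simp: L_def)
  have adL: "adj L M"
    unfolding adj_def
  proof (intro conjI ballI)
    fix v w assume vw: "v \<in> vecs H" "w \<in> vecs H"
    have 1: "(\<lambda>n. ip H (T n v) w) \<longlonglongrightarrow> ip H (L v) w"
      by (rule ip_tendsto) (use TI vw L in auto)
    have "(\<lambda>n. ip H (S n w) v) \<longlonglongrightarrow> ip H (M w) v"
      by (rule ip_tendsto) (use SI vw M in auto)
    then have "(\<lambda>n. cnj (ip H (S n w) v)) \<longlonglongrightarrow> cnj (ip H (M w) v)"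
      by (rule tendsto_cnj)
    moreover have "cnj (ip H (S n w) v) = ip H (T n v) w" for n
      using ip_cnj[of "S n w" v] vw SI by (simp add: adj_ip[OF S])
    moreover have "cnj (ip H (M w) v) = ip H v (M w)"
      using ip_cnj[of "M w" v] vw M by simp
    ultimately have "(\<lambda>n. ip H (T n v) w) \<longlonglongrightarrow> ip H v (M w)" by simp
    then show "ip H (L v) w = ip H v (M w)" using 1 LIMSEQ_unique by blast
  qed (use L M in auto)
  have adD: "adj (T n - L) (S n - M)" for n by (rule adj_minus[OF S adL])
  \<comment> \<open>A Fatou-type argument: a finite part of the sum over \<open>E\<close> passes to
    the limit in \<open>m\<close>, and the bound is independent of that part.\<close>
  have key: "(\<Sum>e\<in>F. (hnorm H ((T n - L) e))\<^sup>2) \<le> \<epsilon>\<^sup>2"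
    if N: "\<And>m. m \<ge> N \<Longrightarrow> hnorm (HS E) (T n - T m) < \<epsilon>" and F: "finite F" "F \<subseteq> E" and \<epsilon>: "\<epsilon> > 0"
    for n N F \<epsilon>
  proof -
    have FH: "e \<in> F \<Longrightarrow> e \<in> vecs H" for e using F basis_in[OF E] by auto
    have "(\<lambda>m. \<Sum>e\<in>F. (hnorm H (T n e - T m e))\<^sup>2) \<longlonglongrightarrow> (\<Sum>e\<in>F. (hnorm H (T n e - L e))\<^sup>2)"
    proof (intro tendsto_sum tendsto_power norm_tendsto)
      fix e assume "e \<in> F"
      then have e: "e \<in> vecs H" by (rule FH)
      have "hnorm H (T n e - T m e - (T n e - L e)) = hnorm H (T m e - L e)" for m
        using norm_minus_commute[of "T m e" "L e"] e TI L by simp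
      then show "(\<lambda>m. hnorm H (T n e - T m e - (T n e - L e))) \<longlonglongrightarrow> 0"
        using L(2)[OF e] by simp
    qed (use TI L FH in auto)
    moreover have "\<forall>\<^sub>F m in sequentially. (\<Sum>e\<in>F. (hnorm H (T n e - T m e))\<^sup>2) \<le> \<epsilon>\<^sup>2"
    proof (rule eventually_sequentiallyI[of N])
      fix m assume "m \<ge> N"
      then have "sqrt (hs2 E (T n - T m)) < \<epsilon>" using that(1) N by (simp add: HS_norm[OF E ad])
      then have "hs2 E (T n - T m) \<le> \<epsilon>\<^sup>2"
        by (metis hs2_nonneg less_imp_le power_mono real_sqrt_ge_zero real_sqrt_pow2)
      moreover have "(\<Sum>e\<in>F. (hnorm H ((T n - T m) e))\<^sup>2) \<le> hs2 E (T n - T m)"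
        unfolding hs2_def using smd[of n m] F unfolding hs_sm_def
        by (intro finite_sum_le_infsum) auto
      ultimately show "(\<Sum>e\<in>F. (hnorm H (T n e - T m e))\<^sup>2) \<le> \<epsilon>\<^sup>2" by simp
    qed
    ultimately show ?thesis using tendsto_upperbound by fastforce
  qed
  have near: "\<exists>N. \<forall>n\<ge>N. hs_sm E (T n - L) \<and> hs2 E (T n - L) \<le> \<epsilon>\<^sup>2" if \<epsilon>: "\<epsilon> > 0" for \<epsilon>
  proof -
    obtain N where N: "\<And>m n. m \<ge> N \<Longrightarrow> n \<ge> N \<Longrightarrow> hnorm (HS E) (T m - T n) < \<epsilon>"
      using C[OF \<epsilon>] by blast
    show ?thesis
    proof (intro exI[of _ N] allI impI)
      fix n assume n: "n \<ge> N"
      have k: "(\<Sum>e\<in>F. (hnorm H ((T n - L) e))\<^sup>2) \<le> \<epsilon>\<^sup>2" if "finite F" "F \<subseteq> E" for F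
        using key[OF N[OF n] that \<epsilon>] by blast
      have 1: "hs_sm E (T n - L)" unfolding hs_sm_def
        by (rule nonneg_bdd_above_summable_on, simp, rule bdd_aboveI2, rule k) auto
      moreover have "hs2 E (T n - L) \<le> \<epsilon>\<^sup>2" unfolding hs2_def
        by (rule infsum_le_finite_sums[OF 1[unfolded hs_sm_def] k])
      ultimately show "hs_sm E (T n - L) \<and> hs2 E (T n - L) \<le> \<epsilon>\<^sup>2" ..
    qed
  qed
  \<comment> \<open>\<open>L\<close> is \<open>T n\<close> minus the difference
    \<open>T n - L\<close>, and both are square-summable along \<open>E\<close>.\<close>
  obtain n where "hs_sm E (T n - L)" using near[of 1] by auto
  then have "hs_sm E (T n + (-1) *\<^sub>C (T n - L))"
    by (intro hs_sm_plus[OF E S sm adj_cmult[OF adD]] hs_sm_cmult[OF E adD])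
  moreover have "T n + (-1) *\<^sub>C (T n - L) = L"
    by (simp add: complex_vector.scale_minus_left scaleC_one)
  ultimately have "L \<in> vecs (HS E)" using adL by (auto simp: HS_vecs L_def)
  moreover have "(\<lambda>n. hnorm (HS E) (T n - L)) \<longlonglongrightarrow> 0"
  proof (rule LIMSEQ_I)
    fix r :: real assume r: "r > 0"
    obtain N where N: "\<And>n. n \<ge> N \<Longrightarrow> hs2 E (T n - L) \<le> (r / 2)\<^sup>2"
      using near[of "r / 2"] r by auto
    have "norm (hnorm (HS E) (T n - L) - 0) < r" if "n \<ge> N" for n
    proof -
      have "sqrt (hs2 E (T n - L)) \<le> r / 2"
        using N[OF that] r by (intro real_le_lsqrt) auto
      then show ?thesis using r by (simp add: HS_norm[OF E adD])
    qed
    then show "\<exists>N. \<forall>n\<ge>N. norm (hnorm (HS E) (T n - L) - 0) < r" by blast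
  qed
  ultimately show ?thesis by blast
qed

lemma HS_hilbert:
  assumes E: "orthonormal_basis H E"
  shows "hilbert_space (HS E)"
  unfolding hilbert_space_def
proof (intro conjI ballI allI impI)
  show "complex_vector.subspace (vecs (HS E))" by (rule HS_subspace[OF E])
  fix T T' T'' assume T: "T \<in> vecs (HS E)" "T' \<in> vecs (HS E)" "T'' \<in> vecs (HS E)"
  have "hsip E (T + T') T'' = (\<Sum>\<^sub>\<infinity>e\<in>E. ip H (T e) (T'' e) + ip H (T' e) (T'' e))"
    unfolding hsip_def using T by (intro infsum_cong) (auto simp: HS_vecs ip_add_left basis_in[OF E])
  also have "\<dots> = hsip E T T'' + hsip E T' T''"
    unfolding hsip_def using T by (intro infsum_add) (auto simp: HS_vecs intro: hsip_summable[OF E])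
  finally show "ip (HS E) (T + T') T'' = ip (HS E) T T'' + ip (HS E) T' T''" by simp
next
  fix c T T' assume T: "T \<in> vecs (HS E)" "T' \<in> vecs (HS E)"
  have "hsip E (c *\<^sub>C T) T' = (\<Sum>\<^sub>\<infinity>e\<in>E. c * ip H (T e) (T' e))"
    unfolding hsip_def using T
    by (intro infsum_cong) (auto simp: HS_vecs scaleC_fun_def ip_scale_left basis_in[OF E])
  then show "ip (HS E) (c *\<^sub>C T) T' = c * ip (HS E) T T'"
    by (simp add: hsip_def infsum_cmult_right')
next
  fix T T' assume T: "T \<in> vecs (HS E)" "T' \<in> vecs (HS E)"
  have "hsip E T' T = (\<Sum>\<^sub>\<infinity>e\<in>E. cnj (ip H (T e) (T' e)))"
    unfolding hsip_def using T by (intro infsum_cong ip_cnj) (auto simp: HS_vecs basis_in[OF E])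
  then show "ip (HS E) T' T = cnj (ip (HS E) T T')" by (simp add: hsip_def)
next
  fix T assume T: "T \<in> vecs (HS E)"
  then obtain S where S: "adj T S" "hs_sm E T" by (auto simp: HS_vecs)
  show "0 \<le> Re (ip (HS E) T T)" by (simp add: hsip_self[OF E S(1)])
  assume "ip (HS E) T T = 0"
  then have "hs2 E T = 0" by (simp add: hsip_self[OF E S(1)])
  then have "hnorm H (T v) = 0" if "v \<in> vecs H" for v
    using hs_bound[OF E S that] S that by (intro antisym) auto
  then have "T v = 0" for v
    using T S by (cases "v \<in> vecs H") (auto simp: HS_vecs)
  then show "T = 0" by auto
next
  fix s :: "nat \<Rightarrow> 'v \<Rightarrow> 'v"
  assume "range s \<subseteq> vecs (HS E) \<and> (\<forall>\<epsilon>>0. \<exists>N. \<forall>m\<ge>N. \<forall>n\<ge>N. hnorm (HS E) (s m - s n) < \<epsilon>)"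
  then show "\<exists>l\<in>vecs (HS E). (\<lambda>n. hnorm (HS E) (s n - l)) \<longlonglongrightarrow> 0"
    by (intro HS_closed[OF E]) auto
qed

text \<open>On the left, \<open>U\<close> preserves the norm of each value. On the right,
  \<open>U'\<close> would replace the basis by its image; passing to the adjoint turns this into a
  multiplication on the left.\<close>

lemma hs2_conj:
  assumes E: "orthonormal_basis H E" and T: "adj T S" "hs_sm E T"
    and U: "adj U U'" "\<And>v. v \<in> vecs H \<Longrightarrow> U' (U v) = v"
  shows "hs_sm E (U \<circ> T \<circ> U')" "hs2 E (U \<circ> T \<circ> U') = hs2 E T"
proof -
  have iso: "hnorm H (U v) = hnorm H v" if "v \<in> vecs H" for v
    using adj_ip[OF U(1) that, of "U v"] U that by (simp add: hnorm_def)
  have left: "hs_sm E (U \<circ> A)" "hs2 E (U \<circ> A) = hs2 E A" if "adj A A'" "hs_sm E A" for A A'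
  proof -
    have *: "(hnorm H ((U \<circ> A) e))\<^sup>2 = (hnorm H (A e))\<^sup>2" if "e \<in> E" for e
      using iso \<open>adj A A'\<close> basis_in[OF E that] by simp
    show "hs_sm E (U \<circ> A)" using that unfolding hs_sm_def by (subst summable_on_cong[OF *]) auto
    show "hs2 E (U \<circ> A) = hs2 E A" unfolding hs2_def by (rule infsum_cong[OF *])
  qed
  have a: "adj (U \<circ> S) (T \<circ> U')" using adj_comp[OF U(1) adj_sym[OF T(1)]] .
  have S: "hs_sm E S" "hs2 E S = hs2 E T" using hs_sm_adj[OF E T] hs2_adj[OF E T] by auto
  have TU: "hs_sm E (T \<circ> U')" "hs2 E (T \<circ> U') = hs2 E T"
    using hs_sm_adj[OF E a] hs2_adj[OF E a] left[OF adj_sym[OF T(1)] S(1)] S by auto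
  show "hs_sm E (U \<circ> T \<circ> U')" "hs2 E (U \<circ> T \<circ> U') = hs2 E T"
    using left[OF adj_sym[OF a] TU(1)] TU(2) by (simp_all add: comp_assoc)
qed

end

section \<open>Operators commuting with a Hilbert--Schmidt operator\<close>

context hilb
begin

lemma adj_funpow: "adj D D \<Longrightarrow> adj (D ^^ n) (D ^^ n)"
proof (induction n)
  case 0
  show ?case unfolding adj_def by simp
next
  case (Suc n)
  then show ?case using adj_comp[OF Suc.IH Suc.prems] by (simp add: funpow_swap1 comp_def fun_eq_iff)
qed

lemma hs_sm_comp:
  assumes E: "orthonormal_basis H E" and T: "adj T S" "hs_sm E T"
    and A: "adj A A'" "\<And>v. v \<in> vecs H \<Longrightarrow> hnorm H (A v) \<le> C * hnorm H v"
  shows "hs_sm E (A \<circ> T)" "hs2 E (A \<circ> T) \<le> C\<^sup>2 * hs2 E T"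
proof -
  have le: "(hnorm H ((A \<circ> T) e))\<^sup>2 \<le> C\<^sup>2 * (hnorm H (T e))\<^sup>2" if "e \<in> E" for e
  proof -
    have "T e \<in> vecs H" "A (T e) \<in> vecs H"
      using adj_in[OF T(1)] adj_in[OF A(1)] basis_in[OF E that] by blast+
    then have "(hnorm H (A (T e)))\<^sup>2 \<le> (C * hnorm H (T e))\<^sup>2"
      using A(2) by (intro power_mono) simp_all
    then show ?thesis by (simp add: power_mult_distrib)
  qed
  have sm: "(\<lambda>e. C\<^sup>2 * (hnorm H (T e))\<^sup>2) summable_on E"
    using T(2) unfolding hs_sm_def by (rule summable_on_cmult_right)
  show 1: "hs_sm E (A \<circ> T)"
    unfolding hs_sm_def by (rule summable_on_comparison_test[OF sm le]) auto
  show "hs2 E (A \<circ> T) \<le> C\<^sup>2 * hs2 E T"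
    using infsum_mono[OF 1[unfolded hs_sm_def] sm le] by (simp add: hs2_def infsum_cmult_right')
qed

text \<open>The even powers of a self-adjoint Hilbert--Schmidt contraction converge in the
  Hilbert--Schmidt norm, since \<open>hs2 E (D ^^ n)\<close> is decreasing and the inner product of two powers
  depends only on the sum of the exponents.\<close>

lemma fixed_vector_of_contraction:
  assumes E: "orthonormal_basis H E" and D: "adj D D" "hs_sm E D" "\<And>v. v \<notin> vecs H \<Longrightarrow> D v = 0"
    and c: "\<And>v. v \<in> vecs H \<Longrightarrow> hnorm H (D v) \<le> hnorm H v"
    and n: "\<And>\<delta>. \<delta> < 1 \<Longrightarrow> \<exists>v\<in>vecs H. hnorm H v \<le> 1 \<and> \<delta> < hnorm H (D v)"
  shows "\<exists>v\<in>vecs H. v \<noteq> 0 \<and> D (D v) = v"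
proof -
  interpret HS: hilb "HS E" using HS_hilbert[OF E] by unfold_locales
  have ap: "adj (D ^^ n) (D ^^ n)" for n by (rule adj_funpow[OF D(1)])
  have Pin: "(D ^^ n) v \<in> vecs H" if "v \<in> vecs H" for n v using adj_in[OF ap that] .
  have c1: "hnorm H (D v) \<le> 1 * hnorm H v" if "v \<in> vecs H" for v using c[OF that] by simp
  have sm: "hs_sm E (D ^^ Suc n)" and dec: "hs2 E (D ^^ Suc (Suc n)) \<le> hs2 E (D ^^ Suc n)" for n
  proof -
    have "hs_sm E (D ^^ Suc n)"  for n
    proof (induction n)
      case 0
      then show ?case using D(2) by simp
    next
      case (Suc n)
      then show ?case using hs_sm_comp(1)[OF E ap Suc D(1) c1] by (simp only: funpow.simps)
    qed
    then show "hs_sm E (D ^^ Suc n)" "hs2 E (D ^^ Suc (Suc n)) \<le> hs2 E (D ^^ Suc n)"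
      using hs_sm_comp(2)[OF E ap _ D(1) c1, of "Suc n"] by (simp_all only: funpow.simps) auto
  qed
  \<comment> \<open>Repeated doubling of the exponent: with \<open>w = (D ^^ (2 ^ j)) v\<close>, the
    squared norm of \<open>w\<close> is the inner product of \<open>(D ^^ (2 ^ j)) w\<close> with
    \<open>v\<close>, so a lower bound \<open>sqrt \<delta>\<close> at one stage gives
    \<open>\<delta>\<close> at the next.\<close>
  have big: "\<exists>v\<in>vecs H. hnorm H v \<le> 1 \<and> \<delta> < hnorm H ((D ^^ (2 ^ j)) v)" if "\<delta> < 1" for \<delta> j
    using that
  proof (induction j arbitrary: \<delta>)
    case 0
    then show ?case using n by simp
  next
    case (Suc j)
    have "sqrt (max \<delta> 0) < 1" using Suc.prems by simp
    then obtain v where v: "v \<in> vecs H" "hnorm H v \<le> 1" "sqrt (max \<delta> 0) < hnorm H ((D ^^ (2 ^ j)) v)"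
      using Suc.IH by blast
    let ?w = "(D ^^ (2 ^ j)) v"
    have w: "?w \<in> vecs H" by (rule Pin[OF v(1)])
    have "max \<delta> 0 < (hnorm H ?w)\<^sup>2" using v(3) w
      by (metis max.cobounded2 norm_nonneg real_sqrt_less_iff real_sqrt_unique)
    also have "(hnorm H ?w)\<^sup>2 = Re (ip H ?w ?w)" using norm_sq[OF w] .
    also have "ip H ?w ?w = ip H ((D ^^ (2 ^ j)) ?w) v"
      using adj_ip[OF ap w v(1)] by simp
    also have "Re \<dots> \<le> hnorm H ((D ^^ (2 ^ j)) ?w) * hnorm H v"
      using cauchy_schwarz[OF Pin[OF w] v(1)] complex_Re_le_cmod order_trans by blast
    also have "\<dots> \<le> hnorm H ((D ^^ (2 ^ j)) ?w) * 1"
      using v Pin[OF w] by (intro mult_left_mono) auto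
    finally have "\<delta> < hnorm H ((D ^^ (2 ^ j)) ?w)" by simp
    moreover have "(D ^^ (2 ^ j)) ?w = (D ^^ (2 ^ Suc j)) v"
      by (simp add: mult_2 funpow_add)
    ultimately show ?case using v by auto
  qed
  define b where "b n = hs2 E (D ^^ Suc n)" for n
  have bdec: "decseq b" unfolding b_def by (intro decseq_SucI dec)
  \<comment> \<open>A vector of norm at most 1 whose image is longer than 1/2 gives 1/4 for the
    squared Hilbert-Schmidt norm. This is available for the exponents \<open>2 ^ n\<close>, and
    monotonicity carries it to the smaller exponents.\<close>
  have b4: "1/4 \<le> b n" for n
  proof -
    obtain v where v: "v \<in> vecs H" "hnorm H v \<le> 1" "1/2 < hnorm H ((D ^^ (2 ^ n)) v)"
      using big[of "1/2" n] by auto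
    have "n < 2 ^ n" by (rule less_exp)
    then obtain m where m: "2 ^ n = Suc m" "n \<le> m" by (metis Suc_less_eq less_Suc_eq_le less_imp_Suc_add)
    have "1/2 \<le> sqrt (b m) * hnorm H v"
      using hs_bound[OF E ap sm v(1), of m] v(3) m by (simp add: b_def)
    also have "\<dots> \<le> sqrt (b m) * 1" using v(2) by (intro mult_left_mono) (auto simp: b_def)
    finally have "(1/2)\<^sup>2 \<le> (sqrt (b m))\<^sup>2" by (intro power_mono) auto
    then have "1/4 \<le> b m" by (simp add: b_def power2_eq_square)
    also have "\<dots> \<le> b n" using bdec m(2) by (simp add: decseq_def)
    finally show ?thesis .
  qed
  have "norm (b n) \<le> b 0" for n
    using b4[of n] decseqD[OF bdec, of 0 n] by simp
  then have "Bseq b" by (rule BseqI')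
  then have "convergent b" using Bseq_monoseq_convergent bdec decseq_imp_monoseq by blast
  then obtain L where L: "b \<longlonglongrightarrow> L" by (auto simp: convergent_def)
  \<comment> \<open>Odd powers are left out because an eigenvalue -1 would make the full sequence
    oscillate. The exponents start at 2 since the zeroth power, the identity, need not be
    Hilbert-Schmidt.\<close>
  define P where "P i = D ^^ (Suc (Suc (2 * i)))" for i
  have P_ap: "adj (P i) (P i)" for i unfolding P_def by (rule ap)
  have P_sm: "hs_sm E (P i)" for i unfolding P_def by (rule sm)
  have off: "(D ^^ Suc n) v = 0" if "v \<notin> vecs H" for n v
    using that D(3) adj_zero[OF ap] by (simp add: funpow_swap1)
  have P_HS: "P i \<in> vecs (HS E)" for i
    unfolding HS_vecs using P_ap P_sm off by (auto simp: P_def simp del: funpow.simps)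
  have ip_sum: "ip H ((D ^^ i) e) ((D ^^ j) e) = ip H e ((D ^^ (i + j)) e)" if "e \<in> vecs H" for i j e
    using adj_ip[OF ap that Pin[OF that]] by (simp add: funpow_add)
  have P_ip: "hsip E (P i) (P j) = of_real (b (i + j + 1))" for i j
  proof -
    have "hsip E (P i) (P j) = hsip E (D ^^ Suc (i + j + 1)) (D ^^ Suc (i + j + 1))"
      unfolding hsip_def
    proof (rule infsum_cong)
      fix e assume "e \<in> E"
      then have e: "e \<in> vecs H" by (rule basis_in[OF E])
      have "Suc (Suc (2 * i)) + Suc (Suc (2 * j)) = Suc (i + j + 1) + Suc (i + j + 1)" by simp
      then show "ip H (P i e) (P j e) = ip H ((D ^^ Suc (i + j + 1)) e) ((D ^^ Suc (i + j + 1)) e)"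
        unfolding P_def ip_sum[OF e] by (simp only:)
    qed
    then show ?thesis unfolding b_def by (simp only: hsip_self[OF E ap])
  qed
  have Ps: "(hnorm (HS E) (P i))\<^sup>2 = b (2 * i + 1)" for i
    using HS.norm_sq[OF P_HS, of i] P_ip[of i i] by (simp only: HS_ip mult_2 Re_complex_of_real)
  \<comment> \<open>\<open>b (2 * i + 1)\<close>, \<open>b (2 * j + 1)\<close> and
    \<open>b (i + j + 1)\<close> all tend to \<open>L\<close>, so the right-hand side tends to 0:
    the even powers form a Cauchy sequence.\<close>
  have Pn: "(hnorm (HS E) (P i - P j))\<^sup>2 = b (2 * i + 1) + b (2 * j + 1) - 2 * b (i + j + 1)" for i j
    unfolding HS.norm_diff_sq[OF P_HS P_HS] Ps by (simp add: P_ip)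
  obtain Q where Q: "Q \<in> vecs (HS E)" "(\<lambda>n. hnorm (HS E) (P n - Q)) \<longlonglongrightarrow> 0"
  proof (rule HS.complete[OF P_HS])
    fix \<epsilon> :: real assume \<epsilon>: "\<epsilon> > 0"
    then obtain N where N: "\<And>n. n \<ge> N \<Longrightarrow> \<bar>b n - L\<bar> < \<epsilon>\<^sup>2 / 4"
      using LIMSEQ_D[OF L, of "\<epsilon>\<^sup>2 / 4"] by auto
    show "\<exists>N. \<forall>m\<ge>N. \<forall>n\<ge>N. hnorm (HS E) (P m - P n) < \<epsilon>"
    proof (intro exI[of _ N] allI impI)
      fix m n assume mn: "m \<ge> N" "n \<ge> N"
      then have "N \<le> 2 * m + 1" "N \<le> 2 * n + 1" "N \<le> m + n + 1" by auto
      then have "(hnorm (HS E) (P m - P n))\<^sup>2 < \<epsilon>\<^sup>2"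
        using N[of "2 * m + 1"] N[of "2 * n + 1"] N[of "m + n + 1"]
        unfolding Pn abs_less_iff by linarith
      then show "hnorm (HS E) (P m - P n) < \<epsilon>" using \<epsilon>
        by - (rule power_less_imp_less_base, assumption, simp)
    qed
  qed blast
  obtain Q' where aQ: "adj Q Q'" and sQ: "hs_sm E Q" using Q(1) by (auto simp: HS_vecs)
  have Qin: "Q v \<in> vecs H" if "v \<in> vecs H" for v using adj_in[OF aQ that] .
  have lim: "(\<lambda>n. hnorm H (P n v - Q v)) \<longlonglongrightarrow> 0" if v: "v \<in> vecs H" for v
  proof (rule Lim_null_comparison)
    have "hnorm H ((P n - Q) v) \<le> hnorm (HS E) (P n - Q) * hnorm H v" for n
      using hs_bound[OF E adj_minus[OF P_ap aQ] _ v, of n] HS.diff_in[OF P_HS Q(1), of n]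
      unfolding HS_norm[OF E adj_minus[OF P_ap aQ]] by (simp add: HS_vecs)
    then show "\<forall>\<^sub>F n in sequentially. norm (hnorm H (P n v - Q v)) \<le> hnorm (HS E) (P n - Q) * hnorm H v"
      using v Pin Qin unfolding P_def by (intro always_eventually) (auto simp del: funpow.simps)
    show "(\<lambda>n. hnorm (HS E) (P n - Q) * hnorm H v) \<longlonglongrightarrow> 0"
      using tendsto_mult[OF Q(2) tendsto_const] by simp
  qed
  have PH: "P n v \<in> vecs H" if "v \<in> vecs H" for n v unfolding P_def by (rule Pin[OF that])
  have DH: "D v \<in> vecs H" if "v \<in> vecs H" for v using adj_in[OF D(1) that] .
  \<comment> \<open>Applying \<open>D\<close> twice shifts the sequence \<open>P\<close> by one and
    does not increase distances, so both limits agree.\<close>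
  have fixQ: "D (D (Q v)) = Q v" if v: "v \<in> vecs H" for v
  proof (rule limit_unique)
    show "P (Suc n) v \<in> vecs H" for n using PH[OF v] .
    show "D (D (Q v)) \<in> vecs H" "Q v \<in> vecs H" using DH Qin v by auto
    show "(\<lambda>n. hnorm H (P (Suc n) v - Q v)) \<longlonglongrightarrow> 0"
      using lim[OF v] by (rule LIMSEQ_Suc)
    show "(\<lambda>n. hnorm H (P (Suc n) v - D (D (Q v)))) \<longlonglongrightarrow> 0"
    proof (rule Lim_null_comparison[OF always_eventually lim[OF v]], intro allI)
      fix n
      have "P (Suc n) v - D (D (Q v)) = D (D (P n v - Q v))"
        using PH[OF v] Qin[OF v] DH by (simp add: adj_diff[OF D(1)] P_def)
      then show "norm (hnorm H (P (Suc n) v - D (D (Q v)))) \<le> hnorm H (P n v - Q v)"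
        using c[of "P n v - Q v"] c[of "D (P n v - Q v)"] PH[OF v] Qin[OF v] DH by simp
    qed
  qed
  \<comment> \<open>The lower bound on \<open>b\<close> survives in the limit, so \<open>Q\<close>
    is nonzero; any nonzero value of \<open>Q\<close> is a fixed vector.\<close>
  have "(\<lambda>n. hnorm (HS E) (P n)) \<longlonglongrightarrow> hnorm (HS E) Q"
    by (rule HS.norm_tendsto[OF P_HS Q])
  moreover have "1/2 \<le> hnorm (HS E) (P n)" for n
  proof -
    have "(1/2)\<^sup>2 \<le> (hnorm (HS E) (P n))\<^sup>2"
      unfolding Ps using b4[of "2 * n + 1"] by (simp add: power2_eq_square)
    then show ?thesis by (rule power2_le_imp_le) (rule HS.norm_nonneg[OF P_HS])
  qed
  ultimately have "1/2 \<le> hnorm (HS E) Q" by (intro LIMSEQ_le_const) auto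
  then have "Q \<noteq> 0" by auto
  then obtain v where v: "Q v \<noteq> 0" by (auto simp: fun_eq_iff)
  then have "v \<in> vecs H" using Q(1) by (auto simp: HS_vecs)
  then show ?thesis using v fixQ Qin by blast
qed

text \<open>Each member of an orthonormal subset of \<open>V\<close> contributes 1 to a sum bounded
  by \<open>hs2 E A\<close>, so the cardinalities of such subsets are bounded; one of greatest
  cardinality spans \<open>V\<close>, since otherwise it could be extended.\<close>

lemma finite_dim_fixed:
  assumes E: "orthonormal_basis H E" and A: "adj A A" "hs_sm E A"
  defines "V \<equiv> {v \<in> vecs H. A v = v}"
  shows "complex_vector.subspace V" "\<exists>F. finite F \<and> V = complex_vector.span F"
proof -
  show sub: "complex_vector.subspace V"
    unfolding V_def
    by (rule complex_vector.subspaceI) (auto simp: adj_add[OF A(1)] adj_scale[OF A(1)] adj_zero[OF A(1)])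
  define \<F> where "\<F> = {F. finite F \<and> ortho F \<and> F \<subseteq> V}"
  have b: "real (card F) \<le> hs2 E A" if "F \<in> \<F>" for F
  proof -
    have "(\<Sum>f\<in>F. (hnorm H (A f))\<^sup>2) = (\<Sum>f\<in>F. 1)"
      using that by (intro sum.cong) (auto simp: \<F>_def V_def subset_iff ortho_norm)
    then show ?thesis using hs_adj_bound[OF E A, of F] that by (simp add: \<F>_def)
  qed
  have "{} \<in> \<F>" by (simp add: \<F>_def ortho_def)
  moreover have "\<forall>F. F \<in> \<F> \<longrightarrow> card F < Suc (nat \<lfloor>hs2 E A\<rfloor>)"
    using b le_nat_floor unfolding less_Suc_eq_le by blast
  ultimately have "\<exists>F. F \<in> \<F> \<and> (\<forall>G. G \<in> \<F> \<longrightarrow> card G \<le> card F)"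
    by (rule ex_has_greatest_nat[where P = "\<lambda>F. F \<in> \<F>" and f = card])
  then obtain F where F: "F \<in> \<F>" "\<And>G. G \<in> \<F> \<Longrightarrow> card G \<le> card F" by blast
  have "V \<subseteq> complex_vector.span F"
  proof
    fix v assume v: "v \<in> V"
    then have "v \<in> vecs H" by (simp add: V_def)
    then obtain F' where F': "F \<subseteq> F'" "finite F'" "ortho F'"
      "complex_vector.span F' = complex_vector.span (insert v F)"
      using ortho_extend[of F v] F(1) by (auto simp: \<F>_def)
    have "F' \<subseteq> complex_vector.span (insert v F)"
      using complex_vector.span_superset[of F'] unfolding F'(4) .
    also have "\<dots> \<subseteq> V" using v F(1) sub by (intro complex_vector.span_minimal) (auto simp: \<F>_def)
    finally have "F' \<in> \<F>" using F' by (simp add: \<F>_def)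
    then have "F' = F" using F(2) F'(1,2) card_seteq[of F' F] by simp
    then show "v \<in> complex_vector.span F"
      using F'(4) complex_vector.span_base[of v "insert v F"] by simp
  qed
  moreover have "complex_vector.span F \<subseteq> V"
    using F(1) sub by (intro complex_vector.span_minimal) (auto simp: \<F>_def)
  ultimately show "\<exists>F. finite F \<and> V = complex_vector.span F" using F(1) by (auto simp: \<F>_def)
qed

text \<open>The candidate is the fixed space of \<open>D \<circ> D\<close>, where \<open>D\<close>
  is \<open>S \<circ> T\<close> divided by its operator norm \<open>\<mu>\<close>. As
  \<open>D\<close> is positive, this is the eigenspace of \<open>S \<circ> T\<close> for
  \<open>\<mu>\<close>. Closure of \<open>\<U>\<close> under adjoints is what makes \<open>S\<close>
  commute with \<open>\<U>\<close> as well.\<close>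

lemma finite_dim_of_commuting:
  assumes E: "orthonormal_basis H E" and T: "T \<in> vecs (HS E)" "T \<noteq> 0"
    and U: "\<And>u. u \<in> \<U> \<Longrightarrow> \<exists>u'\<in>\<U>. adj u u'"
    and com: "\<And>u v. u \<in> \<U> \<Longrightarrow> v \<in> vecs H \<Longrightarrow> T (u v) = u (T v)"
  shows "\<exists>V. complex_vector.subspace V \<and> V \<subseteq> vecs H \<and> V \<noteq> {0} \<and>
    (\<exists>F. finite F \<and> V = complex_vector.span F) \<and> (\<forall>u\<in>\<U>. u ` V \<subseteq> V)"
proof -
  obtain S where S: "adj T S" "hs_sm E T" and off: "\<And>v. v \<notin> vecs H \<Longrightarrow> T v = 0"
    using T(1) by (auto simp: HS_vecs)
  have TH: "T v \<in> vecs H" and SH: "S v \<in> vecs H" if "v \<in> vecs H" for v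
    using adj_in[OF S(1) that] adj_in'[OF S(1) that] .
  define A where "A = S \<circ> T"
  have A: "adj A A" unfolding A_def by (rule adj_comp[OF adj_sym[OF S(1)] S(1)])
  have AH: "A v \<in> vecs H" if "v \<in> vecs H" for v using adj_in[OF A that] .
  have Ssm: "hs_sm E S" by (rule hs_sm_adj(1)[OF E S])
  have Asm: "hs_sm E A" unfolding A_def
    by (rule hs_sm_comp(1)[OF E S adj_sym[OF S(1)] hs_bound[OF E adj_sym[OF S(1)] Ssm]])
  define W where "W = {v \<in> vecs H. hnorm H v \<le> 1}"
  define \<mu> where "\<mu> = (SUP v\<in>W. hnorm H (A v))"
  have "hnorm H (A v) \<le> sqrt (hs2 E A)" if "v \<in> W" for v
  proof -
    have "hnorm H (A v) \<le> sqrt (hs2 E A) * hnorm H v" using hs_bound[OF E A Asm] that by (simp add: W_def)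
    also have "\<dots> \<le> sqrt (hs2 E A) * 1" using that by (intro mult_left_mono) (auto simp: W_def)
    finally show ?thesis by simp
  qed
  then have bdd: "bdd_above ((\<lambda>v. hnorm H (A v)) ` W)" by (rule bdd_aboveI2)
  have le: "hnorm H (A v) \<le> \<mu> * hnorm H v" if v: "v \<in> vecs H" for v
  proof (cases "v = 0")
    case True
    then show ?thesis by (simp add: adj_zero[OF A])
  next
    case False
    then have n: "hnorm H v > 0" by (rule norm_pos[OF v])
    have "of_real (1 / hnorm H v) *\<^sub>C v \<in> W" using v n by (simp add: W_def norm_scale norm_divide)
    then have "hnorm H (A (of_real (1 / hnorm H v) *\<^sub>C v)) \<le> \<mu>"
      unfolding \<mu>_def by (rule cSUP_upper[OF _ bdd])
    then show ?thesis using n v AH[OF v]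
      by (simp add: adj_scale[OF A] norm_scale norm_divide field_simps)
  qed
  \<comment> \<open>The inner product of \<open>A v0\<close> with \<open>v0\<close> is the squared
    norm of \<open>T v0\<close>; hence \<open>A\<close> is nonzero and \<open>\<mu>\<close>
    positive, which permits the division below.\<close>
  obtain v0 where v0: "v0 \<in> vecs H" "T v0 \<noteq> 0" using T(2) off by (metis ext zero_fun_def)
  have "ip H (A v0) v0 = ip H (T v0) (T v0)"
    using adj_ip[OF adj_sym[OF S(1)] TH[OF v0(1)] v0(1)] by (simp add: A_def)
  moreover have "ip H (T v0) (T v0) \<noteq> 0" using v0 ip_eq_0[OF TH] by blast
  ultimately have "A v0 \<noteq> 0" using v0(1) by auto
  then have "0 < hnorm H (A v0)" using norm_pos AH v0 by blast
  also have "\<dots> \<le> \<mu> * hnorm H v0" by (rule le[OF v0(1)])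
  finally have \<mu>: "\<mu> > 0"
    using norm_nonneg[OF v0(1)] mult_nonpos_nonneg[of \<mu> "hnorm H v0"] by linarith
  define D where "D = of_real (1 / \<mu>) *\<^sub>C A"
  have Dv: "D v = of_real (1 / \<mu>) *\<^sub>C A v" for v by (simp add: D_def scaleC_fun_def)
  have D: "adj D D" using adj_cmult[OF A, of "of_real (1 / \<mu>)"] by (simp add: D_def)
  have DH: "D v \<in> vecs H" if "v \<in> vecs H" for v using adj_in[OF D that] .
  have Dsm: "hs_sm E D" unfolding D_def by (rule hs_sm_cmult(1)[OF E A Asm])
  have Dn: "hnorm H (D v) = hnorm H (A v) / \<mu>" if "v \<in> vecs H" for v
    using AH[OF that] \<mu> by (simp add: Dv norm_scale norm_divide)
  have Dc: "hnorm H (D v) \<le> hnorm H v" if "v \<in> vecs H" for v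
    using le[OF that] \<mu> by (simp add: Dn[OF that] field_simps)
  have "\<exists>v\<in>vecs H. v \<noteq> 0 \<and> D (D v) = v"
  proof (rule fixed_vector_of_contraction[OF E D Dsm _ Dc])
    show "D v = 0" if "v \<notin> vecs H" for v
      using off[OF that] adj_zero[OF adj_sym[OF S(1)]] by (simp add: Dv A_def)
    fix \<delta> :: real assume "\<delta> < 1"
    then have "\<delta> * \<mu> < \<mu>" using \<mu> by simp
    moreover have "W \<noteq> {}" by (auto simp: W_def intro!: exI[of _ 0])
    ultimately obtain v where "v \<in> W" "\<delta> * \<mu> < hnorm H (A v)"
      unfolding \<mu>_def using less_cSUP_iff[OF _ bdd] by metis
    then show "\<exists>v\<in>vecs H. hnorm H v \<le> 1 \<and> \<delta> < hnorm H (D v)"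
      using \<mu> by (auto simp: W_def Dn field_simps)
  qed
  then obtain v1 where v1: "v1 \<in> vecs H" "v1 \<noteq> 0" "D (D v1) = v1" by blast
  have D2: "adj (D \<circ> D) (D \<circ> D)" by (rule adj_comp[OF D D])
  have D2sm: "hs_sm E (D \<circ> D)"
    using hs_sm_comp(1)[OF E D Dsm D, of 1] Dc by simp
  define V where "V = {v \<in> vecs H. (D \<circ> D) v = v}"
  have inv: "u ` V \<subseteq> V" if u: "u \<in> \<U>" for u
  proof -
    obtain u' where u': "u' \<in> \<U>" "adj u u'" using U[OF u] by blast
    have uH: "u v \<in> vecs H" and u'H: "u' v \<in> vecs H" if "v \<in> vecs H" for v
      using adj_in[OF u'(2) that] adj_in'[OF u'(2) that] .
    \<comment> \<open>Commutation passes from \<open>T\<close> to its adjoint by moving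
      \<open>u\<close> across as \<open>u'\<close>, which also commutes with
      \<open>T\<close>.\<close>
    have "S (u v) = u (S v)" if v: "v \<in> vecs H" for v
    proof (rule eqI_ip)
      show "S (u v) \<in> vecs H" "u (S v) \<in> vecs H" using SH uH v by auto
      fix w assume w: "w \<in> vecs H"
      have "ip H (S (u v)) w = ip H (u v) (T w)" using adj_ip[OF adj_sym[OF S(1)] uH[OF v] w] .
      also have "\<dots> = ip H v (u' (T w))" using adj_ip[OF u'(2) v TH[OF w]] .
      also have "\<dots> = ip H v (T (u' w))" using com[OF u'(1) w] by simp
      also have "\<dots> = ip H (S v) (u' w)" using adj_ip[OF adj_sym[OF S(1)] v u'H[OF w]] by simp
      also have "\<dots> = ip H (u (S v)) w" using adj_ip[OF u'(2) SH[OF v] w] by simp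
      finally show "ip H (S (u v)) w = ip H (u (S v)) w" .
    qed
    then have "D (u v) = u (D v)" if "v \<in> vecs H" for v
      using that com[OF u that] TH[OF that] SH[OF TH[OF that]]
      by (simp add: Dv A_def adj_scale[OF u'(2)])
    then show ?thesis using uH DH by (auto simp: V_def)
  qed
  have "V \<noteq> {0}" using v1 by (auto simp: V_def)
  then show ?thesis
    using finite_dim_fixed[OF E D2 D2sm] inv by (intro exI[of _ V]) (auto simp: V_def)
qed

end

section \<open>Unitary representations of the limit group\<close>

text \<open>Preservation of inner products amounts to unitarity here, because the group law supplies
  inverse operators (\<open>rep_inv\<close>, \<open>rep_inv'\<close>).\<close>

definition unitary_rep ::
  "('a, 'm) monoid_scheme \<Rightarrow> 'v::complex_vector inner_space \<Rightarrow> ('a \<Rightarrow> 'v \<Rightarrow> 'v) \<Rightarrow> bool" where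
  "unitary_rep \<Gamma> H \<rho> \<longleftrightarrow>
     (\<forall>g\<in>carrier \<Gamma>. \<forall>v\<in>vecs H. \<rho> g v \<in> vecs H) \<and>
     (\<forall>g\<in>carrier \<Gamma>. \<forall>v\<in>vecs H. \<forall>w\<in>vecs H. \<rho> g (v + w) = \<rho> g v + \<rho> g w) \<and>
     (\<forall>g\<in>carrier \<Gamma>. \<forall>c. \<forall>v\<in>vecs H. \<rho> g (c *\<^sub>C v) = c *\<^sub>C \<rho> g v) \<and>
     (\<forall>g\<in>carrier \<Gamma>. \<forall>v\<in>vecs H. \<forall>w\<in>vecs H. ip H (\<rho> g v) (\<rho> g w) = ip H v w) \<and>
     (\<forall>v\<in>vecs H. \<rho> \<one>\<^bsub>\<Gamma>\<^esub> v = v) \<and>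
     (\<forall>g\<in>carrier \<Gamma>. \<forall>h\<in>carrier \<Gamma>. \<forall>v\<in>vecs H. \<rho> (g \<otimes>\<^bsub>\<Gamma>\<^esub> h) v = \<rho> g (\<rho> h v))"

locale unitary_representation = hilb H + group \<Gamma>
  for H :: "'v::complex_vector inner_space" and \<Gamma> :: "('a, 'm) monoid_scheme" (structure) +
  fixes \<rho> :: "'a \<Rightarrow> 'v \<Rightarrow> 'v"
  assumes rep: "unitary_rep \<Gamma> H \<rho>"
begin

lemma rep_in: "g \<in> carrier \<Gamma> \<Longrightarrow> v \<in> vecs H \<Longrightarrow> \<rho> g v \<in> vecs H"
  using rep unfolding unitary_rep_def by (elim conjE) blast

lemma rep_add: "g \<in> carrier \<Gamma> \<Longrightarrow> v \<in> vecs H \<Longrightarrow> w \<in> vecs H \<Longrightarrow> \<rho> g (v + w) = \<rho> g v + \<rho> g w"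
  using rep unfolding unitary_rep_def by (elim conjE) blast

lemma rep_scale: "g \<in> carrier \<Gamma> \<Longrightarrow> v \<in> vecs H \<Longrightarrow> \<rho> g (c *\<^sub>C v) = c *\<^sub>C \<rho> g v"
  using rep unfolding unitary_rep_def by (elim conjE) blast

lemma rep_ip: "g \<in> carrier \<Gamma> \<Longrightarrow> v \<in> vecs H \<Longrightarrow> w \<in> vecs H \<Longrightarrow> ip H (\<rho> g v) (\<rho> g w) = ip H v w"
  using rep unfolding unitary_rep_def by (elim conjE) blast

lemma rep_one: "v \<in> vecs H \<Longrightarrow> \<rho> \<one> v = v"
  using rep unfolding unitary_rep_def by (elim conjE) blast

lemma rep_mult:
  "g \<in> carrier \<Gamma> \<Longrightarrow> h \<in> carrier \<Gamma> \<Longrightarrow> v \<in> vecs H \<Longrightarrow> \<rho> (g \<otimes> h) v = \<rho> g (\<rho> h v)"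
  using rep unfolding unitary_rep_def by (elim conjE) blast

lemma rep_inv: "g \<in> carrier \<Gamma> \<Longrightarrow> v \<in> vecs H \<Longrightarrow> \<rho> (inv g) (\<rho> g v) = v"
  using rep_mult[of "inv g" g v] by (simp add: rep_one)

lemma rep_inv': "g \<in> carrier \<Gamma> \<Longrightarrow> v \<in> vecs H \<Longrightarrow> \<rho> g (\<rho> (inv g) v) = v"
  using rep_mult[of g "inv g" v] by (simp add: rep_one)

lemma rep_adj:
  assumes g: "g \<in> carrier \<Gamma>"
  shows "adj (\<rho> g) (\<rho> (inv g))"
  unfolding adj_def
proof (intro conjI ballI)
  fix v w assume "v \<in> vecs H" "w \<in> vecs H"
  then show "ip H (\<rho> g v) w = ip H v (\<rho> (inv g) w)"
    using rep_ip[OF g, of v "\<rho> (inv g) w"] g by (simp add: rep_in rep_inv')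
qed (use rep_in g in simp_all)

text \<open>The cut-off outside \<open>vecs H\<close> keeps the conjugate of an element of
  \<open>vecs (HS E)\<close> in \<open>vecs (HS E)\<close>.\<close>

definition conj_op :: "'a \<Rightarrow> ('v \<Rightarrow> 'v) \<Rightarrow> 'v \<Rightarrow> 'v" where
  "conj_op g T = (\<lambda>v. if v \<in> vecs H then \<rho> g (T (\<rho> (inv g) v)) else 0)"

lemma conj_op_comp:
  assumes E: "orthonormal_basis H E"
  shows "hs_sm E (conj_op g T) = hs_sm E (\<rho> g \<circ> T \<circ> \<rho> (inv g))"
    "hs2 E (conj_op g T) = hs2 E (\<rho> g \<circ> T \<circ> \<rho> (inv g))"
    "hsip E (conj_op g T) T' = hsip E (\<rho> g \<circ> T \<circ> \<rho> (inv g)) T'"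
    "adj (\<rho> g \<circ> T \<circ> \<rho> (inv g)) S \<Longrightarrow> adj (conj_op g T) S"
  using basis_in[OF E] unfolding hs_sm_def hs2_def hsip_def adj_def
  by (auto simp: conj_op_def cong: summable_on_cong infsum_cong)

lemma conj_op_HS:
  assumes E: "orthonormal_basis H E" and g: "g \<in> carrier \<Gamma>" and T: "T \<in> vecs (HS E)"
  shows "conj_op g T \<in> vecs (HS E)" "hnorm (HS E) (conj_op g T) = hnorm (HS E) T"
proof -
  obtain S where S: "adj T S" "hs_sm E T" using T by (auto simp: HS_vecs)
  have a: "adj (\<rho> g \<circ> T \<circ> \<rho> (inv g)) (\<rho> g \<circ> (S \<circ> \<rho> (inv g)))"
    by (rule adj_comp[OF adj_comp[OF rep_adj[OF g] S(1)] adj_sym[OF rep_adj[OF g]]])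
  have b: "adj (conj_op g T) (\<rho> g \<circ> (S \<circ> \<rho> (inv g)))" by (rule conj_op_comp(4)[OF E a])
  note c = hs2_conj[OF E S rep_adj[OF g] rep_inv[OF g]]
  show "conj_op g T \<in> vecs (HS E)"
    unfolding HS_vecs conj_op_comp[OF E] using b c(1) by (auto simp: conj_op_def)
  show "hnorm (HS E) (conj_op g T) = hnorm (HS E) T"
    unfolding HS_norm[OF E b] HS_norm[OF E S(1)] conj_op_comp[OF E] using c(2) by simp
qed

lemma conj_op_rep:
  assumes E: "orthonormal_basis H E"
  shows "unitary_rep \<Gamma> (HS E) conj_op"
proof -
  interpret HS: hilb "HS E" using HS_hilbert[OF E] by unfold_locales
  have TH: "T v \<in> vecs H" if "T \<in> vecs (HS E)" "v \<in> vecs H" for T v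
    using that adj_in by (auto simp: HS_vecs)
  have add: "conj_op g (T + T') = conj_op g T + conj_op g T'"
    if "g \<in> carrier \<Gamma>" "T \<in> vecs (HS E)" "T' \<in> vecs (HS E)" for g T T'
    using that TH rep_in by (auto simp: conj_op_def fun_eq_iff rep_add)
  have scale: "conj_op g (c *\<^sub>C T) = c *\<^sub>C conj_op g T"
    if "g \<in> carrier \<Gamma>" "T \<in> vecs (HS E)" for g T c
    using that TH rep_in by (auto simp: conj_op_def fun_eq_iff scaleC_fun_def rep_scale)
  have pol: "ip (HS E) (conj_op g T) (conj_op g T') = ip (HS E) T T'"
    if g: "g \<in> carrier \<Gamma>" and T: "T \<in> vecs (HS E)" "T' \<in> vecs (HS E)" for g T T'
  proof -
    note [simp] = conj_op_HS[OF E g]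
    have n: "hnorm (HS E) (conj_op g T + c *\<^sub>C conj_op g T') = hnorm (HS E) (T + c *\<^sub>C T')" for c
      using T add[OF g T(1) HS.scale_in[OF T(2)], of c] scale[OF g T(2)] conj_op_HS(2)[OF E g, of "T + c *\<^sub>C T'"]
      by simp
    \<comment> \<open>Polarization written so that all four terms have the form
      \<open>A + c *\<^sub>C B\<close>; the single norm identity \<open>n\<close> then handles them
      all.\<close>
    have p: "ip (HS E) A B = Complex
        (((hnorm (HS E) (A + 1 *\<^sub>C B))\<^sup>2 - (hnorm (HS E) (A + (- 1) *\<^sub>C B))\<^sup>2) / 4)
        (((hnorm (HS E) (A + \<i> *\<^sub>C B))\<^sup>2 - (hnorm (HS E) (A + (- \<i>) *\<^sub>C B))\<^sup>2) / 4)"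
      if "A \<in> vecs (HS E)" "B \<in> vecs (HS E)" for A B
      using HS.ip_polarize[OF that] by (simp add: scaleC_one del: HS_ip)
    show ?thesis unfolding p[OF T] p[OF conj_op_HS(1)[OF E g T(1)] conj_op_HS(1)[OF E g T(2)]] n ..
  qed
  have mult: "conj_op (g \<otimes> h) T = conj_op g (conj_op h T)"
    if "g \<in> carrier \<Gamma>" "h \<in> carrier \<Gamma>" "T \<in> vecs (HS E)" for g h T
    using that TH rep_in by (auto simp: conj_op_def fun_eq_iff rep_mult inv_mult_group)
  have one: "conj_op \<one> T = T" if "T \<in> vecs (HS E)" for T
    using that TH by (auto simp: conj_op_def fun_eq_iff rep_one HS_vecs)
  show ?thesis
    unfolding unitary_rep_def
    by (intro conjI ballI allI conj_op_HS(1)[OF E] add scale pol mult one)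
qed

end

text \<open>Property (T) for representations on the Hilbert spaces that occur in
  \<open>topological_property_T\<close>.\<close>

definition kazhdan_pair :: "('a, 'm) monoid_scheme \<Rightarrow> 'a set \<Rightarrow> real \<Rightarrow> bool" where
  "kazhdan_pair \<Gamma> F c \<longleftrightarrow> finite F \<and> F \<subseteq> carrier \<Gamma> \<and> 0 < c \<and>
     (\<forall>(H :: (nat \<Rightarrow> complex) inner_space) \<rho>. hilbert_space H \<longrightarrow> unitary_rep \<Gamma> H \<rho> \<longrightarrow>
        (\<forall>v\<in>vecs H. (\<forall>g\<in>carrier \<Gamma>. \<rho> g v = v) \<longrightarrow> v = 0) \<longrightarrow>
        (\<forall>v\<in>vecs H. v \<noteq> 0 \<longrightarrow> (\<exists>g\<in>F. c * hnorm H v \<le> hnorm H (\<rho> g v - v))))"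

text \<open>The inner product is transported along \<open>j\<close>. A linear injection is enough
  for this, because \<open>hilbert_space\<close> does not relate the inner product to the ambient
  type.\<close>

lemma kazhdan_pair_transport:
  fixes H :: "'v::complex_vector inner_space" and j :: "'v \<Rightarrow> nat \<Rightarrow> complex"
  assumes K: "kazhdan_pair \<Gamma> F c" and H: "hilbert_space H" and R: "unitary_rep \<Gamma> H \<rho>"
    and G: "group \<Gamma>"
    and j: "inj_on j (vecs H)" "\<And>v w. v \<in> vecs H \<Longrightarrow> w \<in> vecs H \<Longrightarrow> j (v + w) = j v + j w"
      "\<And>a v. v \<in> vecs H \<Longrightarrow> j (a *\<^sub>C v) = a *\<^sub>C j v"
    and inv: "\<And>v. v \<in> vecs H \<Longrightarrow> (\<And>g. g \<in> carrier \<Gamma> \<Longrightarrow> \<rho> g v = v) \<Longrightarrow> v = 0"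
    and v: "v \<in> vecs H" "v \<noteq> 0"
  shows "\<exists>g\<in>F. c * hnorm H v \<le> hnorm H (\<rho> g v - v)"
proof -
  interpret group \<Gamma> by fact
  interpret unitary_representation H \<Gamma> \<rho> by unfold_locales fact+
  define J where "J = inv_into (vecs H) j"
  have J [simp]: "J (j v) = v" if "v \<in> vecs H" for v
    unfolding J_def using inv_into_f_f[OF j(1) that] .
  define H' where "H' = \<lparr>vecs = j ` vecs H, ip = \<lambda>x y. ip H (J x) (J y)\<rparr>"
  define \<rho>' where "\<rho>' g x = j (\<rho> g (J x))" for g x
  have V': "vecs H' = j ` vecs H" by (simp add: H'_def)
  have ip': "ip H' (j v) (j w) = ip H v w" if "v \<in> vecs H" "w \<in> vecs H" for v w
    using that by (simp add: H'_def)
  have diff: "j (v - w) = j v - j w" if "v \<in> vecs H" "w \<in> vecs H" for v w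
    using j(2)[of "v - w" w] that by simp
  have j0: "j 0 = 0" using diff[of 0 0] by simp
  have n': "hnorm H' (j v) = hnorm H v" if "v \<in> vecs H" for v
    using ip'[OF that that] by (simp add: hnorm_def)
  have nd': "hnorm H' (j v - j w) = hnorm H (v - w)" if "v \<in> vecs H" "w \<in> vecs H" for v w
    using n'[of "v - w"] diff that by simp
  have "hilbert_space H'"
    unfolding hilbert_space_def V' ball_simps
  proof (intro conjI ballI allI impI)
    show "complex_vector.subspace (j ` vecs H)"
    proof (rule complex_vector.subspaceI)
      show "0 \<in> j ` vecs H" using j0 by (intro image_eqI[of _ _ 0]) auto
      show "x + y \<in> j ` vecs H" if "x \<in> j ` vecs H" "y \<in> j ` vecs H" for x y
        using that by (auto simp flip: j(2))
      show "a *\<^sub>C x \<in> j ` vecs H" if "x \<in> j ` vecs H" for a x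
        using that by (auto simp flip: j(3))
    qed
    fix u v w assume uvw: "u \<in> vecs H" "v \<in> vecs H" "w \<in> vecs H"
    show "ip H' (j u + j v) (j w) = ip H' (j u) (j w) + ip H' (j v) (j w)"
      using uvw by (simp add: ip' ip_add_left flip: j(2))
  next
    fix c v w assume "v \<in> vecs H" "w \<in> vecs H"
    then show "ip H' (c *\<^sub>C j v) (j w) = c * ip H' (j v) (j w)"
      by (simp add: ip' ip_scale_left flip: j(3))
  next
    fix v w assume "v \<in> vecs H" "w \<in> vecs H"
    then show "ip H' (j w) (j v) = cnj (ip H' (j v) (j w))"
      unfolding ip'[OF \<open>w \<in> vecs H\<close> \<open>v \<in> vecs H\<close>] ip'[OF \<open>v \<in> vecs H\<close> \<open>w \<in> vecs H\<close>]
      by (rule ip_cnj)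
  next
    fix v assume v: "v \<in> vecs H"
    show "0 \<le> Re (ip H' (j v) (j v))" using v by (simp add: ip' ip_nonneg)
    assume "ip H' (j v) (j v) = 0"
    then show "j v = 0" using v ip_eq_0[OF v] j0 by (simp add: ip')
  next
    fix s :: "nat \<Rightarrow> nat \<Rightarrow> complex"
    assume s: "range s \<subseteq> j ` vecs H \<and> (\<forall>\<epsilon>>0. \<exists>N. \<forall>m\<ge>N. \<forall>n\<ge>N. hnorm H' (s m - s n) < \<epsilon>)"
    define t where "t n = J (s n)" for n
    have t: "t n \<in> vecs H" "s n = j (t n)" for n
    proof -
      obtain v where "v \<in> vecs H" "s n = j v" using s by blast
      then show "t n \<in> vecs H" "s n = j (t n)" by (simp_all add: t_def)
    qed
    have C: "\<forall>\<epsilon>>0. \<exists>N. \<forall>m\<ge>N. \<forall>n\<ge>N. hnorm H (t m - t n) < \<epsilon>"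
      using s by (simp add: t(2) nd'[OF t(1) t(1)])
    obtain l where "l \<in> vecs H" "(\<lambda>n. hnorm H (t n - l)) \<longlonglongrightarrow> 0"
      by (rule complete[OF t(1) C[rule_format]])
    then show "\<exists>l\<in>j ` vecs H. (\<lambda>n. hnorm H' (s n - l)) \<longlonglongrightarrow> 0"
      by (intro bexI[of _ "j l"]) (simp_all add: t nd')
  qed
  moreover have "unitary_rep \<Gamma> H' \<rho>'"
    unfolding unitary_rep_def V' ball_simps
    by (intro conjI ballI allI)
      (simp_all add: \<rho>'_def rep_in rep_add rep_scale rep_ip rep_one rep_mult ip' flip: j(2,3))
  moreover have "\<forall>x\<in>vecs H'. (\<forall>g\<in>carrier \<Gamma>. \<rho>' g x = x) \<longrightarrow> x = 0"
    unfolding V'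
  proof (intro ballI impI)
    fix x assume "x \<in> j ` vecs H" and i: "\<forall>g\<in>carrier \<Gamma>. \<rho>' g x = x"
    then obtain v where v: "v \<in> vecs H" "x = j v" by blast
    have "\<rho> g v = v" if g: "g \<in> carrier \<Gamma>" for g
    proof (rule inj_onD[OF j(1)])
      show "j (\<rho> g v) = j v" using i g v by (simp add: \<rho>'_def)
    qed (use v rep_in g in auto)
    then show "x = 0" using inv[OF v(1)] v(2) j0 by simp
  qed
  ultimately have "\<forall>x\<in>vecs H'. x \<noteq> 0 \<longrightarrow> (\<exists>g\<in>F. c * hnorm H' x \<le> hnorm H' (\<rho>' g x - x))"
    using K unfolding kazhdan_pair_def by (elim conjE) blast
  moreover have "j v \<in> vecs H'" "j v \<noteq> 0"
    using v inj_onD[OF j(1), of v 0] j0 by (auto simp: V')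
  ultimately obtain g where g: "g \<in> F" "c * hnorm H' (j v) \<le> hnorm H' (\<rho>' g (j v) - j v)" by blast
  have "g \<in> carrier \<Gamma>" using g(1) K by (auto simp: kazhdan_pair_def)
  then show ?thesis using g v
    by (intro bexI[of _ g]) (simp_all add: \<rho>'_def n' nd' rep_in)
qed

context unitary_representation
begin

text \<open>The coordinates are the inner products of \<open>T (s m)\<close> with \<open>s n\<close>
  for a dense sequence \<open>s\<close>, the pair \<open>(m, n)\<close> being coded by one natural
  number.\<close>

lemma HS_embedding:
  assumes E: "orthonormal_basis H E" and sep: "separable_hilbert H"
  obtains j :: "('v \<Rightarrow> 'v) \<Rightarrow> nat \<Rightarrow> complex" where "inj_on j (vecs (HS E))"
    "\<And>T T'. T \<in> vecs (HS E) \<Longrightarrow> T' \<in> vecs (HS E) \<Longrightarrow> j (T + T') = j T + j T'"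
    "\<And>a T. T \<in> vecs (HS E) \<Longrightarrow> j (a *\<^sub>C T) = a *\<^sub>C j T"
proof -
  interpret HS: hilb "HS E" using HS_hilbert[OF E] by unfold_locales
  obtain S where S: "countable S" "dense_in H S" using sep by (auto simp: separable_hilbert_def)
  have "S \<noteq> {}" using S(2) zero_in zero_less_one[where ?'a = real] unfolding dense_in_def by blast
  then obtain s :: "nat \<Rightarrow> 'v" where s: "range s = S" using S(1) range_from_nat_into[of S] by blast
  have sH: "s n \<in> vecs H" for n using S(2) s by (auto simp: dense_in_def)
  have sd: "\<exists>n. hnorm H (v - s n) < \<epsilon>" if "v \<in> vecs H" "\<epsilon> > 0" for v \<epsilon>
    using S(2) s that unfolding dense_in_def by blast
  have z: "w = 0" if w: "w \<in> vecs H" "\<And>n. ip H w (s n) = 0" for w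
  proof (rule ccontr)
    assume "w \<noteq> 0"
    then have p: "hnorm H w > 0" by (rule norm_pos[OF w(1)])
    then obtain n where n: "hnorm H (w - s n) < hnorm H w" using sd[OF w(1)] by blast
    have "(hnorm H w)\<^sup>2 = Re (ip H w (w - s n))"
      using w sH by (simp add: norm_sq ip_diff_right)
    also have "\<dots> \<le> hnorm H w * hnorm H (w - s n)"
      using cauchy_schwarz[of w "w - s n"] w(1) sH complex_Re_le_cmod order_trans diff_in by blast
    also have "\<dots> < hnorm H w * hnorm H w" using n p by simp
    finally show False by (simp add: power2_eq_square)
  qed
  have TH: "T v \<in> vecs H" if "T \<in> vecs (HS E)" "v \<in> vecs H" for T v
    using that adj_in by (auto simp: HS_vecs)
  define j where "j T = (\<lambda>k. ip H (T (s (fst (prod_decode k)))) (s (snd (prod_decode k))))" for T :: "'v \<Rightarrow> 'v"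
  have add: "j (T + T') = j T + j T'" if "T \<in> vecs (HS E)" "T' \<in> vecs (HS E)" for T T'
    using that TH sH by (simp add: j_def fun_eq_iff ip_add_left)
  have scale: "j (a *\<^sub>C T) = a *\<^sub>C j T" if "T \<in> vecs (HS E)" for a T
    using that TH sH by (simp add: j_def fun_eq_iff scaleC_fun_def scaleC_complex_def ip_scale_left)
  \<comment> \<open>If \<open>T\<close> vanishes along \<open>s\<close>, every value of its adjoint
    is orthogonal to \<open>s\<close>, so the adjoint is zero and with it \<open>T\<close>. This
    takes the place of a continuity argument for \<open>T\<close>.\<close>
  have zero: "T = 0" if T: "T \<in> vecs (HS E)" and "j T = 0" for T
  proof -
    obtain S where S: "adj T S" using T by (auto simp: HS_vecs)
    have "ip H (T (s m)) (s n) = 0" for m n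
      using fun_cong[OF that(2), of "prod_encode (m, n)"] by (simp add: j_def)
    then have Ts: "T (s m) = 0" for m using z TH[OF T] sH by blast
    have S0: "S w = 0" if w: "w \<in> vecs H" for w
    proof (rule z)
      show "S w \<in> vecs H" by (rule adj_in'[OF S w])
      show "ip H (S w) (s n) = 0" for n
        using adj_ip[OF adj_sym[OF S] w sH] w by (simp add: Ts)
    qed
    have "T v = 0" if v: "v \<in> vecs H" for v
    proof (rule eqI_ip)
      show "ip H (T v) w = ip H 0 w" if w: "w \<in> vecs H" for w
        using adj_ip[OF S v w] S0[OF w] v w by simp
    qed (use TH[OF T v] in auto)
    then show ?thesis using T unfolding HS_vecs by (metis ext zero_fun_def)
  qed
  have "inj_on j (vecs (HS E))"
  proof (rule inj_onI)
    fix T T' assume T: "T \<in> vecs (HS E)" "T' \<in> vecs (HS E)" and e: "j T = j T'"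
    have "j (T - T') + j T' = j T" using add[OF HS.diff_in[OF T] T(2)] by simp
    then have "j (T - T') = 0" using e by simp
    then show "T = T'" using zero[OF HS.diff_in[OF T]] by simp
  qed
  then show ?thesis using that add scale by blast
qed

text \<open>The strict inequality says that conjugation by each \<open>g\<close> in \<open>F\<close>
  moves \<open>T\<close> by less than \<open>c\<close> times its norm: its left side is the expanded
  squared displacement, conjugation being isometric. Without a finite-dimensional subrepresentation
  no nonzero operator would be invariant, and the Kazhdan pair would forbid such a
  \<open>T\<close>.\<close>

lemma finite_dim_subrep_of_almost_invariant:
  assumes E: "orthonormal_basis H E" and sep: "separable_hilbert H"
    and K: "kazhdan_pair \<Gamma> F c"
    and T: "adj T S" "hs_sm E T" "0 < hs2 E T"
      "\<And>g. g \<in> F \<Longrightarrow> 2 * (hs2 E T - Re (hsip E (\<rho> g \<circ> T \<circ> \<rho> (inv g)) T)) < c\<^sup>2 * hs2 E T"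
  shows "has_finite_dim_subrep \<Gamma> H \<rho>"
proof (rule ccontr)
  assume no: "\<not> has_finite_dim_subrep \<Gamma> H \<rho>"
  interpret HS: hilb "HS E" using HS_hilbert[OF E] by unfold_locales
  \<comment> \<open>Membership in \<open>vecs (HS E)\<close> requires vanishing off
    \<open>vecs H\<close>; the values on \<open>E\<close> are unaffected.\<close>
  define T0 where "T0 v = (if v \<in> vecs H then T v else 0)" for v
  have Te: "T0 e = T e" if "e \<in> E" for e using basis_in[OF E that] by (simp add: T0_def)
  have a0: "adj T0 S" using T(1) unfolding adj_def by (simp add: T0_def)
  have s0: "hs_sm E T0" using T(2) unfolding hs_sm_def by (simp add: Te cong: summable_on_cong)
  have h0: "hs2 E T0 = hs2 E T" unfolding hs2_def by (simp add: Te cong: infsum_cong)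
  have T0: "T0 \<in> vecs (HS E)" unfolding HS_vecs using a0 s0 by (auto simp: T0_def)
  have nz: "T0 \<noteq> 0"
  proof
    assume "T0 = 0"
    then have "hs2 E T0 = 0" by (simp add: hs2_def)
    then show False using T(3) h0 by simp
  qed
  obtain j :: "('v \<Rightarrow> 'v) \<Rightarrow> nat \<Rightarrow> complex" where j: "inj_on j (vecs (HS E))"
    "\<And>T T'. T \<in> vecs (HS E) \<Longrightarrow> T' \<in> vecs (HS E) \<Longrightarrow> j (T + T') = j T + j T'"
    "\<And>a T. T \<in> vecs (HS E) \<Longrightarrow> j (a *\<^sub>C T) = a *\<^sub>C j T"
    using HS_embedding[OF E sep] by blast
  have inv0: "A = 0" if A: "A \<in> vecs (HS E)" and i: "\<And>g. g \<in> carrier \<Gamma> \<Longrightarrow> conj_op g A = A" for A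
  proof (rule ccontr)
    assume A0: "A \<noteq> 0"
    have AH: "A v \<in> vecs H" if "v \<in> vecs H" for v using A that adj_in by (auto simp: HS_vecs)
    have com: "A (\<rho> g v) = \<rho> g (A v)" if g: "g \<in> carrier \<Gamma>" and v: "v \<in> vecs H" for g v
      using fun_cong[OF i[OF g], of "\<rho> g v"] rep_in[OF g v] rep_inv[OF g v] by (simp add: conj_op_def)
    have "\<exists>V. complex_vector.subspace V \<and> V \<subseteq> vecs H \<and> V \<noteq> {0} \<and>
      (\<exists>F. finite F \<and> V = complex_vector.span F) \<and> (\<forall>u\<in>\<rho> ` carrier \<Gamma>. u ` V \<subseteq> V)"
      by (rule finite_dim_of_commuting[OF E A A0]) (use rep_adj com inv_closed in blast)+
    then have "has_finite_dim_subrep \<Gamma> H \<rho>" unfolding has_finite_dim_subrep_def by blast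
    with no show False ..
  qed
  obtain g where g: "g \<in> F" "c * hnorm (HS E) T0 \<le> hnorm (HS E) (conj_op g T0 - T0)"
    using kazhdan_pair_transport[OF K HS.hilbert conj_op_rep[OF E] _ j inv0 T0 nz] by blast
  have gG: "g \<in> carrier \<Gamma>" and c: "0 < c" using g(1) K by (auto simp: kazhdan_pair_def)
  have "c\<^sup>2 * hs2 E T = (c * hnorm (HS E) T0)\<^sup>2"
    by (simp add: power_mult_distrib HS_norm[OF E a0] h0)
  also have "\<dots> \<le> (hnorm (HS E) (conj_op g T0 - T0))\<^sup>2"
    using g(2) c HS.norm_nonneg[OF T0] by (intro power_mono) auto
  also have "\<dots> = 2 * hs2 E T - 2 * Re (hsip E (conj_op g T0) T0)"
    using HS.norm_diff_sq[OF conj_op_HS(1)[OF E gG T0] T0] conj_op_HS(2)[OF E gG T0]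
    by (simp add: HS_norm[OF E a0] h0)
  also have "hsip E (conj_op g T0) T0 = hsip E (\<rho> g \<circ> T \<circ> \<rho> (inv g)) T"
    unfolding hsip_def
    by (rule infsum_cong) (simp add: conj_op_def T0_def basis_in[OF E] rep_in gG)
  finally show False using T(4)[OF g(1)] by simp
qed

end

section \<open>The topology of the HLS groupoid\<close>

context approximated_group
begin

abbreviation HLS :: "'a hls groupoid" where "HLS \<equiv> hls_groupoid \<Gamma> K"

lemma gtop_HLS [simp]: "gtop HLS = hls_topology \<Gamma> K"
  and gunits_HLS: "gunits HLS = {hls_point \<Gamma> K n \<one> | n. True}"
  and gsrc_HLS [simp]: "gsrc HLS = hls_unit \<Gamma> K"
  and grng_HLS [simp]: "grng HLS = hls_unit \<Gamma> K"
  and gmul_HLS [simp]: "gmul HLS = hls_mul \<Gamma> K"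
  and ginv_HLS [simp]: "ginv HLS = hls_inv \<Gamma> K"
  by (simp_all add: hls_groupoid_def)

lemma K_subgroup: "subgroup (K n) \<Gamma>"
  using K_normal by (simp add: normal_imp_subgroup)

lemma K_sub: "K n \<subseteq> carrier \<Gamma>"
  using K_subgroup by (rule subgroup.subset)

lemma one_Mod [simp]: "\<one>\<^bsub>\<Gamma> Mod K n\<^esub> = K n"
  by (simp add: FactGroup_def)

lemma coset_Mod: "g \<in> carrier \<Gamma> \<Longrightarrow> K n #> g \<in> carrier (\<Gamma> Mod K n)"
  using rcosetsI[OF K_sub] by (simp add: FactGroup_def)

lemma K_coset_one [simp]: "K n #> \<one> = K n"
  using K_sub by (rule coset_mult_one)

lemma K_Mod: "K n \<in> carrier (\<Gamma> Mod K n)"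
  using coset_Mod[of \<one> n] by simp

text \<open>\<open>g \<otimes> inv h\<close> differs from the identity, hence lies outside some
  \<open>K M\<close> and, the sequence being decreasing, outside all later ones. This makes
  bisections closed and their indicator functions continuous.\<close>

lemma coset_separate:
  assumes "g \<in> carrier \<Gamma>" "h \<in> carrier \<Gamma>" "g \<noteq> h"
  shows "\<exists>M. \<forall>n\<ge>M. K n #> g \<noteq> K n #> h"
proof -
  have "g \<otimes> inv h \<noteq> \<one>"
    using assms by (metis inv_closed inv_equality inv_inv)
  then obtain M where M: "g \<otimes> inv h \<notin> K M" using K_inter by blast
  have "K n #> g \<noteq> K n #> h" if "n \<ge> M" for n
  proof
    assume "K n #> g = K n #> h"
    then have "g \<in> K n #> h" using rcos_self[OF assms(1) K_subgroup[of n]] by simp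
    then obtain k where k: "k \<in> K n" "g = k \<otimes> h" by (auto simp: r_coset_def)
    then have "g \<otimes> inv h = k" using assms K_sub[of n] by (auto simp: m_assoc)
    then have "g \<otimes> inv h \<in> K M"
      using k(1) lift_Suc_antimono_le[of K, OF K_decreasing that] by blast
    with M show False ..
  qed
  then show ?thesis by blast
qed

lemma arrows_HLS:
  "topspace (hls_topology \<Gamma> K) = {Level n A | n A. A \<in> carrier (\<Gamma> Mod K n)} \<union> Limit ` carrier \<Gamma>"
proof -
  let ?R = "{Level n A | n A. A \<in> carrier (\<Gamma> Mod K n)} \<union> Limit ` carrier \<Gamma>"
  let ?L1 = "{{Level n A} | n A. A \<in> carrier (\<Gamma> Mod K n)}"
  let ?L2 = "{{hls_point \<Gamma> K n g | n. enat N < n} | g N. g \<in> carrier \<Gamma>}"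
  have p: "hls_point \<Gamma> K n g \<in> ?R" if "g \<in> carrier \<Gamma>" for n g
    using that coset_Mod by (cases n) (auto simp: hls_point_def)
  have "Limit g \<in> \<Union>?L2" if "g \<in> carrier \<Gamma>" for g
  proof (rule UnionI)
    show "{hls_point \<Gamma> K n g | n. enat 0 < n} \<in> ?L2" using that by blast
    show "Limit g \<in> {hls_point \<Gamma> K n g | n. enat 0 < n}"
      by (intro CollectI exI[of _ \<infinity>]) (simp add: hls_point_def)
  qed
  then have 1: "Limit ` carrier \<Gamma> \<subseteq> \<Union>?L2" by (rule image_subsetI)
  have 2: "\<Union>?L1 = {Level n A | n A. A \<in> carrier (\<Gamma> Mod K n)}" by auto
  have 3: "\<Union>?L2 \<subseteq> ?R"
  proof (rule subsetI, elim UnionE CollectE exE conjE)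
    fix x U g N
    assume x: "x \<in> U" and U: "U = {hls_point \<Gamma> K n g | n. enat N < n}" and g: "g \<in> carrier \<Gamma>"
    obtain n where "x = hls_point \<Gamma> K n g" using x unfolding U by (elim CollectE exE conjE)
    then show "x \<in> ?R" using p[OF g, of n] by (simp only:)
  qed
  show ?thesis
    unfolding hls_topology_def topology_generated_by_topspace Union_Un_distrib 2
    using 1 3 by (intro equalityI Un_least) (simp_all only: Un_upper1 le_supI2)
qed

lemma Level_arrow: "Level n A \<in> topspace (hls_topology \<Gamma> K) \<longleftrightarrow> A \<in> carrier (\<Gamma> Mod K n)"
  and Limit_arrow: "Limit g \<in> topspace (hls_topology \<Gamma> K) \<longleftrightarrow> g \<in> carrier \<Gamma>"
  unfolding arrows_HLS by auto

text \<open>Points at finite levels are isolated, and a neighbourhood of \<open>Limit g\<close> is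
  any set of arrows containing it and a tail of the cosets of \<open>g\<close>. Openness is tested
  through this description from here on.\<close>

lemma openin_HLS:
  "openin (hls_topology \<Gamma> K) V \<longleftrightarrow> V \<subseteq> topspace (hls_topology \<Gamma> K) \<and>
     (\<forall>g\<in>carrier \<Gamma>. Limit g \<in> V \<longrightarrow> (\<exists>N. \<forall>n>N. Level n (K n #> g) \<in> V))"
    (is "?L \<longleftrightarrow> ?R")
proof
  assume L: ?L
  have "\<forall>g. Limit g \<in> V \<longrightarrow> (\<exists>N. \<forall>n>N. Level n (K n #> g) \<in> V)"
    using L unfolding hls_topology_def openin_topology_generated_by_iff
  proof (induction rule: generate_topology_on.induct)
    case Empty
    then show ?case by simp
  next
    case (Int a b)
    show ?case
    proof (intro allI impI)
      fix g assume "Limit g \<in> a \<inter> b"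
      then obtain M N where "\<forall>n>M. Level n (K n #> g) \<in> a" "\<forall>n>N. Level n (K n #> g) \<in> b"
        using Int.IH by blast
      then show "\<exists>N. \<forall>n>N. Level n (K n #> g) \<in> a \<inter> b" by (intro exI[of _ "max M N"]) auto
    qed
  next
    case (UN k)
    then show ?case by blast
  next
    case (Basis s)
    show ?case
    proof (intro allI impI)
      fix g assume g: "Limit g \<in> s"
      then obtain h N where s: "s = {hls_point \<Gamma> K n h | n. enat N < n}" using Basis by auto
      have "h = g" using g unfolding s by (auto simp: hls_point_def split: enat.splits)
      then have "Level n (K n #> g) \<in> s" if "n > N" for n
        unfolding s using that by (intro CollectI exI[of _ "enat n"]) (simp add: hls_point_def)
      then show "\<exists>N. \<forall>n>N. Level n (K n #> g) \<in> s" by blast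
    qed
  qed
  then show ?R using openin_subset[OF L] by blast
next
  assume R: ?R
  show ?L
  proof (rule openin_subopen[THEN iffD2], intro ballI)
    fix x assume x: "x \<in> V"
    show "\<exists>T. openin (hls_topology \<Gamma> K) T \<and> x \<in> T \<and> T \<subseteq> V"
    proof (cases x)
      case (Level n A)
      then have "A \<in> carrier (\<Gamma> Mod K n)" using R x Level_arrow by blast
      then have "openin (hls_topology \<Gamma> K) {Level n A}"
        unfolding hls_topology_def by (intro topology_generated_by_Basis) blast
      then show ?thesis using x Level by blast
    next
      case (Limit g)
      then have g: "g \<in> carrier \<Gamma>" using R x Limit_arrow by blast
      then obtain N where N: "\<forall>n>N. Level n (K n #> g) \<in> V" using R x Limit by blast
      define T where "T = {hls_point \<Gamma> K n g | n. enat N < n}"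
      have "openin (hls_topology \<Gamma> K) T"
        unfolding hls_topology_def T_def using g by (intro topology_generated_by_Basis) blast
      moreover have "x \<in> T"
        unfolding T_def Limit by (intro CollectI exI[of _ \<infinity>]) (simp add: hls_point_def)
      moreover have "T \<subseteq> V"
        using N x Limit by (auto simp: T_def hls_point_def split: enat.splits)
      ultimately show ?thesis by blast
    qed
  qed
qed

lemma open_Level: "A \<in> carrier (\<Gamma> Mod K n) \<Longrightarrow> openin (hls_topology \<Gamma> K) {Level n A}"
  unfolding openin_HLS by (simp add: Level_arrow)

text \<open>The finite levels being isolated, only convergence along the cosets of one group element
  remains to be checked.\<close>

lemma continuous_map_HLS:
  "continuous_map (hls_topology \<Gamma> K) euclidean f \<longleftrightarrow>
     (\<forall>g\<in>carrier \<Gamma>. (\<lambda>n. f (Level n (K n #> g))) \<longlonglongrightarrow> f (Limit g))"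
proof -
  have "continuous_map (hls_topology \<Gamma> K) euclidean f \<longleftrightarrow>
     (\<forall>U. open U \<longrightarrow> (\<forall>g\<in>carrier \<Gamma>. f (Limit g) \<in> U \<longrightarrow> (\<exists>N. \<forall>n>N. f (Level n (K n #> g)) \<in> U)))"
    unfolding continuous_map_def openin_HLS
    by (simp add: Level_arrow Limit_arrow coset_Mod)
  also have "\<dots> \<longleftrightarrow> (\<forall>g\<in>carrier \<Gamma>. (\<lambda>n. f (Level n (K n #> g))) \<longlonglongrightarrow> f (Limit g))"
    unfolding tendsto_def eventually_sequentially by (meson le_eq_less_or_eq Suc_le_eq)
  finally show ?thesis .
qed

text \<open>The section of \<open>g\<close> over all levels. It is not one of the generating sets,
  whose levels satisfy \<open>enat N < n\<close> and so omit level 0, but for \<open>g\<close> in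
  the group it is clopen and compact and meets each fiber in one point.\<close>

definition bisection :: "'a \<Rightarrow> 'a hls set" where
  "bisection g = insert (Limit g) (range (\<lambda>n. Level n (K n #> g)))"

lemma bisection_Level: "Level n A \<in> bisection g \<longleftrightarrow> A = K n #> g"
  and bisection_Limit: "Limit h \<in> bisection g \<longleftrightarrow> h = g"
  by (auto simp: bisection_def)

lemma open_bisection: "g \<in> carrier \<Gamma> \<Longrightarrow> openin (hls_topology \<Gamma> K) (bisection g)"
  unfolding openin_HLS by (auto simp: bisection_def Level_arrow Limit_arrow coset_Mod)

lemma units_bisection: "gunits HLS = bisection \<one>"
proof
  show "gunits HLS \<subseteq> bisection \<one>"
    by (auto simp: gunits_HLS bisection_def hls_point_def split: enat.splits)
  have "hls_point \<Gamma> K \<infinity> \<one> = Limit \<one>" "hls_point \<Gamma> K (enat n) \<one> = Level n (K n #> \<one>)" for n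
    by (simp_all add: hls_point_def)
  then show "bisection \<one> \<subseteq> gunits HLS"
    unfolding gunits_HLS bisection_def by (metis (mono_tags, lifting) CollectI insert_subset image_subsetI)
qed

lemma unit_Level: "Level n A \<in> gunits HLS \<longleftrightarrow> A = K n"
  and unit_Limit: "Limit g \<in> gunits HLS \<longleftrightarrow> g = \<one>"
  unfolding units_bisection by (simp_all add: bisection_Level bisection_Limit)

lemma unit_cases [consumes 1, case_names level limit]:
  assumes "u \<in> gunits HLS"
  obtains n where "u = Level n (K n)" | "u = Limit \<one>"
  using assms by (cases u) (auto simp: unit_Level unit_Limit)

text \<open>A member of the cover that contains \<open>Limit g\<close> already contains all but
  finitely many points.\<close>

lemma compact_bisection:
  assumes g: "g \<in> carrier \<Gamma>"
  shows "compactin (hls_topology \<Gamma> K) (bisection g)"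
  unfolding compactin_def
proof (intro conjI allI impI)
  show "bisection g \<subseteq> topspace (hls_topology \<Gamma> K)" using open_bisection[OF g] by (rule openin_subset)
  fix \<U> assume U: "(\<forall>U\<in>\<U>. openin (hls_topology \<Gamma> K) U) \<and> bisection g \<subseteq> \<Union>\<U>"
  have "Limit g \<in> \<Union>\<U>" by (intro subsetD[OF conjunct2[OF U]]) (simp add: bisection_Limit)
  then obtain U0 where U0: "U0 \<in> \<U>" "Limit g \<in> U0" by (elim UnionE)
  have "openin (hls_topology \<Gamma> K) U0" using U U0(1) by blast
  from this[unfolded openin_HLS] obtain N where N: "\<forall>n>N. Level n (K n #> g) \<in> U0"
    using g U0(2) by (elim conjE) (drule (1) bspec, blast)
  have "Level n (K n #> g) \<in> \<Union>\<U>" for n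
    by (intro subsetD[OF conjunct2[OF U]]) (simp add: bisection_Level)
  then have "\<forall>n. \<exists>V\<in>\<U>. Level n (K n #> g) \<in> V" by (intro allI) (simp only: Union_iff)
  then obtain V where V: "\<And>n. V n \<in> \<U>" "\<And>n. Level n (K n #> g) \<in> V n" by metis
  have "bisection g \<subseteq> \<Union> (insert U0 (V ` {..N}))"
  proof
    fix x assume x: "x \<in> bisection g"
    show "x \<in> \<Union> (insert U0 (V ` {..N}))"
    proof (cases x)
      case (Level n A)
      then have A: "A = K n #> g" using x by (simp add: bisection_Level)
      show ?thesis
      proof (cases "n \<le> N")
        case True
        then show ?thesis using V(2)[of n] Level A by auto
      next
        case False
        then show ?thesis using N Level A by auto
      qed
    next
      case (Limit h)
      then show ?thesis using x U0(2) by (simp add: bisection_Limit)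
    qed
  qed
  then show "\<exists>\<F>. finite \<F> \<and> \<F> \<subseteq> \<U> \<and> bisection g \<subseteq> \<Union>\<F>"
    using U0(1) V(1) by (intro exI[of _ "insert U0 (V ` {..N})"]) auto
qed

lemma closed_bisection:
  assumes g: "g \<in> carrier \<Gamma>"
  shows "closedin (hls_topology \<Gamma> K) (bisection g)"
  unfolding closedin_def
proof
  show "bisection g \<subseteq> topspace (hls_topology \<Gamma> K)" using open_bisection[OF g] by (rule openin_subset)
  show "openin (hls_topology \<Gamma> K) (topspace (hls_topology \<Gamma> K) - bisection g)"
    unfolding openin_HLS
  proof (intro conjI ballI impI)
    fix h assume "h \<in> carrier \<Gamma>" "Limit h \<in> topspace (hls_topology \<Gamma> K) - bisection g"
    then have h: "h \<in> carrier \<Gamma>" "h \<noteq> g" by (auto simp: bisection_Limit)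
    then obtain M where "\<forall>n\<ge>M. K n #> h \<noteq> K n #> g" using coset_separate[OF _ g] by blast
    then show "\<exists>N. \<forall>n>N. Level n (K n #> h) \<in> topspace (hls_topology \<Gamma> K) - bisection g"
      using coset_Mod[OF h(1)] by (intro exI[of _ M]) (simp add: bisection_Level Level_arrow)
  qed auto
qed

text \<open>Bisections and isolated points cover everything, and on each of them the unit map is
  injective. This is what limits the number of arrows of a compact set in a fiber.\<close>

lemma bisection_cover:
  assumes C: "compactin (hls_topology \<Gamma> K) C"
  obtains \<F> where "finite \<F>" "C \<subseteq> \<Union>\<F>"
    "\<And>U x y. U \<in> \<F> \<Longrightarrow> x \<in> U \<Longrightarrow> y \<in> U \<Longrightarrow> hls_unit \<Gamma> K x = hls_unit \<Gamma> K y \<Longrightarrow> x = y"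
proof -
  define \<U> where "\<U> = bisection ` carrier \<Gamma> \<union> {{Level n A} | n A. A \<in> carrier (\<Gamma> Mod K n)}"
  have "openin (hls_topology \<Gamma> K) U" if "U \<in> \<U>" for U
    using that open_bisection open_Level by (auto simp: \<U>_def)
  moreover have "C \<subseteq> \<Union>\<U>"
  proof
    fix x assume x: "x \<in> C"
    show "x \<in> \<Union>\<U>"
    proof (cases x)
      case (Level n A)
      then have "{Level n A} \<in> \<U>"
        using x compactin_subset_topspace[OF C] Level_arrow[of n A] by (auto simp: \<U>_def)
      then show ?thesis using Level by blast
    next
      case (Limit g)
      then have "g \<in> carrier \<Gamma>" using x compactin_subset_topspace[OF C] Limit_arrow[of g] by auto
      then show ?thesis unfolding \<U>_def Limit by (intro UnionI[of "bisection g"]) (simp_all add: bisection_Limit)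
    qed
  qed
  ultimately obtain \<F> where F: "finite \<F>" "\<F> \<subseteq> \<U>" "C \<subseteq> \<Union>\<F>"
    using compactinD[OF C, of \<U>] by blast
  have inj: "x = y" if "U \<in> \<U>" "x \<in> U" "y \<in> U" "hls_unit \<Gamma> K x = hls_unit \<Gamma> K y" for U x y
    using that by (auto simp: \<U>_def bisection_def)
  show ?thesis
  proof (rule that[OF F(1,3)])
    fix U x y
    assume "U \<in> \<F>" and xy: "x \<in> U" "y \<in> U" "hls_unit \<Gamma> K x = hls_unit \<Gamma> K y"
    then have "U \<in> \<U>" using F(2) by blast
    then show "x = y" using xy by (rule inj)
  qed
qed

lemma compact_finite_Limit:
  assumes C: "compactin (hls_topology \<Gamma> K) C"
  shows "finite {g. Limit g \<in> C}"
proof -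
  obtain \<F> where F: "finite \<F>" "C \<subseteq> \<Union>\<F>"
    "\<And>U x y. U \<in> \<F> \<Longrightarrow> x \<in> U \<Longrightarrow> y \<in> U \<Longrightarrow> hls_unit \<Gamma> K x = hls_unit \<Gamma> K y \<Longrightarrow> x = y"
    using bisection_cover[OF C] by metis
  have "finite {g. Limit g \<in> U}" if "U \<in> \<F>" for U
  proof (cases "\<exists>g. Limit g \<in> U")
    case True
    then obtain g where "Limit g \<in> U" ..
    then have "{g. Limit g \<in> U} \<subseteq> {g}" using F(3)[OF that] by fastforce
    then show ?thesis by (rule finite_subset) simp
  qed simp
  then have "finite (\<Union>U\<in>\<F>. {g. Limit g \<in> U})" using F(1) by blast
  then show ?thesis by (rule rev_finite_subset) (use F(2) in blast)
qed

text \<open>Each member of the finite cover holds at most one arrow of a fiber. Uniformity in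
  \<open>u\<close> keeps the supremum in \<open>I_norm\<close> finite.\<close>

lemma compact_fiber_card:
  assumes C: "compactin (hls_topology \<Gamma> K) C"
  shows "\<exists>M. \<forall>u. finite (rng_fiber HLS u \<inter> C) \<and> card (rng_fiber HLS u \<inter> C) \<le> M"
proof -
  obtain \<F> where F: "finite \<F>" "C \<subseteq> \<Union>\<F>"
    "\<And>U x y. U \<in> \<F> \<Longrightarrow> x \<in> U \<Longrightarrow> y \<in> U \<Longrightarrow> hls_unit \<Gamma> K x = hls_unit \<Gamma> K y \<Longrightarrow> x = y"
    using bisection_cover[OF C] by metis
  have one: "finite (rng_fiber HLS u \<inter> U) \<and> card (rng_fiber HLS u \<inter> U) \<le> 1" if "U \<in> \<F>" for u U
  proof (cases "rng_fiber HLS u \<inter> U = {}")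
    case False
    then obtain x where x: "x \<in> rng_fiber HLS u \<inter> U" by blast
    then have "y = x" if "y \<in> rng_fiber HLS u \<inter> U" for y
      using F(3)[OF \<open>U \<in> \<F>\<close>, of y x] that by (auto simp: rng_fiber_def)
    then have "rng_fiber HLS u \<inter> U = {x}" using x by blast
    then show ?thesis by simp
  qed simp
  have sub: "rng_fiber HLS u \<inter> C \<subseteq> (\<Union>U\<in>\<F>. rng_fiber HLS u \<inter> U)" for u using F(2) by blast
  have fin: "finite (\<Union>U\<in>\<F>. rng_fiber HLS u \<inter> U)" for u using F(1) one by blast
  have "card (rng_fiber HLS u \<inter> C) \<le> card \<F>" for u
  proof -
    have "card (rng_fiber HLS u \<inter> C) \<le> card (\<Union>U\<in>\<F>. rng_fiber HLS u \<inter> U)"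
      by (rule card_mono[OF fin sub])
    also have "\<dots> \<le> (\<Sum>U\<in>\<F>. card (rng_fiber HLS u \<inter> U))" by (rule card_UN_le[OF F(1)])
    also have "\<dots> \<le> (\<Sum>U\<in>\<F>. 1)" using one by (intro sum_mono) blast
    finally show ?thesis by simp
  qed
  then show ?thesis using finite_subset[OF sub fin] by blast
qed

text \<open>A finite subcover of \<open>C\<close> by \<open>V\<close> and isolated points leaves
  only finitely many points outside \<open>V\<close>. This converts control at limit arrows into
  uniform control on compact sets.\<close>

lemma compact_minus_open:
  assumes C: "compactin (hls_topology \<Gamma> K) C" and V: "openin (hls_topology \<Gamma> K) V"
    and L: "\<And>g. Limit g \<in> C \<Longrightarrow> Limit g \<in> V"
  shows "\<exists>N. \<forall>n A. Level n A \<in> C - V \<longrightarrow> n \<le> N"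
proof -
  define \<U> where "\<U> = insert V {{Level n A} | n A. A \<in> carrier (\<Gamma> Mod K n)}"
  have "openin (hls_topology \<Gamma> K) U" if "U \<in> \<U>" for U
    using that V open_Level by (auto simp: \<U>_def)
  moreover have "C \<subseteq> \<Union>\<U>"
  proof
    fix x assume x: "x \<in> C"
    then show "x \<in> \<Union>\<U>"
    proof (cases x)
      case (Level n A)
      then have "{Level n A} \<in> \<U>"
        using x compactin_subset_topspace[OF C] Level_arrow[of n A] by (auto simp: \<U>_def)
      then show ?thesis using Level by blast
    next
      case (Limit g)
      then show ?thesis using x L by (simp add: \<U>_def)
    qed
  qed
  ultimately obtain \<F> where F: "finite \<F>" "\<F> \<subseteq> \<U>" "C \<subseteq> \<Union>\<F>"
    using compactinD[OF C, of \<U>] by blast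
  have "finite U" if "U \<in> \<F> - {V}" for U using that F(2) by (auto simp: \<U>_def)
  then have "finite (\<Union>(\<F> - {V}))" using F(1) by blast
  then have "finite (C - V)" by (rule rev_finite_subset) (use F(3) in blast)
  then have "finite ((\<lambda>x. case x of Level n A \<Rightarrow> n | Limit g \<Rightarrow> 0) ` (C - V))" by simp
  then obtain N where "\<forall>k\<in>(\<lambda>x. case x of Level n A \<Rightarrow> n | Limit g \<Rightarrow> 0) ` (C - V). k \<le> N"
    unfolding finite_nat_set_iff_bounded_le by blast
  then show ?thesis by (intro exI[of _ N]) force
qed

section \<open>The unit space\<close>

lemma openin_units:
  "openin (unit_top HLS) U \<longleftrightarrow>
     U \<subseteq> gunits HLS \<and> (Limit \<one> \<in> U \<longrightarrow> (\<exists>N. \<forall>n>N. Level n (K n) \<in> U))"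
proof -
  have o: "openin (hls_topology \<Gamma> K) (gunits HLS)"
    unfolding units_bisection by (rule open_bisection) simp
  have "openin (unit_top HLS) U \<longleftrightarrow> openin (hls_topology \<Gamma> K) U \<and> U \<subseteq> gunits HLS"
    unfolding unit_top_def gtop_HLS by (rule openin_open_subtopology[OF o])
  also have "\<dots> \<longleftrightarrow> U \<subseteq> gunits HLS \<and> (Limit \<one> \<in> U \<longrightarrow> (\<exists>N. \<forall>n>N. Level n (K n) \<in> U))"
  proof -
    have "(\<forall>g\<in>carrier \<Gamma>. Limit g \<in> U \<longrightarrow> P g) \<longleftrightarrow> (Limit \<one> \<in> U \<longrightarrow> P \<one>)"
      if "U \<subseteq> gunits HLS" for P
      using that unit_Limit by (metis one_closed subsetD)
    note eq = this[of "\<lambda>g. \<exists>N. \<forall>n>N. Level n (K n #> g) \<in> U"]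
    show ?thesis
    proof (cases "U \<subseteq> gunits HLS")
      case True
      have "U \<subseteq> topspace (hls_topology \<Gamma> K)" using True openin_subset[OF o] by (rule subset_trans)
      then show ?thesis unfolding openin_HLS eq[OF True] K_coset_one using True by simp
    qed simp
  qed
  finally show ?thesis .
qed

lemma units_arrows: "gunits HLS \<subseteq> topspace (hls_topology \<Gamma> K)"
  unfolding units_bisection by (rule openin_subset[OF open_bisection]) simp

lemma topspace_units: "topspace (unit_top HLS) = gunits HLS"
  using units_arrows by (auto simp: unit_top_def)

lemma compact_units: "compact_space (unit_top HLS)"
proof -
  have "compactin (unit_top HLS) (gunits HLS)"
    unfolding unit_top_def compactin_subtopology using compact_bisection[of \<one>]
    by (simp add: units_bisection)
  then show ?thesis by (simp add: compact_space_def topspace_units)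
qed

lemma continuous_map_units:
  "continuous_map (unit_top HLS) euclidean f \<longleftrightarrow> (\<lambda>n. f (Level n (K n))) \<longlonglongrightarrow> f (Limit \<one>)"
proof -
  have "continuous_map (unit_top HLS) euclidean f \<longleftrightarrow>
     (\<forall>U. open U \<longrightarrow> f (Limit \<one>) \<in> U \<longrightarrow> (\<exists>N. \<forall>n>N. f (Level n (K n)) \<in> U))"
    unfolding continuous_map_def openin_units topspace_units
    by (simp add: unit_Level unit_Limit)
  also have "\<dots> \<longleftrightarrow> (\<lambda>n. f (Level n (K n))) \<longlonglongrightarrow> f (Limit \<one>)"
    unfolding tendsto_def eventually_sequentially by (meson le_eq_less_or_eq Suc_le_eq)
  finally show ?thesis .
qed

text \<open>The unit space is compact, so the decay condition is automatic and only continuity at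
  the limit unit remains.\<close>

lemma C0_function_units:
  "C0_function (unit_top HLS) f \<longleftrightarrow> (\<lambda>n. f (Level n (K n))) \<longlonglongrightarrow> f (Limit \<one>)"
proof -
  have "compactin (unit_top HLS) {x \<in> topspace (unit_top HLS). \<epsilon> \<le> norm (f x)}"
    if f: "continuous_map (unit_top HLS) euclidean f" for \<epsilon>
  proof (rule closedin_compact_space[OF compact_units])
    have "continuous_map (unit_top HLS) euclidean (norm \<circ> f)"
      by (rule continuous_map_compose[OF f]) (auto intro!: continuous_intros)
    then have "closedin (unit_top HLS) {x \<in> topspace (unit_top HLS). (norm \<circ> f) x \<in> {\<epsilon>..}}"
      by (rule closedin_continuous_map_preimage) simp
    then show "closedin (unit_top HLS) {x \<in> topspace (unit_top HLS). \<epsilon> \<le> norm (f x)}" by simp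
  qed
  then show ?thesis unfolding C0_function_def by (auto simp: continuous_map_units)
qed

end

section \<open>Property (T) of the limit group\<close>

context approximated_group
begin

text \<open>The support of the restriction of \<open>f\<close> to the limit group. For
  \<open>f\<close> in \<open>Cc HLS\<close> it is finite, so restriction lands in the group
  algebra.\<close>

definition lsupp :: "('a hls \<Rightarrow> complex) \<Rightarrow> 'a set" where
  "lsupp f = {g \<in> carrier \<Gamma>. f (Limit g) \<noteq> 0}"

lemma lsupp_supp:
  assumes "g \<in> lsupp f"
  shows "Limit g \<in> supp HLS f"
proof -
  have "{x \<in> arrows HLS. f x \<noteq> 0} \<subseteq> supp HLS f"
    unfolding supp_def by (rule closure_of_subset) (auto simp: arrows_def)
  moreover have "Limit g \<in> {x \<in> arrows HLS. f x \<noteq> 0}"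
    using assms by (simp add: lsupp_def arrows_def Limit_arrow)
  ultimately show ?thesis by blast
qed

lemma finite_lsupp:
  assumes "f \<in> Cc HLS"
  shows "finite (lsupp f)"
proof -
  have "compactin (hls_topology \<Gamma> K) (supp HLS f)" using assms by (simp add: Cc_def)
  from compact_finite_Limit[OF this] show ?thesis
    by (rule rev_finite_subset) (use lsupp_supp in blast)
qed

lemma rng_fiber_Limit: "rng_fiber HLS (Limit \<one>) = Limit ` carrier \<Gamma>"
proof -
  have "x \<in> rng_fiber HLS (Limit \<one>) \<longleftrightarrow> x \<in> Limit ` carrier \<Gamma>" for x
    by (cases x) (auto simp: rng_fiber_def arrows_def Limit_arrow)
  then show ?thesis by blast
qed

lemma infsum_rng_fiber_Limit:
  fixes \<phi> :: "'a hls \<Rightarrow> 'b::{topological_comm_monoid_add, t2_space}"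
  assumes A: "finite A" "A \<subseteq> carrier \<Gamma>" "\<And>g. g \<in> carrier \<Gamma> \<Longrightarrow> g \<notin> A \<Longrightarrow> \<phi> (Limit g) = 0"
  shows "(\<Sum>\<^sub>\<infinity>x\<in>rng_fiber HLS (Limit \<one>). \<phi> x) = (\<Sum>g\<in>A. \<phi> (Limit g))"
proof -
  have "(\<Sum>\<^sub>\<infinity>x\<in>rng_fiber HLS (Limit \<one>). \<phi> x) = (\<Sum>\<^sub>\<infinity>x\<in>Limit ` A. \<phi> x)"
    unfolding rng_fiber_Limit using A by (intro infsum_cong_neutral) auto
  also have "\<dots> = (\<Sum>x\<in>Limit ` A. \<phi> x)" using A(1) by (intro infsum_finite) simp
  also have "\<dots> = (\<Sum>g\<in>A. \<phi> (Limit g))" by (simp add: sum.reindex inj_on_def)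
  finally show ?thesis .
qed

text \<open>A lift of the group element \<open>g\<close> to \<open>Cc HLS\<close>: the bisection is
  compact and clopen, so its indicator is continuous with compact support.\<close>

definition indic :: "'a \<Rightarrow> 'a hls \<Rightarrow> complex" where
  "indic g x = (if x \<in> bisection g then 1 else 0)"

lemma indic_Cc:
  assumes g: "g \<in> carrier \<Gamma>"
  shows "indic g \<in> Cc HLS"
proof -
  have sub: "bisection g \<subseteq> topspace (hls_topology \<Gamma> K)" using open_bisection[OF g] by (rule openin_subset)
  have "(\<lambda>n. indic g (Level n (K n #> h))) \<longlonglongrightarrow> indic g (Limit h)" if h: "h \<in> carrier \<Gamma>" for h
  proof (rule tendsto_eventually, cases "h = g")
    case True
    then show "\<forall>\<^sub>F n in sequentially. indic g (Level n (K n #> h)) = indic g (Limit h)"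
      by (simp add: indic_def bisection_Level bisection_Limit)
  next
    case False
    then obtain M where M: "\<forall>n\<ge>M. K n #> h \<noteq> K n #> g" using coset_separate[OF h g] by blast
    show "\<forall>\<^sub>F n in sequentially. indic g (Level n (K n #> h)) = indic g (Limit h)"
      by (rule eventually_sequentiallyI[of M])
        (use M False in \<open>simp add: indic_def bisection_Level bisection_Limit\<close>)
  qed
  then have c: "continuous_map (hls_topology \<Gamma> K) euclidean (indic g)"
    unfolding continuous_map_HLS by blast
  have "{x \<in> topspace (hls_topology \<Gamma> K). indic g x \<noteq> 0} = bisection g"
    using sub by (auto simp: indic_def)
  then have "supp HLS (indic g) = bisection g"
    unfolding supp_def arrows_def gtop_HLS using closed_bisection[OF g] by (simp add: closure_of_eq)
  moreover have "indic g x = 0" if "x \<notin> topspace (hls_topology \<Gamma> K)" for x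
    using that sub by (auto simp: indic_def)
  ultimately show ?thesis
    using c compact_bisection[OF g] by (simp add: Cc_def arrows_def)
qed

lemma lsupp_indic: "g \<in> carrier \<Gamma> \<Longrightarrow> lsupp (indic g) = {g}"
  and indic_Limit: "indic g (Limit h) = (if h = g then 1 else 0)"
  by (auto simp: lsupp_def indic_def bisection_Limit)

lemma Psi_Limit:
  assumes f: "finite (lsupp f)"
  shows "Psi HLS f (Limit g) = (if g = \<one> then \<Sum>h\<in>lsupp f. f (Limit h) else 0)"
  unfolding Psi_def unit_Limit using infsum_rng_fiber_Limit[OF f, of f]
  by (auto simp: lsupp_def)

lemma lsupp_Psi: "lsupp (Psi HLS f) \<subseteq> {\<one>}"
  by (auto simp: lsupp_def Psi_def unit_Limit)

text \<open>The limit fiber is one of those in the supremum. The work lies in bounding the supremum,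
  since \<open>SUP\<close> of an unbounded set of reals says nothing: \<open>f\<close> is bounded on
  its compact support, and the fibers meet the support in boundedly many points.\<close>

lemma sum_le_I_norm:
  assumes f: "f \<in> Cc HLS"
  shows "(\<Sum>g\<in>lsupp f. cmod (f (Limit g))) \<le> I_norm HLS f"
proof -
  have S: "compactin (hls_topology \<Gamma> K) (supp HLS f)" using f by (simp add: Cc_def)
  have cf: "continuous_map (hls_topology \<Gamma> K) euclidean f" using f by (simp add: Cc_def)
  have "compact (f ` supp HLS f)"
    using image_compactin[OF S cf] by simp
  then have "bounded (f ` supp HLS f)" by (rule compact_imp_bounded)
  then obtain B where B: "\<And>x. x \<in> supp HLS f \<Longrightarrow> cmod (f x) \<le> B"
    unfolding bounded_iff by blast
  \<comment> \<open>If the support is empty, \<open>B\<close> may be negative.\<close>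
  have B0: "cmod (f x) \<le> max B 0" if "x \<in> supp HLS f" for x using B[OF that] by simp
  have out: "f x = 0" if "x \<notin> supp HLS f" for x
  proof (cases "x \<in> arrows HLS")
    case True
    have "{x \<in> arrows HLS. f x \<noteq> 0} \<subseteq> supp HLS f"
      unfolding supp_def by (rule closure_of_subset) (auto simp: arrows_def)
    then show ?thesis using True that by blast
  next
    case False
    then show ?thesis using f by (simp add: Cc_def)
  qed
  obtain M where M: "\<And>u. finite (rng_fiber HLS u \<inter> supp HLS f)"
    "\<And>u. card (rng_fiber HLS u \<inter> supp HLS f) \<le> M"
    using compact_fiber_card[OF S] by blast
  have le: "(\<Sum>\<^sub>\<infinity>x\<in>rng_fiber HLS u. cmod (f x)) \<le> real M * max B 0" for u
  proof -
    have "(\<Sum>\<^sub>\<infinity>x\<in>rng_fiber HLS u. cmod (f x)) = (\<Sum>\<^sub>\<infinity>x\<in>rng_fiber HLS u \<inter> supp HLS f. cmod (f x))"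
      using out by (intro infsum_cong_neutral) auto
    also have "\<dots> = (\<Sum>x\<in>rng_fiber HLS u \<inter> supp HLS f. cmod (f x))" using M(1) by (rule infsum_finite)
    also have "\<dots> \<le> (\<Sum>x\<in>rng_fiber HLS u \<inter> supp HLS f. max B 0)" using B0 by (intro sum_mono) auto
    also have "\<dots> = real (card (rng_fiber HLS u \<inter> supp HLS f)) * max B 0" by simp
    also have "\<dots> \<le> real M * max B 0" using M(2) by (intro mult_right_mono) auto
    finally show ?thesis .
  qed
  have "(\<Sum>g\<in>lsupp f. cmod (f (Limit g))) = (\<Sum>\<^sub>\<infinity>x\<in>rng_fiber HLS (Limit \<one>). cmod (f x))"
    by (rule infsum_rng_fiber_Limit[symmetric, OF finite_lsupp[OF f]]) (auto simp: lsupp_def)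
  also have "\<dots> \<le> (SUP u\<in>gunits HLS. \<Sum>\<^sub>\<infinity>x\<in>rng_fiber HLS u. cmod (f x))"
  proof (rule cSUP_upper)
    show "Limit \<one> \<in> gunits HLS" by (simp add: unit_Limit)
    show "bdd_above ((\<lambda>u. \<Sum>\<^sub>\<infinity>x\<in>rng_fiber HLS u. cmod (f x)) ` gunits HLS)"
      by (rule bdd_aboveI2[OF le])
  qed
  also have "\<dots> \<le> I_norm HLS f" unfolding I_norm_def by simp
  finally show ?thesis .
qed

end

locale HLS_representation = approximated_group \<Gamma> K + unitary_representation H \<Gamma> \<rho>
  for \<Gamma> :: "('a, 'm) monoid_scheme" (structure) and K and H :: "'v::complex_vector inner_space" and \<rho>
begin

text \<open>The integrated form of \<open>\<rho>\<close>, composed with restriction of functions to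
  the limit group.\<close>

definition \<Phi> :: "('a hls \<Rightarrow> complex) \<Rightarrow> 'v \<Rightarrow> 'v" where
  "\<Phi> f v = (\<Sum>g\<in>lsupp f. f (Limit g) *\<^sub>C \<rho> g v)"

lemma \<Phi>_eq:
  assumes "finite A" "lsupp f \<subseteq> A" "A \<subseteq> carrier \<Gamma>"
  shows "\<Phi> f v = (\<Sum>g\<in>A. f (Limit g) *\<^sub>C \<rho> g v)"
  unfolding \<Phi>_def using assms by (intro sum.mono_neutral_left) (auto simp: lsupp_def)

lemma lsupp_carrier: "lsupp f \<subseteq> carrier \<Gamma>"
  by (auto simp: lsupp_def)

lemma \<Phi>_in: "v \<in> vecs H \<Longrightarrow> \<Phi> f v \<in> vecs H"
  unfolding \<Phi>_def by (intro sum_in scale_in rep_in) (auto simp: lsupp_def)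

lemma rep_sum:
  assumes "g \<in> carrier \<Gamma>" "\<And>i. i \<in> I \<Longrightarrow> x i \<in> vecs H"
  shows "\<rho> g (sum x I) = (\<Sum>i\<in>I. \<rho> g (x i))"
proof -
  have "\<rho> g 0 = 0" using rep_add[OF assms(1), of 0 0] by simp
  then show ?thesis using assms(2)
    by (induction I rule: infinite_finite_induct) (auto simp: rep_add[OF assms(1)] sum_in)
qed

lemma rep_norm: "g \<in> carrier \<Gamma> \<Longrightarrow> v \<in> vecs H \<Longrightarrow> hnorm H (\<rho> g v) = hnorm H v"
  by (simp add: hnorm_def rep_ip)

lemma \<Phi>_bounded: "bounded_operator H (\<Phi> f)"
  unfolding bounded_operator_def linear_between_def
proof (intro conjI ballI allI exI)
  show "\<Phi> f ` vecs H \<subseteq> vecs H" using \<Phi>_in by blast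
  fix v w assume v: "v \<in> vecs H" and w: "w \<in> vecs H"
  show "\<Phi> f (v + w) = \<Phi> f v + \<Phi> f w"
    unfolding \<Phi>_def sum.distrib[symmetric] using v w
    by (intro sum.cong refl) (simp add: lsupp_def rep_add scaleC_add_right)
next
  fix c v assume v: "v \<in> vecs H"
  show "\<Phi> f (c *\<^sub>C v) = c *\<^sub>C \<Phi> f v"
    unfolding \<Phi>_def complex_vector.scale_sum_right using v
    by (intro sum.cong refl) (simp add: lsupp_def rep_scale scaleC_scaleC mult.commute)
next
  fix v assume v: "v \<in> vecs H"
  have "hnorm H (\<Phi> f v) \<le> (\<Sum>g\<in>lsupp f. hnorm H (f (Limit g) *\<^sub>C \<rho> g v))"
    unfolding \<Phi>_def using v by (intro norm_sum_le scale_in rep_in) (auto simp: lsupp_def)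
  also have "\<dots> = (\<Sum>g\<in>lsupp f. cmod (f (Limit g))) * hnorm H v"
    unfolding sum_distrib_right using v
    by (intro sum.cong refl) (simp add: lsupp_def norm_scale rep_in rep_norm)
  finally show "hnorm H (\<Phi> f v) \<le> (\<Sum>g\<in>lsupp f. cmod (f (Limit g))) * hnorm H v" .
qed

lemma convolution_Limit:
  assumes f: "f \<in> Cc HLS" and x: "x \<in> carrier \<Gamma>"
  shows "convolution HLS f h (Limit x) = (\<Sum>g\<in>lsupp f. f (Limit g) * h (Limit (inv g \<otimes> x)))"
proof -
  have "convolution HLS f h (Limit x) =
      (\<Sum>\<^sub>\<infinity>y\<in>rng_fiber HLS (Limit \<one>). f y * h (hls_mul \<Gamma> K (hls_inv \<Gamma> K y) (Limit x)))"
    using x by (simp add: convolution_def arrows_def Limit_arrow)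
  also have "\<dots> = (\<Sum>g\<in>lsupp f. f (Limit g) * h (hls_mul \<Gamma> K (hls_inv \<Gamma> K (Limit g)) (Limit x)))"
    by (rule infsum_rng_fiber_Limit[OF finite_lsupp[OF f]]) (auto simp: lsupp_def)
  finally show ?thesis by simp
qed

text \<open>Restriction to the limit is multiplicative because the range fiber of the limit unit
  consists of limit arrows only; what remains is the usual rearrangement in a group algebra.\<close>

lemma \<Phi>_convolution:
  assumes f: "f \<in> Cc HLS" and h: "h \<in> Cc HLS" and v: "v \<in> vecs H"
  shows "\<Phi> (convolution HLS f h) v = \<Phi> f (\<Phi> h v)"
proof -
  note fin = finite_lsupp[OF f] finite_lsupp[OF h]
  have fc: "g \<in> carrier \<Gamma>" if "g \<in> lsupp f" for g using that by (simp add: lsupp_def)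
  have hc: "g \<in> carrier \<Gamma>" if "g \<in> lsupp h" for g using that by (simp add: lsupp_def)
  \<comment> \<open>One finite index set that contains the support of the convolution and is the
    same for all \<open>g\<close>, so that the two sums may be exchanged; for fixed \<open>g\<close>
    the substitution is \<open>x = g \<otimes> k\<close>.\<close>
  define A where "A = (\<lambda>(g, k). g \<otimes> k) ` (lsupp f \<times> lsupp h)"
  have A: "finite A" "A \<subseteq> carrier \<Gamma>" using fin fc hc by (auto simp: A_def)
  have "lsupp (convolution HLS f h) \<subseteq> A"
  proof
    fix x assume "x \<in> lsupp (convolution HLS f h)"
    then have x: "x \<in> carrier \<Gamma>" "convolution HLS f h (Limit x) \<noteq> 0" by (auto simp: lsupp_def)
    obtain g where g: "g \<in> lsupp f" "h (Limit (inv g \<otimes> x)) \<noteq> 0"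
    proof (rule ccontr)
      assume "\<not> thesis"
      then have "\<forall>g\<in>lsupp f. h (Limit (inv g \<otimes> x)) = 0" using that by blast
      then show False using x convolution_Limit[OF f x(1), of h] by simp
    qed
    then have "inv g \<otimes> x \<in> lsupp h" using fc[OF g(1)] x(1) by (simp add: lsupp_def)
    moreover have "x = g \<otimes> (inv g \<otimes> x)" using fc[OF g(1)] x(1) by (simp flip: m_assoc)
    ultimately show "x \<in> A" unfolding A_def using g(1) by (intro image_eqI[of _ _ "(g, inv g \<otimes> x)"]) auto
  qed
  then have "\<Phi> (convolution HLS f h) v = (\<Sum>x\<in>A. convolution HLS f h (Limit x) *\<^sub>C \<rho> x v)"
    by (rule \<Phi>_eq[OF A(1) _ A(2)])
  also have "\<dots> = (\<Sum>x\<in>A. \<Sum>g\<in>lsupp f. (f (Limit g) * h (Limit (inv g \<otimes> x))) *\<^sub>C \<rho> x v)"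
    using A(2) by (intro sum.cong refl) (simp add: convolution_Limit[OF f] complex_vector.scale_sum_left subset_iff)
  also have "\<dots> = (\<Sum>g\<in>lsupp f. \<Sum>x\<in>A. (f (Limit g) * h (Limit (inv g \<otimes> x))) *\<^sub>C \<rho> x v)"
    by (rule sum.swap)
  also have "\<dots> = (\<Sum>g\<in>lsupp f. \<Sum>k\<in>lsupp h. (f (Limit g) * h (Limit k)) *\<^sub>C \<rho> (g \<otimes> k) v)"
  proof (rule sum.cong[OF refl])
    fix g assume g: "g \<in> lsupp f"
    note gc = fc[OF g]
    have "(\<Sum>x\<in>A. (f (Limit g) * h (Limit (inv g \<otimes> x))) *\<^sub>C \<rho> x v) =
        (\<Sum>x\<in>(\<lambda>k. g \<otimes> k) ` lsupp h. (f (Limit g) * h (Limit (inv g \<otimes> x))) *\<^sub>C \<rho> x v)"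
    proof (rule sum.mono_neutral_right[OF A(1)])
      show "(\<lambda>k. g \<otimes> k) ` lsupp h \<subseteq> A" using g by (auto simp: A_def)
      show "\<forall>x\<in>A - (\<lambda>k. g \<otimes> k) ` lsupp h. (f (Limit g) * h (Limit (inv g \<otimes> x))) *\<^sub>C \<rho> x v = 0"
      proof
        fix x assume x: "x \<in> A - (\<lambda>k. g \<otimes> k) ` lsupp h"
        then have xc: "x \<in> carrier \<Gamma>" using A(2) by blast
        have "x = g \<otimes> (inv g \<otimes> x)" using gc xc by (simp flip: m_assoc)
        then have "inv g \<otimes> x \<notin> lsupp h" using x by blast
        then have "h (Limit (inv g \<otimes> x)) = 0" using gc xc by (simp add: lsupp_def)
        then show "(f (Limit g) * h (Limit (inv g \<otimes> x))) *\<^sub>C \<rho> x v = 0" by simp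
      qed
    qed
    also have "\<dots> = (\<Sum>k\<in>lsupp h. (f (Limit g) * h (Limit (inv g \<otimes> (g \<otimes> k)))) *\<^sub>C \<rho> (g \<otimes> k) v)"
      using gc hc by (subst sum.reindex) (auto simp: inj_on_def)
    also have "\<dots> = (\<Sum>k\<in>lsupp h. (f (Limit g) * h (Limit k)) *\<^sub>C \<rho> (g \<otimes> k) v)"
      using gc hc by (intro sum.cong refl) (simp flip: m_assoc)
    finally show "(\<Sum>x\<in>A. (f (Limit g) * h (Limit (inv g \<otimes> x))) *\<^sub>C \<rho> x v) =
      (\<Sum>k\<in>lsupp h. (f (Limit g) * h (Limit k)) *\<^sub>C \<rho> (g \<otimes> k) v)" .
  qed
  also have "\<dots> = \<Phi> f (\<Phi> h v)"
    unfolding \<Phi>_def[of f]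
  proof (rule sum.cong[OF refl])
    fix g assume "g \<in> lsupp f"
    note gc = fc[OF this]
    have "\<rho> g (\<Phi> h v) = (\<Sum>k\<in>lsupp h. \<rho> g (h (Limit k) *\<^sub>C \<rho> k v))"
      unfolding \<Phi>_def using hc v by (intro rep_sum gc scale_in rep_in) auto
    also have "\<dots> = (\<Sum>k\<in>lsupp h. h (Limit k) *\<^sub>C \<rho> (g \<otimes> k) v)"
      using hc v gc by (intro sum.cong refl) (simp add: rep_scale rep_in rep_mult)
    finally show "(\<Sum>k\<in>lsupp h. (f (Limit g) * h (Limit k)) *\<^sub>C \<rho> (g \<otimes> k) v) = f (Limit g) *\<^sub>C \<rho> g (\<Phi> h v)"
      by (simp add: complex_vector.scale_sum_right scaleC_scaleC)
  qed
  finally show ?thesis .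
qed

text \<open>Inversion maps the support of \<open>f\<close> onto that of its involution, matching the
  fact that the adjoint of \<open>\<rho> g\<close> is \<open>\<rho> (inv g)\<close>.\<close>

lemma \<Phi>_involution:
  assumes v: "v \<in> vecs H" and w: "w \<in> vecs H"
  shows "ip H (\<Phi> f v) w = ip H v (\<Phi> (involution HLS f) w)"
proof -
  have fc: "g \<in> carrier \<Gamma>" if "g \<in> lsupp f" for g using that by (simp add: lsupp_def)
  have val: "involution HLS f (Limit g) = cnj (f (Limit (inv g)))" if "g \<in> carrier \<Gamma>" for g
    using that by (simp add: involution_def arrows_def Limit_arrow)
  have S: "lsupp (involution HLS f) = (\<lambda>g. inv g) ` lsupp f"
  proof (intro equalityI subsetI)
    fix x assume "x \<in> lsupp (involution HLS f)"
    then have "x \<in> carrier \<Gamma>" "inv x \<in> lsupp f" by (auto simp: lsupp_def val)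
    then show "x \<in> (\<lambda>g. inv g) ` lsupp f" by (intro image_eqI[of _ _ "inv x"]) simp_all
  next
    fix x assume "x \<in> (\<lambda>g. inv g) ` lsupp f"
    then show "x \<in> lsupp (involution HLS f)" by (auto simp: lsupp_def val)
  qed
  have "ip H (\<Phi> f v) w = (\<Sum>g\<in>lsupp f. ip H (f (Limit g) *\<^sub>C \<rho> g v) w)"
    unfolding \<Phi>_def using v w fc by (intro ip_sum_left scale_in rep_in) auto
  also have "\<dots> = (\<Sum>g\<in>lsupp f. ip H v (cnj (f (Limit g)) *\<^sub>C \<rho> (inv g) w))"
    using v w fc by (intro sum.cong refl) (simp add: ip_scale_left ip_scale_right rep_in adj_ip[OF rep_adj])
  also have "\<dots> = ip H v (\<Sum>g\<in>lsupp f. cnj (f (Limit g)) *\<^sub>C \<rho> (inv g) w)"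
    using v w fc by (intro ip_sum_right[symmetric] scale_in rep_in) auto
  also have "(\<Sum>g\<in>lsupp f. cnj (f (Limit g)) *\<^sub>C \<rho> (inv g) w) = \<Phi> (involution HLS f) w"
    unfolding \<Phi>_def S using fc by (subst sum.reindex) (auto simp: inj_on_def val intro: inv_inj[THEN inj_onD])
  finally show ?thesis .
qed

lemma \<Phi>_indic: "g \<in> carrier \<Gamma> \<Longrightarrow> \<Phi> (indic g) v = \<rho> g v"
  by (simp add: \<Phi>_def lsupp_indic indic_Limit scaleC_one)

lemma \<Phi>_Psi:
  assumes f: "f \<in> Cc HLS" and v: "v \<in> vecs H"
  shows "\<Phi> (Psi HLS f) v = (\<Sum>g\<in>lsupp f. f (Limit g)) *\<^sub>C v"
  using \<Phi>_eq[OF _ lsupp_Psi[of f], of v] v by (simp add: Psi_Limit[OF finite_lsupp[OF f]] rep_one)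

lemma \<Phi>_star: "star_representation HLS H \<Phi>"
  unfolding star_representation_def
proof (intro conjI ballI allI)
  fix f h v assume f: "f \<in> Cc HLS" and h: "h \<in> Cc HLS"
  have A: "finite (lsupp f \<union> lsupp h)" "lsupp f \<union> lsupp h \<subseteq> carrier \<Gamma>"
    "lsupp (f + h) \<subseteq> lsupp f \<union> lsupp h"
    using finite_lsupp[OF f] finite_lsupp[OF h] by (auto simp: lsupp_def)
  show "\<Phi> (f + h) v = \<Phi> f v + \<Phi> h v"
    using \<Phi>_eq[OF A(1,3,2)] \<Phi>_eq[OF A(1) Un_upper1 A(2)] \<Phi>_eq[OF A(1) Un_upper2 A(2)]
    by (simp add: scaleC_add_left sum.distrib)
next
  fix c f v assume f: "f \<in> Cc HLS"
  have "lsupp (c *\<^sub>C f) \<subseteq> lsupp f" by (auto simp: lsupp_def scaleC_fun_def scaleC_complex_def)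
  from \<Phi>_eq[OF finite_lsupp[OF f] this lsupp_carrier]
  show "\<Phi> (c *\<^sub>C f) v = c *\<^sub>C \<Phi> f v"
    by (simp add: \<Phi>_def[of f] scaleC_fun_def scaleC_complex_def complex_vector.scale_sum_right scaleC_scaleC)
next
  let ?S = "{\<Phi> f v |f v. f \<in> Cc HLS \<and> v \<in> vecs H}"
  \<comment> \<open>Nondegeneracy: the indicator of the unit space acts as the identity.\<close>
  have "vecs H \<subseteq> ?S"
  proof
    fix v assume v: "v \<in> vecs H"
    have "v = \<Phi> (indic \<one>) v" using v by (simp add: \<Phi>_indic rep_one)
    then show "v \<in> ?S" using v indic_Cc[OF one_closed] by blast
  qed
  then have 1: "vecs H \<subseteq> complex_vector.span ?S" using complex_vector.span_superset by (rule subset_trans)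
  have "?S \<subseteq> vecs H" using \<Phi>_in by blast
  then have 2: "complex_vector.span ?S \<subseteq> vecs H" by (rule span_in)
  show "dense_in H (complex_vector.span ?S)"
    unfolding dense_in_def
  proof (intro conjI ballI allI impI 2)
    fix v and \<epsilon> :: real assume "v \<in> vecs H" "\<epsilon> > 0"
    then show "\<exists>w\<in>complex_vector.span ?S. hnorm H (v - w) < \<epsilon>"
      using 1 by (intro bexI[of _ v]) auto
  qed
qed (simp_all add: \<Phi>_bounded \<Phi>_convolution \<Phi>_involution)

text \<open>Tested on \<open>indic g\<close>, whose image under \<open>Psi\<close> acts as the
  scalar 1.\<close>

lemma \<Phi>_constant:
  assumes "v \<in> constant_vectors HLS H \<Phi>" "g \<in> carrier \<Gamma>"
  shows "\<rho> g v = v"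
proof -
  have v: "v \<in> vecs H" and c: "\<And>f. f \<in> Cc HLS \<Longrightarrow> \<Phi> f v = \<Phi> (Psi HLS f) v"
    using assms(1) by (auto simp: constant_vectors_def)
  show ?thesis
    using c[OF indic_Cc[OF assms(2)]] assms(2)
    by (simp add: \<Phi>_indic \<Phi>_Psi[OF indic_Cc v] lsupp_indic indic_Limit scaleC_one)
qed

text \<open>The difference is the combination of the displacements \<open>\<rho> g v - v\<close>
  with weights \<open>f (Limit g)\<close>, whose absolute values sum to at most 1.\<close>

lemma \<Phi>_diff_bound:
  assumes f: "f \<in> Cc HLS" "I_norm HLS f \<le> 1" and v: "v \<in> vecs H"
    and m: "\<And>g. g \<in> lsupp f \<Longrightarrow> hnorm H (\<rho> g v - v) \<le> m" "0 \<le> m"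
  shows "hnorm H (\<Phi> f v - \<Phi> (Psi HLS f) v) \<le> m"
proof -
  have fc: "g \<in> carrier \<Gamma>" if "g \<in> lsupp f" for g using that by (simp add: lsupp_def)
  have "\<Phi> f v - \<Phi> (Psi HLS f) v = (\<Sum>g\<in>lsupp f. f (Limit g) *\<^sub>C (\<rho> g v - v))"
    unfolding \<Phi>_Psi[OF f(1) v] \<Phi>_def[of f]
    by (simp add: complex_vector.scale_sum_left complex_vector.scale_right_diff_distrib sum_subtractf)
  then have "hnorm H (\<Phi> f v - \<Phi> (Psi HLS f) v) \<le> (\<Sum>g\<in>lsupp f. hnorm H (f (Limit g) *\<^sub>C (\<rho> g v - v)))"
    using norm_sum_le[of "lsupp f" "\<lambda>g. f (Limit g) *\<^sub>C (\<rho> g v - v)"] fc v by (simp add: rep_in)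
  also have "\<dots> \<le> (\<Sum>g\<in>lsupp f. cmod (f (Limit g)) * m)"
    using fc v m(1) by (intro sum_mono) (simp add: norm_scale rep_in mult_left_mono)
  also have "\<dots> = (\<Sum>g\<in>lsupp f. cmod (f (Limit g))) * m" by (simp add: sum_distrib_right)
  also have "\<dots> \<le> 1 * m"
    using sum_le_I_norm[OF f(1)] f(2) m(2) by (intro mult_right_mono) auto
  finally show ?thesis by simp
qed

end

context approximated_group
begin

text \<open>\<open>F\<close> consists of the limit arrows in the compact set \<open>C\<close>. If
  all displacements over \<open>F\<close> were below \<open>c * hnorm H v\<close>, so would be the
  norm of the weighted combination of them that an admissible \<open>f\<close> produces.\<close>

lemma kazhdan_pair_of_topological:
  assumes T: "topological_property_T HLS"
  shows "\<exists>F c. kazhdan_pair \<Gamma> F c"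
proof -
  obtain C c where C: "compactin (hls_topology \<Gamma> K) C" and c: "0 < c"
    and *: "\<forall>(H :: (nat \<Rightarrow> complex) inner_space) \<Phi>.
           hilbert_space H \<and> star_representation HLS H \<Phi> \<longrightarrow>
           (\<forall>v\<in>vecs H. (\<forall>w\<in>constant_vectors HLS H \<Phi>. ip H v w = 0) \<longrightarrow>
              (\<exists>f\<in>Cc HLS. supp HLS f \<subseteq> C \<and> I_norm HLS f \<le> 1 \<and>
                 c * hnorm H v \<le> hnorm H (\<Phi> f v - \<Phi> (Psi HLS f) v)))"
    using T unfolding topological_property_T_def gtop_HLS by (elim exE conjE)
  define F where "F = {g \<in> carrier \<Gamma>. Limit g \<in> C}"
  have F: "finite F" unfolding F_def using compact_finite_Limit[OF C] by simp
  have "\<exists>g\<in>F. c * hnorm H v \<le> hnorm H (\<rho> g v - v)"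
    if H: "hilbert_space H" and R: "unitary_rep \<Gamma> H \<rho>"
      and inv: "\<forall>v\<in>vecs H. (\<forall>g\<in>carrier \<Gamma>. \<rho> g v = v) \<longrightarrow> v = 0" and v: "v \<in> vecs H" "v \<noteq> 0"
    for H :: "(nat \<Rightarrow> complex) inner_space" and \<rho> v
  proof (rule ccontr)
    assume no: "\<not> ?thesis"
    interpret HLS_representation \<Gamma> K H \<rho> by unfold_locales fact+
    have "w = 0" if "w \<in> constant_vectors HLS H \<Phi>" for w
      using that \<Phi>_constant[OF that] inv by (simp add: constant_vectors_def)
    then have "\<forall>w\<in>constant_vectors HLS H \<Phi>. ip H v w = 0" using v by fastforce
    then obtain f where f: "f \<in> Cc HLS" "supp HLS f \<subseteq> C" "I_norm HLS f \<le> 1"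
      "c * hnorm H v \<le> hnorm H (\<Phi> f v - \<Phi> (Psi HLS f) v)"
      using *[rule_format, OF conjI[OF H \<Phi>_star] v(1)] by blast
    \<comment> \<open>The inserted 0 covers the case of empty \<open>F\<close>.\<close>
    define m where "m = Max (insert 0 ((\<lambda>g. hnorm H (\<rho> g v - v)) ` F))"
    have m: "hnorm H (\<rho> g v - v) \<le> m" if "g \<in> F" for g
      unfolding m_def using F that by (intro Max_ge) auto
    have m0: "0 \<le> m" unfolding m_def using F by (intro Max_ge) auto
    have "m \<in> insert 0 ((\<lambda>g. hnorm H (\<rho> g v - v)) ` F)"
      unfolding m_def using F by (intro Max_in) auto
    then have "m < c * hnorm H v" using no c norm_pos[OF v] by (auto simp: not_le)
    moreover have "g \<in> F" if "g \<in> lsupp f" for g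
      using that lsupp_supp[OF that] f(2) by (auto simp: F_def lsupp_def)
    then have "hnorm H (\<Phi> f v - \<Phi> (Psi HLS f) v) \<le> m"
      using \<Phi>_diff_bound[OF f(1,3) v(1) m m0] by blast
    ultimately show False using f(4) by simp
  qed
  then have "kazhdan_pair \<Gamma> F c"
    unfolding kazhdan_pair_def using F c by (auto simp: F_def)
  then show ?thesis by blast
qed

end

section \<open>Traces and finite-rank operators\<close>

context hilb
begin

lemma adj_cong:
  "adj T S \<Longrightarrow> (\<And>v. v \<in> vecs H \<Longrightarrow> T' v = T v) \<Longrightarrow> (\<And>v. v \<in> vecs H \<Longrightarrow> S' v = S v) \<Longrightarrow> adj T' S'"
  unfolding adj_def by simp

text \<open>With \<open>E\<close> the very basis used by \<open>op_trace\<close>, both sums run over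
  the same set, and the diagonal entry of \<open>abs_square H A\<close> at \<open>e\<close> is the
  squared norm of \<open>A e\<close>.\<close>

lemma trace_abs_square:
  assumes sep: "separable_hilbert H" and a: "adj A A'"
  defines "E \<equiv> chosen_basis H"
  shows "has_finite_trace H (abs_square H A) \<longleftrightarrow> hs_sm E A"
    "op_trace H (abs_square H A) = of_real (hs2 E A)"
    "hs_norm H A = sqrt (hs2 E A)"
proof -
  have E: "orthonormal_basis H E" unfolding E_def by (rule chosen_basis[OF sep])
  have e: "ip H (abs_square H A e) e = of_real ((hnorm H (A e))\<^sup>2)" if "e \<in> E" for e
  proof -
    note eH = basis_in[OF E that]
    have Ae: "A e \<in> vecs H" by (rule adj_in[OF a eH])
    have "ip H (abs_square H A e) e = ip H (A' (A e)) e"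
      unfolding abs_square_def comp_def op_adjoint_eq[OF a Ae] ..
    also have "\<dots> = ip H (A e) (A e)" by (rule adj_ip[OF adj_sym[OF a] Ae eH])
    finally show ?thesis using ip_self[OF Ae] by simp
  qed
  have "has_finite_trace H (abs_square H A) \<longleftrightarrow> (\<lambda>e. complex_of_real ((hnorm H (A e))\<^sup>2)) summable_on E"
    unfolding has_finite_trace_def E_def[symmetric] using e by (rule summable_on_cong)
  also have "\<dots> \<longleftrightarrow> hs_sm E A"
    unfolding hs_sm_def
  proof
    assume "(\<lambda>e. complex_of_real ((hnorm H (A e))\<^sup>2)) summable_on E"
    from summable_on_Re[OF this] show "(\<lambda>e. (hnorm H (A e))\<^sup>2) summable_on E"
      by (simp only: Re_complex_of_real)
  qed (rule summable_on_of_real)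
  finally show "has_finite_trace H (abs_square H A) \<longleftrightarrow> hs_sm E A" .
  have "op_trace H (abs_square H A) = (\<Sum>\<^sub>\<infinity>e\<in>E. complex_of_real ((hnorm H (A e))\<^sup>2))"
    unfolding op_trace_def E_def[symmetric] using e by (rule infsum_cong)
  then show t: "op_trace H (abs_square H A) = of_real (hs2 E A)"
    unfolding hs2_def infsum_complex_of_real .
  show "hs_norm H A = sqrt (hs2 E A)" unfolding hs_norm_def t by simp
qed

lemma hs_inner_hsip:
  assumes sep: "separable_hilbert H" and a: "adj A A'" and X: "\<And>v. v \<in> vecs H \<Longrightarrow> X v \<in> vecs H"
  shows "hs_inner H X A = hsip (chosen_basis H) X A"
  unfolding hs_inner_def op_trace_def hsip_def
proof (rule infsum_cong)
  fix e assume "e \<in> chosen_basis H"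
  then have e: "e \<in> vecs H" using basis_in[OF chosen_basis[OF sep]] by blast
  have "ip H ((op_adjoint H A \<circ> X) e) e = ip H (A' (X e)) e"
    unfolding comp_def op_adjoint_eq[OF a X[OF e]] ..
  also have "\<dots> = ip H (X e) (A e)" by (rule adj_ip[OF adj_sym[OF a] X[OF e] e])
  finally show "ip H ((op_adjoint H A \<circ> X) e) e = ip H (X e) (A e)" .
qed

text \<open>\<open>s\<close> times the sum of the rank-one operators along the vectors
  \<open>a i\<close>. The vectors are indexed because an orbit may repeat them; the scalar is real
  to keep the operator self-adjoint.\<close>

definition frank :: "real \<Rightarrow> 'i set \<Rightarrow> ('i \<Rightarrow> 'v) \<Rightarrow> 'v \<Rightarrow> 'v" where
  "frank s I a v = (\<Sum>i\<in>I. (of_real s * ip H v (a i)) *\<^sub>C a i)"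

text \<open>The Hilbert-Schmidt inner product of the unscaled rank-one sums along \<open>a\<close>
  and along \<open>b\<close>.\<close>

definition gram :: "'i set \<Rightarrow> ('i \<Rightarrow> 'v) \<Rightarrow> ('i \<Rightarrow> 'v) \<Rightarrow> real" where
  "gram I a b = (\<Sum>i\<in>I. \<Sum>j\<in>I. (cmod (ip H (a i) (b j)))\<^sup>2)"

lemma frank_in: "(\<And>i. i \<in> I \<Longrightarrow> a i \<in> vecs H) \<Longrightarrow> frank s I a v \<in> vecs H"
  unfolding frank_def by (intro sum_in scale_in)

lemma frank_adj:
  assumes a: "\<And>i. i \<in> I \<Longrightarrow> a i \<in> vecs H"
  shows "adj (frank s I a) (frank s I a)"
  unfolding adj_def
proof (intro conjI ballI frank_in a)
  fix v w assume v: "v \<in> vecs H" and w: "w \<in> vecs H"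
  have "ip H (frank s I a v) w = (\<Sum>i\<in>I. of_real s * ip H v (a i) * ip H (a i) w)"
    unfolding frank_def using a w by (subst ip_sum_left) (auto simp: ip_scale_left intro!: sum.cong)
  also have "\<dots> = (\<Sum>i\<in>I. ip H v ((of_real s * ip H w (a i)) *\<^sub>C a i))"
  proof (rule sum.cong[OF refl])
    fix i assume i: "i \<in> I"
    show "of_real s * ip H v (a i) * ip H (a i) w = ip H v ((of_real s * ip H w (a i)) *\<^sub>C a i)"
      unfolding ip_scale_right[OF a[OF i] v] ip_cnj[OF w a[OF i]] by simp
  qed
  also have "\<dots> = ip H v (frank s I a w)"
    unfolding frank_def using a v by (subst ip_sum_right) auto
  finally show "ip H (frank s I a v) w = ip H v (frank s I a w)" .
qed

text \<open>The trace of the product of the rank-one operators along \<open>a i\<close> and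
  \<open>b j\<close> is the squared modulus of the inner product of these vectors: after expansion,
  Parseval is applied to each pair \<open>b j\<close>, \<open>a i\<close>. One factor
  \<open>s\<close> comes from each operator.\<close>

lemma frank_has_sum:
  assumes E: "orthonormal_basis H E" and I: "finite I"
    and a: "\<And>i. i \<in> I \<Longrightarrow> a i \<in> vecs H" and b: "\<And>i. i \<in> I \<Longrightarrow> b i \<in> vecs H"
  shows "((\<lambda>e. ip H (frank s I a e) (frank s I b e)) has_sum of_real (s\<^sup>2 * gram I a b)) E"
proof -
  have sumI: "((\<lambda>e. \<Sum>i\<in>J. f i e) has_sum (\<Sum>i\<in>J. F i)) E"
    if "finite J" "\<And>i. i \<in> J \<Longrightarrow> (f i has_sum F i) E" for J and f :: "'b \<Rightarrow> 'v \<Rightarrow> complex" and F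
    using that by (induction J) (auto intro: has_sum_add)
  have 1: "((\<lambda>e. \<Sum>i\<in>I. \<Sum>j\<in>I. (of_real (s\<^sup>2) * ip H (a i) (b j)) * (ip H (b j) e * ip H e (a i))) has_sum
      (\<Sum>i\<in>I. \<Sum>j\<in>I. (of_real (s\<^sup>2) * ip H (a i) (b j)) * ip H (b j) (a i))) E"
    by (intro sumI I has_sum_cmult_right parseval[OF E] a b)
  have 2: "(\<Sum>i\<in>I. \<Sum>j\<in>I. (of_real (s\<^sup>2) * ip H (a i) (b j)) * ip H (b j) (a i)) = of_real (s\<^sup>2 * gram I a b)"
  proof -
    have "(of_real (s\<^sup>2) * ip H (a i) (b j)) * ip H (b j) (a i) = of_real (s\<^sup>2 * (cmod (ip H (a i) (b j)))\<^sup>2)"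
      if "i \<in> I" "j \<in> I" for i j
      using ip_mult_cnj[OF a b, OF that] by (simp only: mult.assoc of_real_mult)
    then show ?thesis unfolding gram_def sum_distrib_left of_real_sum by (intro sum.cong refl)
  qed
  have 3: "ip H (frank s I a e) (frank s I b e) =
      (\<Sum>i\<in>I. \<Sum>j\<in>I. (of_real (s\<^sup>2) * ip H (a i) (b j)) * (ip H (b j) e * ip H e (a i)))" if "e \<in> E" for e
  proof -
    have e: "e \<in> vecs H" by (rule basis_in[OF E that])
    have "ip H (frank s I a e) (frank s I b e) =
        (\<Sum>i\<in>I. ip H ((of_real s * ip H e (a i)) *\<^sub>C a i) (frank s I b e))"
      unfolding frank_def[of s I a] using a frank_in[of I b] b by (intro ip_sum_left) auto
    also have "\<dots> = (\<Sum>i\<in>I. \<Sum>j\<in>I. ip H ((of_real s * ip H e (a i)) *\<^sub>C a i) ((of_real s * ip H e (b j)) *\<^sub>C b j))"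
      unfolding frank_def using a b by (intro sum.cong refl ip_sum_right) auto
    also have "\<dots> = (\<Sum>i\<in>I. \<Sum>j\<in>I. (of_real (s\<^sup>2) * ip H (a i) (b j)) * (ip H (b j) e * ip H e (a i)))"
    proof (intro sum.cong refl)
      fix i j assume "i \<in> I" "j \<in> I"
      then have ab: "a i \<in> vecs H" "b j \<in> vecs H" using a b by auto
      show "ip H ((of_real s * ip H e (a i)) *\<^sub>C a i) ((of_real s * ip H e (b j)) *\<^sub>C b j) =
          (of_real (s\<^sup>2) * ip H (a i) (b j)) * (ip H (b j) e * ip H e (a i))"
        unfolding ip_scale_left[OF ab(1) scale_in[OF ab(2)]] ip_scale_right[OF ab(2,1)] ip_cnj[OF e ab(2)]
        by (simp add: power2_eq_square)
    qed
    finally show ?thesis .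
  qed
  show ?thesis by (rule has_sum_cong[THEN iffD2, OF 3 1[unfolded 2]])
qed

lemma frank_hs:
  assumes E: "orthonormal_basis H E" and I: "finite I" and a: "\<And>i. i \<in> I \<Longrightarrow> a i \<in> vecs H"
  shows "hs_sm E (frank s I a)" "hs2 E (frank s I a) = s\<^sup>2 * gram I a a"
proof -
  have "((\<lambda>e. Re (ip H (frank s I a e) (frank s I a e))) has_sum Re (of_real (s\<^sup>2 * gram I a a))) E"
    by (rule has_sum_Re[OF frank_has_sum[OF E I a a]])
  moreover have "Re (ip H (frank s I a e) (frank s I a e)) = (hnorm H (frank s I a e))\<^sup>2" for e
    using norm_sq[OF frank_in[of I a]] a by simp
  ultimately have h: "((\<lambda>e. (hnorm H (frank s I a e))\<^sup>2) has_sum (s\<^sup>2 * gram I a a)) E" by simp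
  then show "hs_sm E (frank s I a)" unfolding hs_sm_def by (rule has_sum_imp_summable)
  show "hs2 E (frank s I a) = s\<^sup>2 * gram I a a" unfolding hs2_def by (rule infsumI[OF h])
qed

text \<open>Conjugating a rank-one operator moves its vector, so translates of \<open>frank\<close>
  are again of that form.\<close>

lemma frank_conj:
  assumes U: "adj U U'" and a: "\<And>i. i \<in> I \<Longrightarrow> a i \<in> vecs H" and v: "v \<in> vecs H"
  shows "U (frank s I a (U' v)) = frank s I (U \<circ> a) v"
proof -
  have Us: "U (sum f J) = (\<Sum>i\<in>J. U (f i))" if "\<And>i. i \<in> J \<Longrightarrow> f i \<in> vecs H" for J and f :: "'b \<Rightarrow> 'v"
    using that
    by (induction J rule: infinite_finite_induct) (auto simp: adj_zero[OF U] adj_add[OF U] sum_in)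
  have "U (frank s I a (U' v)) = (\<Sum>i\<in>I. U ((of_real s * ip H (U' v) (a i)) *\<^sub>C a i))"
    unfolding frank_def using a by (intro Us scale_in)
  also have "\<dots> = frank s I (U \<circ> a) v"
    unfolding frank_def
  proof (rule sum.cong[OF refl])
    fix i assume "i \<in> I"
    then have i: "a i \<in> vecs H" by (rule a)
    show "U ((of_real s * ip H (U' v) (a i)) *\<^sub>C a i) = (of_real s * ip H v ((U \<circ> a) i)) *\<^sub>C (U \<circ> a) i"
      unfolding adj_scale[OF U i] comp_def adj_ip[OF adj_sym[OF U] v i] ..
  qed
  finally show ?thesis .
qed

lemma gram_self_pos:
  assumes I: "finite I" "i \<in> I" and a: "\<And>i. i \<in> I \<Longrightarrow> a i \<in> vecs H" and "a i \<noteq> 0"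
  shows "0 < gram I a a"
proof -
  have "0 < (cmod (ip H (a i) (a i)))\<^sup>2" using ip_eq_0[OF a[OF I(2)]] assms(4) by auto
  also have "\<dots> \<le> (\<Sum>j\<in>I. (cmod (ip H (a i) (a j)))\<^sup>2)" by (rule member_le_sum[OF I(2)]) (use I in auto)
  also have "\<dots> \<le> gram I a a"
    unfolding gram_def by (rule member_le_sum[OF I(2)]) (use I in \<open>auto intro: sum_nonneg\<close>)
  finally show ?thesis .
qed

lemma parseval_finite:
  assumes F: "ortho F" "finite F" and v: "v \<in> complex_vector.span F"
  shows "(\<Sum>f\<in>F. (cmod (ip H v f))\<^sup>2) = (hnorm H v)\<^sup>2"
proof -
  have vH: "v \<in> vecs H" using span_in[of F] F(1) v by (auto simp: ortho_def)
  have "ip H v v = ip H (proj F v) v" by (simp add: proj_id[OF F v])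
  also have "\<dots> = (\<Sum>f\<in>F. of_real ((cmod (ip H v f))\<^sup>2))"
    unfolding ip_proj[OF F(1) vH vH]
    by (intro sum.cong refl ip_mult_cnj vH) (rule orthoD[OF F(1)])
  finally have "Re (ip H v v) = (\<Sum>f\<in>F. (cmod (ip H v f))\<^sup>2)" by (simp only: flip: of_real_sum) simp
  then show ?thesis using norm_sq[OF vH] by simp
qed

end

section \<open>Continuous representations of the HLS groupoid\<close>

locale HLS_bundle = approximated_group \<Gamma> K
  for \<Gamma> :: "('a, 'm) monoid_scheme" (structure) and K +
  fixes B :: "('a hls, 'v::complex_vector) hilbert_bundle" and \<pi> :: "'a hls \<Rightarrow> 'v \<Rightarrow> 'v"
  assumes rep: "continuous_unitary_rep HLS B \<pi>"
begin

lemma bundle_axioms: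
  "\<forall>u\<in>gunits HLS. separable_hilbert (fib B u)"
  "sect B \<subseteq> all_sections HLS B"
  "complex_vector.subspace (sect B)"
  "\<forall>u\<in>gunits HLS. dense_in (fib B u) ((\<lambda>\<xi>. \<xi> u) ` sect B)"
  "\<forall>\<xi>\<in>sect B. continuous_map (unit_top HLS) euclideanreal (\<lambda>u. hnorm (fib B u) (\<xi> u))"
  "\<forall>\<xi>\<in>all_sections HLS B.
        (\<forall>u\<in>gunits HLS. \<forall>\<epsilon>>0. \<exists>\<eta>\<in>sect B. \<exists>U. openin (unit_top HLS) U \<and> u \<in> U \<and>
           (\<forall>w\<in>U. hnorm (fib B w) (\<xi> w - \<eta> w) < \<epsilon>)) \<longrightarrow> \<xi> \<in> sect B"
  using rep unfolding continuous_unitary_rep_def continuous_hilbert_bundle_def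
  by - (elim conjE, assumption)+

lemma rep_axioms:
  "\<forall>u\<in>gunits HLS. vecs (fib B u) \<noteq> {0}"
  "\<forall>x\<in>arrows HLS. unitary_between (fib B (gsrc HLS x)) (fib B (grng HLS x)) (\<pi> x)"
  "\<forall>u\<in>gunits HLS. \<forall>v\<in>vecs (fib B u). \<pi> u v = v"
  "\<forall>x\<in>arrows HLS. \<forall>y\<in>arrows HLS. gsrc HLS x = grng HLS y \<longrightarrow>
        (\<forall>v\<in>vecs (fib B (gsrc HLS y)). \<pi> (gmul HLS x y) v = \<pi> x (\<pi> y v))"
  "\<forall>x\<in>arrows HLS.
        (\<forall>v\<in>vecs (fib B (gsrc HLS x)). \<pi> (ginv HLS x) (\<pi> x v) = v) \<and>
        (\<forall>w\<in>vecs (fib B (grng HLS x)). \<pi> x (\<pi> (ginv HLS x) w) = w)"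
  "\<forall>\<xi>\<in>C0_sections HLS B. \<forall>\<eta>\<in>C0_sections HLS B.
        continuous_map (gtop HLS) euclidean
          (\<lambda>x. ip (fib B (grng HLS x)) (\<pi> x (\<xi> (gsrc HLS x))) (\<eta> (grng HLS x)))"
  using rep unfolding continuous_unitary_rep_def
  by - (elim conjE, assumption)+

abbreviation lev :: "nat \<Rightarrow> 'a hls" where "lev n \<equiv> Level n (K n)"
abbreviation lim :: "'a hls" where "lim \<equiv> Limit \<one>"

lemma lev_unit: "lev n \<in> gunits HLS" and lim_unit: "lim \<in> gunits HLS"
  by (simp_all add: unit_Level unit_Limit)

lemma fib_sep: "u \<in> gunits HLS \<Longrightarrow> separable_hilbert (fib B u)"
  using bundle_axioms(1) by blast

lemma fib_hilb: "u \<in> gunits HLS \<Longrightarrow> hilb (fib B u)"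
  using fib_sep by unfold_locales (simp add: separable_hilbert_def)

lemma sect_in: "\<xi> \<in> sect B \<Longrightarrow> u \<in> gunits HLS \<Longrightarrow> \<xi> u \<in> vecs (fib B u)"
  using bundle_axioms(2) unfolding all_sections_def by blast

lemma sect_norm_tendsto:
  "\<xi> \<in> sect B \<Longrightarrow> (\<lambda>n. hnorm (fib B (lev n)) (\<xi> (lev n))) \<longlonglongrightarrow> hnorm (fib B lim) (\<xi> lim)"
  using bundle_axioms(5) unfolding continuous_map_units by (rule bspec)

lemma C0_sect: "C0_sections HLS B = sect B"
  unfolding C0_sections_def C0_function_units using sect_norm_tendsto by blast

section \<open>Continuous sections through prescribed vectors\<close>

lemma sect_zero: "0 \<in> sect B"
  and sect_diff: "\<xi> \<in> sect B \<Longrightarrow> \<eta> \<in> sect B \<Longrightarrow> \<xi> - \<eta> \<in> sect B"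
  and sect_scale: "\<xi> \<in> sect B \<Longrightarrow> c *\<^sub>C \<xi> \<in> sect B"
  and sect_sum: "(\<And>i. i \<in> I \<Longrightarrow> \<zeta> i \<in> sect B) \<Longrightarrow> (\<Sum>i\<in>I. \<zeta> i) \<in> sect B"
  using bundle_axioms(3)
  by (simp_all add: complex_vector.subspace_0 complex_vector.subspace_diff
      complex_vector.subspace_scale complex_vector.subspace_sum)

text \<open>Since the finite levels are isolated, continuity only has to be tested at the limit unit.\<close>

lemma sectI:
  assumes s: "\<xi> \<in> all_sections HLS B"
    and a: "\<And>\<epsilon>. \<epsilon> > 0 \<Longrightarrow> \<exists>\<eta>\<in>sect B. hnorm (fib B lim) (\<xi> lim - \<eta> lim) < \<epsilon> \<and>
      (\<exists>N. \<forall>n>N. hnorm (fib B (lev n)) (\<xi> (lev n) - \<eta> (lev n)) < \<epsilon>)"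
  shows "\<xi> \<in> sect B"
proof (rule bundle_axioms(6)[rule_format, OF s])
  fix u and \<epsilon> :: real assume u: "u \<in> gunits HLS" and \<epsilon>: "\<epsilon> > 0"
  show "\<exists>\<eta>\<in>sect B. \<exists>U. openin (unit_top HLS) U \<and> u \<in> U \<and>
           (\<forall>w\<in>U. hnorm (fib B w) (\<xi> w - \<eta> w) < \<epsilon>)"
    using u
  proof (cases rule: unit_cases)
    case (level n)
    have "\<xi> u \<in> vecs (fib B u)" using s u unfolding all_sections_def by blast
    then obtain \<eta> where "\<eta> \<in> sect B" "hnorm (fib B u) (\<xi> u - \<eta> u) < \<epsilon>"
      using bundle_axioms(4) u \<epsilon> unfolding dense_in_def by blast
    moreover have "openin (unit_top HLS) {u}" unfolding openin_units level by (simp add: unit_Level)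
    ultimately show ?thesis by blast
  next
    case limit
    obtain \<eta> N where \<eta>: "\<eta> \<in> sect B" "hnorm (fib B lim) (\<xi> lim - \<eta> lim) < \<epsilon>"
      "\<forall>n>N. hnorm (fib B (lev n)) (\<xi> (lev n) - \<eta> (lev n)) < \<epsilon>" using a[OF \<epsilon>] by blast
    define U where "U = insert lim {lev n | n. n > N}"
    have "openin (unit_top HLS) U"
      unfolding openin_units U_def using lev_unit lim_unit by auto
    moreover have "\<forall>w\<in>U. hnorm (fib B w) (\<xi> w - \<eta> w) < \<epsilon>" using \<eta> by (auto simp: U_def)
    ultimately show ?thesis using \<eta>(1) limit by (intro bexI[of _ \<eta>] exI[of _ U]) (auto simp: U_def)
  qed
qed

text \<open>Extension by zero is continuous, since level \<open>n\<close> is isolated.\<close>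

lemma sect_at_level:
  assumes v: "v \<in> vecs (fib B (lev n))"
  shows "\<exists>\<xi>\<in>sect B. \<xi> (lev n) = v"
proof -
  define \<xi> where "\<xi> u = (if u = lev n then v else 0)" for u
  have z: "0 \<in> vecs (fib B u)" if "u \<in> gunits HLS" for u
    using fib_hilb[OF that] by (rule hilb.zero_in)
  have z': "hnorm (fib B u) 0 = 0" if "u \<in> gunits HLS" for u
    using fib_hilb[OF that] by (rule hilb.norm_zero)
  have "\<xi> \<in> sect B"
  proof (rule sectI)
    show "\<xi> \<in> all_sections HLS B"
      using v z lev_unit by (auto simp: all_sections_def \<xi>_def)
    fix \<epsilon> :: real assume "\<epsilon> > 0"
    then show "\<exists>\<eta>\<in>sect B. hnorm (fib B lim) (\<xi> lim - \<eta> lim) < \<epsilon> \<and>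
      (\<exists>N. \<forall>n>N. hnorm (fib B (lev n)) (\<xi> (lev n) - \<eta> (lev n)) < \<epsilon>)"
      using z'[OF lev_unit] z'[OF lim_unit] sect_zero
      by (intro bexI[of _ 0] conjI exI[of _ n] allI impI) (simp_all add: \<xi>_def)
  qed
  then show ?thesis by (intro bexI[of _ \<xi>]) (simp_all add: \<xi>_def)
qed

text \<open>The bundle axioms give values of sections only densely at the limit. Sections
  \<open>\<eta> k\<close> that approximate \<open>v\<close> within \<open>(1/2) ^ k\<close> are
  spliced: level \<open>n\<close> takes \<open>\<eta> (kk n)\<close>, where \<open>kk n\<close> is
  the largest index still under control there.\<close>

lemma sect_at_lim:
  assumes v: "v \<in> vecs (fib B lim)"
  shows "\<exists>\<xi>\<in>sect B. \<xi> lim = v"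
proof -
  interpret L: hilb "fib B lim" by (rule fib_hilb[OF lim_unit])
  have "\<forall>k. \<exists>\<eta>\<in>sect B. hnorm (fib B lim) (v - \<eta> lim) < (1/2) ^ k"
  proof
    fix k
    show "\<exists>\<eta>\<in>sect B. hnorm (fib B lim) (v - \<eta> lim) < (1/2) ^ k"
      using bspec[OF bundle_axioms(4) lim_unit] v zero_less_power[of "1/2 :: real" k]
      unfolding dense_in_def by simp
  qed
  then obtain \<eta> where \<eta>: "\<And>k. \<eta> k \<in> sect B" "\<And>k. hnorm (fib B lim) (v - \<eta> k lim) < (1/2) ^ k"
    by metis
  \<comment> \<open>At the limit \<open>\<eta> k\<close> and \<open>\<eta> j\<close> differ by less
    than \<open>2 * (1/2) ^ j\<close>; the factor 3 leaves room for the bound to persist at all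
    large levels. The condition \<open>k \<le> n\<close> makes the set finite, so that
    \<open>Max\<close> is meaningful.\<close>
  define P where "P n k \<longleftrightarrow> k \<le> n \<and>
    (\<forall>j\<le>k. hnorm (fib B (lev n)) (\<eta> k (lev n) - \<eta> j (lev n)) \<le> 3 * (1/2) ^ j)" for n k
  define kk where "kk n = Max {k. P n k}" for n
  have fin: "finite {k. P n k}" for n by (rule finite_subset[of _ "{..n}"]) (auto simp: P_def)
  have P0: "P n 0" for n
    using hilb.norm_zero[OF fib_hilb[OF lev_unit[of n]]] by (simp add: P_def)
  have Pkk: "P n (kk n)" for n
    using Max_in[OF fin, of n] P0[of n] unfolding kk_def by blast
  \<comment> \<open>Consequently \<open>kk n\<close> is eventually at least any given
    \<open>j\<close>; continuity of the spliced section rests on this.\<close>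
  have ev: "\<forall>\<^sub>F n in sequentially. P n j" for j
  proof -
    have "\<forall>\<^sub>F n in sequentially. hnorm (fib B (lev n)) (\<eta> j (lev n) - \<eta> i (lev n)) < 3 * (1/2) ^ i"
      if "i \<le> j" for i
    proof -
      have e: "\<eta> k lim \<in> vecs (fib B lim)" for k using sect_in[OF \<eta>(1) lim_unit] .
      have "hnorm (fib B lim) (\<eta> j lim - \<eta> i lim) \<le>
          hnorm (fib B lim) (v - \<eta> j lim) + hnorm (fib B lim) (v - \<eta> i lim)"
        using L.norm_triangle_sub[of "\<eta> j lim" v "\<eta> i lim"] v e L.norm_minus_commute[of v "\<eta> j lim"] by simp
      also have "\<dots> < (1/2) ^ j + (1/2) ^ i" by (intro add_strict_mono \<eta>)
      also have "\<dots> \<le> (1/2) ^ i + (1/2) ^ i"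
        using that by (intro add_right_mono power_decreasing) auto
      also have "\<dots> < 3 * (1/2 :: real) ^ i" by simp
      finally have l: "hnorm (fib B lim) ((\<eta> j - \<eta> i) lim) < 3 * (1/2) ^ i" by simp
      show ?thesis
        using order_tendstoD(2)[OF sect_norm_tendsto[OF sect_diff[OF \<eta>(1) \<eta>(1)]] l] by simp
    qed
    then have "\<forall>\<^sub>F n in sequentially. \<forall>i\<in>{..j}. hnorm (fib B (lev n)) (\<eta> j (lev n) - \<eta> i (lev n)) < 3 * (1/2) ^ i"
      by (intro eventually_ball_finite) auto
    then show ?thesis using eventually_ge_at_top[of j]
      by eventually_elim (auto simp: P_def less_imp_le)
  qed
  define \<xi> where "\<xi> u = (case u of Level n A \<Rightarrow> if A = K n then \<eta> (kk n) (lev n) else 0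
     | Limit g \<Rightarrow> if g = \<one> then v else 0)" for u
  have \<xi>_lev: "\<xi> (lev n) = \<eta> (kk n) (lev n)" and \<xi>_lim: "\<xi> lim = v" for n by (simp_all add: \<xi>_def)
  have "\<xi> \<in> sect B"
  proof (rule sectI)
    have "\<xi> u \<in> vecs (fib B u)" if "u \<in> gunits HLS" for u
      using that
    proof (cases rule: unit_cases)
      case (level n)
      then show ?thesis using sect_in[OF \<eta>(1) lev_unit] by (simp add: \<xi>_lev)
    next
      case limit
      then show ?thesis using v by (simp add: \<xi>_lim)
    qed
    moreover have "\<xi> u = 0" if "u \<notin> gunits HLS" for u
      using that by (cases u) (simp_all add: unit_Level unit_Limit \<xi>_def)
    ultimately show "\<xi> \<in> all_sections HLS B" by (simp add: all_sections_def)
    fix \<epsilon> :: real assume \<epsilon>: "\<epsilon> > 0"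
    then obtain j where j: "(1/2) ^ j < \<epsilon> / 3" using real_arch_pow_inv[of "\<epsilon> / 3" "1/2"] by auto
    obtain N where N: "\<And>n. n \<ge> N \<Longrightarrow> P n j" using ev[of j] unfolding eventually_sequentially by blast
    show "\<exists>\<eta>\<in>sect B. hnorm (fib B lim) (\<xi> lim - \<eta> lim) < \<epsilon> \<and>
      (\<exists>N. \<forall>n>N. hnorm (fib B (lev n)) (\<xi> (lev n) - \<eta> (lev n)) < \<epsilon>)"
    proof (intro bexI[of _ "\<eta> j"] conjI exI[of _ N] allI impI \<eta>(1))
      show "hnorm (fib B lim) (\<xi> lim - \<eta> j lim) < \<epsilon>" using \<eta>(2)[of j] j \<epsilon> by (simp add: \<xi>_lim)
      fix n assume "n > N"
      then have "P n j" using N by simp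
      then have "j \<le> kk n" unfolding kk_def using fin by (intro Max_ge) auto
      then have "hnorm (fib B (lev n)) (\<eta> (kk n) (lev n) - \<eta> j (lev n)) \<le> 3 * (1/2) ^ j"
        using Pkk[of n] by (simp add: P_def)
      then show "hnorm (fib B (lev n)) (\<xi> (lev n) - \<eta> j (lev n)) < \<epsilon>" using j by (simp add: \<xi>_lev)
    qed
  qed
  then show ?thesis using \<xi>_lim by blast
qed

lemma sect_at:
  assumes "u \<in> gunits HLS" "v \<in> vecs (fib B u)"
  shows "\<exists>\<xi>\<in>sect B. \<xi> u = v"
  using assms(1)
proof (cases rule: unit_cases)
  case (level n)
  then show ?thesis using sect_at_level assms(2) by simp
next
  case limit
  then show ?thesis using sect_at_lim assms(2) by simp
qed

section \<open>Adjointable operators and their localizations\<close>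

lemma adjointableE:
  assumes "adjointable HLS B T"
  obtains S where "\<forall>\<xi>\<in>sect B. T \<xi> \<in> sect B" "\<forall>\<xi>\<in>sect B. S \<xi> \<in> sect B"
    "\<forall>\<xi>\<in>sect B. \<forall>\<eta>\<in>sect B. \<forall>u\<in>gunits HLS.
       ip (fib B u) (T \<xi> u) (\<eta> u) = ip (fib B u) (\<xi> u) (S \<eta> u)"
  using assms unfolding adjointable_def C0_sect image_subset_iff by (elim conjE exE)

text \<open>The value is tested against all vectors of the fiber, each realized by a section; moving
  \<open>T\<close> across as \<open>S\<close> leaves only the dependence on
  \<open>\<xi> u\<close>.\<close>

lemma localization_eq:
  assumes T: "adjointable HLS B T" and u: "u \<in> gunits HLS" and \<xi>: "\<xi> \<in> sect B"
  shows "localization HLS B T u (\<xi> u) = T \<xi> u"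
proof -
  interpret L: hilb "fib B u" by (rule fib_hilb[OF u])
  obtain S where S: "\<forall>\<xi>\<in>sect B. T \<xi> \<in> sect B" "\<forall>\<xi>\<in>sect B. S \<xi> \<in> sect B"
    "\<forall>\<xi>\<in>sect B. \<forall>\<eta>\<in>sect B. \<forall>u\<in>gunits HLS.
       ip (fib B u) (T \<xi> u) (\<eta> u) = ip (fib B u) (\<xi> u) (S \<eta> u)"
    using T by (rule adjointableE)
  note Ts = S(1)[rule_format] and TS = S(3)[rule_format]
  have "T \<zeta> u = T \<xi> u" if \<zeta>: "\<zeta> \<in> sect B" "\<zeta> u = \<xi> u" for \<zeta>
  proof (rule L.eqI_ip)
    show "T \<zeta> u \<in> vecs (fib B u)" "T \<xi> u \<in> vecs (fib B u)"
      using sect_in[OF Ts u] \<zeta>(1) \<xi> by blast+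
    fix w assume "w \<in> vecs (fib B u)"
    then obtain \<eta> where "\<eta> \<in> sect B" "\<eta> u = w" using sect_at[OF u] by blast
    then show "ip (fib B u) (T \<zeta> u) w = ip (fib B u) (T \<xi> u) w"
      using TS[OF \<zeta>(1) _ u] TS[OF \<xi> _ u] \<zeta>(2) by metis
  qed
  note eq = this
  show ?thesis
    unfolding localization_def C0_sect
  proof (rule the_equality)
    show "\<exists>\<zeta>\<in>sect B. \<zeta> u = \<xi> u \<and> T \<xi> u = T \<zeta> u" using \<xi> by (intro bexI[of _ \<xi>]) simp_all
    fix w assume "\<exists>\<zeta>\<in>sect B. \<zeta> u = \<xi> u \<and> w = T \<zeta> u"
    then show "w = T \<xi> u" using eq by (elim bexE conjE) simp
  qed
qed

text \<open>Each vector is extended to some section \<open>s v\<close>. The choice may be nonlinear,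
  as \<open>adj\<close> asks only for membership and the pairing identity.\<close>

lemma localization_adj:
  assumes T: "adjointable HLS B T" and u: "u \<in> gunits HLS"
  shows "\<exists>S. hilb.adj (fib B u) (localization HLS B T u) S"
proof -
  interpret L: hilb "fib B u" by (rule fib_hilb[OF u])
  obtain S where S: "\<forall>\<xi>\<in>sect B. T \<xi> \<in> sect B" "\<forall>\<xi>\<in>sect B. S \<xi> \<in> sect B"
    "\<forall>\<xi>\<in>sect B. \<forall>\<eta>\<in>sect B. \<forall>u\<in>gunits HLS.
       ip (fib B u) (T \<xi> u) (\<eta> u) = ip (fib B u) (\<xi> u) (S \<eta> u)"
    using T by (rule adjointableE)
  note Ts = S(1,2)[rule_format] and TS = S(3)[rule_format]
  obtain s where s: "\<And>v. v \<in> vecs (fib B u) \<Longrightarrow> s v \<in> sect B" "\<And>v. v \<in> vecs (fib B u) \<Longrightarrow> s v u = v"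
    using sect_at[OF u] by metis
  have loc: "localization HLS B T u v = T (s v) u" if "v \<in> vecs (fib B u)" for v
    using localization_eq[OF T u s(1)[OF that]] s(2)[OF that] by simp
  have "L.adj (localization HLS B T u) (\<lambda>v. S (s v) u)"
    unfolding L.adj_def
  proof (intro conjI ballI)
    fix v assume v: "v \<in> vecs (fib B u)"
    show "localization HLS B T u v \<in> vecs (fib B u)"
      unfolding loc[OF v] by (rule sect_in[OF Ts(1)[OF s(1)[OF v]] u])
    show "S (s v) u \<in> vecs (fib B u)"
      by (rule sect_in[OF Ts(2)[OF s(1)[OF v]] u])
    fix w assume w: "w \<in> vecs (fib B u)"
    show "ip (fib B u) (localization HLS B T u v) w = ip (fib B u) v (S (s w) u)"
      using TS[OF s(1)[OF v] s(1)[OF w] u] unfolding loc[OF v] s(2)[OF v] s(2)[OF w] .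
  qed
  then show ?thesis by blast
qed

section \<open>The unitaries on the fibers and their matrix coefficients\<close>

lemma inv_arrow:
  assumes x: "x \<in> arrows HLS"
  shows "hls_inv \<Gamma> K x \<in> arrows HLS" "hls_unit \<Gamma> K (hls_inv \<Gamma> K x) = hls_unit \<Gamma> K x"
    "hls_unit \<Gamma> K x \<in> gunits HLS"
proof -
  have "group (\<Gamma> Mod K n)" for n using K_normal by (rule normal.factorgroup_is_group)
  then show "hls_inv \<Gamma> K x \<in> arrows HLS"
    using x by (cases x) (auto simp: arrows_def Level_arrow Limit_arrow intro: group.inv_closed)
  show "hls_unit \<Gamma> K (hls_inv \<Gamma> K x) = hls_unit \<Gamma> K x" by (cases x) simp_all
  show "hls_unit \<Gamma> K x \<in> gunits HLS" by (cases x) (simp_all add: unit_Level unit_Limit)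
qed

lemma rep_unitary:
  assumes x: "x \<in> arrows HLS"
  defines "u \<equiv> hls_unit \<Gamma> K x"
  shows "v \<in> vecs (fib B u) \<Longrightarrow> \<pi> x v \<in> vecs (fib B u)"
    "v \<in> vecs (fib B u) \<Longrightarrow> w \<in> vecs (fib B u) \<Longrightarrow> \<pi> x (v + w) = \<pi> x v + \<pi> x w"
    "v \<in> vecs (fib B u) \<Longrightarrow> \<pi> x (c *\<^sub>C v) = c *\<^sub>C \<pi> x v"
    "v \<in> vecs (fib B u) \<Longrightarrow> w \<in> vecs (fib B u) \<Longrightarrow> ip (fib B u) (\<pi> x v) (\<pi> x w) = ip (fib B u) v w"
proof -
  have "unitary_between (fib B u) (fib B u) (\<pi> x)" using rep_axioms(2) x unfolding u_def by simp
  then have *: "\<pi> x ` vecs (fib B u) \<subseteq> vecs (fib B u)"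
    "\<forall>v\<in>vecs (fib B u). \<forall>w\<in>vecs (fib B u). \<pi> x (v + w) = \<pi> x v + \<pi> x w"
    "\<forall>c. \<forall>v\<in>vecs (fib B u). \<pi> x (c *\<^sub>C v) = c *\<^sub>C \<pi> x v"
    "\<forall>v\<in>vecs (fib B u). \<forall>w\<in>vecs (fib B u). ip (fib B u) (\<pi> x v) (\<pi> x w) = ip (fib B u) v w"
    unfolding unitary_between_def linear_between_def by - (elim conjE, assumption)+
  show "v \<in> vecs (fib B u) \<Longrightarrow> \<pi> x v \<in> vecs (fib B u)" using *(1) by blast
  show "v \<in> vecs (fib B u) \<Longrightarrow> w \<in> vecs (fib B u) \<Longrightarrow> \<pi> x (v + w) = \<pi> x v + \<pi> x w" using *(2) by blast
  show "v \<in> vecs (fib B u) \<Longrightarrow> \<pi> x (c *\<^sub>C v) = c *\<^sub>C \<pi> x v" using *(3) by blast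
  show "v \<in> vecs (fib B u) \<Longrightarrow> w \<in> vecs (fib B u) \<Longrightarrow> ip (fib B u) (\<pi> x v) (\<pi> x w) = ip (fib B u) v w"
    using *(4) by blast
qed

lemma rep_adj:
  assumes x: "x \<in> arrows HLS"
  shows "hilb.adj (fib B (hls_unit \<Gamma> K x)) (\<pi> x) (\<pi> (hls_inv \<Gamma> K x))"
proof -
  define u where "u = hls_unit \<Gamma> K x"
  interpret L: hilb "fib B u" unfolding u_def by (rule fib_hilb[OF inv_arrow(3)[OF x]])
  have i: "\<pi> (hls_inv \<Gamma> K x) w \<in> vecs (fib B u)" if "w \<in> vecs (fib B u)" for w
    using rep_unitary(1)[OF inv_arrow(1)[OF x]] that unfolding inv_arrow(2)[OF x] u_def by blast
  have "\<pi> x (\<pi> (hls_inv \<Gamma> K x) w) = w" if "w \<in> vecs (fib B u)" for w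
    using rep_axioms(5) x that by (simp add: u_def)
  then have "L.adj (\<pi> x) (\<pi> (hls_inv \<Gamma> K x))"
    unfolding L.adj_def using rep_unitary(1,4)[OF x, folded u_def] i by metis
  then show ?thesis by (simp add: u_def)
qed

lemma rep_tendsto:
  assumes g: "g \<in> carrier \<Gamma>" and s: "\<xi> \<in> sect B" "\<eta> \<in> sect B"
  shows "(\<lambda>n. ip (fib B (lev n)) (\<pi> (Level n (K n #> g)) (\<xi> (lev n))) (\<eta> (lev n)))
    \<longlonglongrightarrow> ip (fib B lim) (\<pi> (Limit g) (\<xi> lim)) (\<eta> lim)"
  using rep_axioms(6) s g unfolding C0_sect gtop_HLS continuous_map_HLS by simp

text \<open>The case \<open>g = \<one>\<close> of \<open>rep_tendsto\<close>, where the
  representation acts trivially.\<close>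

lemma sect_ip_tendsto:
  assumes s: "\<xi> \<in> sect B" "\<eta> \<in> sect B"
  shows "(\<lambda>n. ip (fib B (lev n)) (\<xi> (lev n)) (\<eta> (lev n))) \<longlonglongrightarrow> ip (fib B lim) (\<xi> lim) (\<eta> lim)"
  using rep_tendsto[OF one_closed s] rep_axioms(3) sect_in[OF s(1)] lev_unit lim_unit by simp

lemma limit_rep_unitary: "unitary_rep \<Gamma> (limit_fiber \<Gamma> B) (limit_rep \<pi>)"
proof -
  have a: "Limit g \<in> arrows HLS" if "g \<in> carrier \<Gamma>" for g using that by (simp add: arrows_def Limit_arrow)
  have u: "hls_unit \<Gamma> K (Limit g) = lim" for g by simp
  note r = rep_unitary[OF a, unfolded u]
  have m: "\<pi> (Limit (g \<otimes> h)) v = \<pi> (Limit g) (\<pi> (Limit h) v)"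
    if "g \<in> carrier \<Gamma>" "h \<in> carrier \<Gamma>" "v \<in> vecs (fib B lim)" for g h v
    using rep_axioms(4)[rule_format, OF a[OF that(1)] a[OF that(2)], of v] that(3) by simp
  have o: "\<pi> lim v = v" if "v \<in> vecs (fib B lim)" for v
    using rep_axioms(3) lim_unit that by blast
  show ?thesis
    unfolding unitary_rep_def limit_fiber_def limit_rep_def
    by (intro conjI ballI allI r m o)
qed

text \<open>Amenability is evaluated on two compact sets, the limit unit and the limit arrows over
  \<open>F\<close>. One operator of the net, localized at the limit unit, then meets the hypotheses
  of \<open>finite_dim_subrep_of_almost_invariant\<close>.\<close>

lemma finite_dim_subrep_of_amenable:
  assumes K: "kazhdan_pair \<Gamma> F c" and am: "amenable_rep HLS B \<pi>"
  shows "has_finite_dim_subrep \<Gamma> (limit_fiber \<Gamma> B) (limit_rep \<pi>)"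
proof -
  define H where "H = fib B lim"
  have Hl: "limit_fiber \<Gamma> B = H" by (simp add: H_def limit_fiber_def)
  have sep: "separable_hilbert H" unfolding H_def by (rule fib_sep[OF lim_unit])
  interpret R: unitary_representation H \<Gamma> "limit_rep \<pi>"
  proof unfold_locales
    show "hilbert_space H" using sep by (simp add: separable_hilbert_def)
    show "unitary_rep \<Gamma> H (limit_rep \<pi>)" using limit_rep_unitary unfolding Hl .
  qed
  define E where "E = chosen_basis H"
  have E: "orthonormal_basis H E" unfolding E_def by (rule R.chosen_basis[OF sep])
  have F: "finite F" "F \<subseteq> carrier \<Gamma>" and c: "0 < c" using K by (auto simp: kazhdan_pair_def)
  \<comment> \<open>With norm and inner products within \<open>\<eta>\<close> of 1, the squared
    displacement is below \<open>8 * \<eta> \<le> c\<^sup>2 / 5\<close>, while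
    \<open>c\<^sup>2\<close> times the squared norm is at least \<open>c\<^sup>2 / 4\<close> because
    \<open>\<eta> \<le> 1/2\<close>.\<close>
  define \<eta> where "\<eta> = min (1/2) (c\<^sup>2 / 40)"
  have \<eta>: "0 < \<eta>" "\<eta> \<le> 1/2" "\<eta> \<le> c\<^sup>2 / 40" using c by (auto simp: \<eta>_def)
  obtain Fil :: "(('a hls \<Rightarrow> 'v) \<Rightarrow> 'a hls \<Rightarrow> 'v) filter" where Fil: "Fil \<noteq> bot"
    and e1: "\<forall>\<^sub>F T in Fil. hilbert_schmidt HLS B T \<and> hs_sup_norm HLS B T \<le> 1"
    and e2: "\<forall>C. compactin (unit_top HLS) C \<longrightarrow>
           uniform_limit C (\<lambda>T u. hs_norm (fib B u) (localization HLS B T u)) (\<lambda>_. 1) Fil"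
    and e3: "\<forall>C. compactin (gtop HLS) C \<longrightarrow>
           uniform_limit C
             (\<lambda>T x. hs_inner (fib B (grng HLS x))
                (translate_op HLS \<pi> x (localization HLS B T (gsrc HLS x)))
                (localization HLS B T (grng HLS x)))
             (\<lambda>_. 1) Fil"
    using am unfolding amenable_rep_def by (elim exE conjE)
  have C1: "compactin (unit_top HLS) {lim}"
    by (rule finite_imp_compactin) (use lim_unit topspace_units in auto)
  have C2: "compactin (gtop HLS) (Limit ` F)"
    by (rule finite_imp_compactin) (use F Limit_arrow in auto)
  have "\<forall>\<^sub>F T in Fil. dist (hs_norm H (localization HLS B T lim)) 1 < \<eta>"
    using uniform_limitD[OF e2[rule_format, OF C1] \<eta>(1)] by (simp add: H_def)
  moreover have "\<forall>\<^sub>F T in Fil. \<forall>g\<in>F. dist (hs_inner H (translate_op HLS \<pi> (Limit g) (localization HLS B T lim))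
      (localization HLS B T lim)) 1 < \<eta>"
    using uniform_limitD[OF e3[rule_format, OF C2] \<eta>(1)] by (simp add: H_def)
  ultimately have "\<forall>\<^sub>F T in Fil. hilbert_schmidt HLS B T \<and> dist (hs_norm H (localization HLS B T lim)) 1 < \<eta> \<and>
      (\<forall>g\<in>F. dist (hs_inner H (translate_op HLS \<pi> (Limit g) (localization HLS B T lim))
      (localization HLS B T lim)) 1 < \<eta>)"
    using e1 by eventually_elim blast
  then obtain T where T: "hilbert_schmidt HLS B T" and d1: "dist (hs_norm H (localization HLS B T lim)) 1 < \<eta>"
    and d2: "\<And>g. g \<in> F \<Longrightarrow> dist (hs_inner H (translate_op HLS \<pi> (Limit g) (localization HLS B T lim))
      (localization HLS B T lim)) 1 < \<eta>"
    using eventually_happens'[OF Fil] by blast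
  define A where "A = localization HLS B T lim"
  have "adjointable HLS B T" using T by (simp add: hilbert_schmidt_def)
  from localization_adj[OF this lim_unit] obtain S where S: "R.adj A S"
    unfolding A_def H_def by blast
  have "has_finite_trace H (abs_square H A)"
    using T lim_unit by (simp add: hilbert_schmidt_def A_def H_def)
  then have sm: "R.hs_sm E A" unfolding E_def R.trace_abs_square(1)[OF sep S] .
  define N where "N = R.hs2 E A"
  have "\<bar>sqrt N - 1\<bar> < \<eta>"
    using d1 unfolding A_def[symmetric] R.trace_abs_square(3)[OF sep S] by (simp add: N_def E_def dist_real_def)
  then have sN: "1 - \<eta> < sqrt N" "sqrt N < 1 + \<eta>" by auto
  have N0: "0 \<le> N" unfolding N_def by (rule R.hs2_nonneg)
  have "(1/2)\<^sup>2 \<le> (sqrt N)\<^sup>2" using sN(1) \<eta>(2) by (intro power_mono) auto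
  then have N1: "1/4 \<le> N" using N0 by (simp add: power2_eq_square)
  have "(sqrt N)\<^sup>2 \<le> (1 + \<eta>)\<^sup>2" using sN(2) N0 by (intro power_mono) auto
  also have "(1 + \<eta>)\<^sup>2 \<le> 1 + 3 * \<eta>" using \<eta>(1,2) mult_right_mono[of \<eta> 1 \<eta>] by (simp add: power2_eq_square algebra_simps)
  finally have N2: "N \<le> 1 + 3 * \<eta>" using N0 by simp
  show ?thesis unfolding Hl
  proof (rule R.finite_dim_subrep_of_almost_invariant[OF E sep K S sm])
    show "0 < R.hs2 E A" using N1 by (simp add: N_def)
    fix g assume g: "g \<in> F"
    then have gG: "g \<in> carrier \<Gamma>" using F by blast
    define X where "X = limit_rep \<pi> g \<circ> A \<circ> limit_rep \<pi> (inv g)"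
    have X: "translate_op HLS \<pi> (Limit g) A = X"
      by (simp add: translate_op_def X_def limit_rep_def)
    have "X v \<in> vecs H" if "v \<in> vecs H" for v
      unfolding X_def comp_def using R.rep_in[OF gG R.adj_in[OF S R.rep_in[OF inv_closed[OF gG] that]]] .
    then have "hs_inner H X A = R.hsip E X A" unfolding E_def by (rule R.hs_inner_hsip[OF sep S])
    then have "cmod (R.hsip E X A - 1) < \<eta>" using d2[OF g] X by (simp add: A_def dist_norm)
    then have "\<bar>Re (R.hsip E X A - 1)\<bar> < \<eta>" using abs_Re_le_cmod le_less_trans by blast
    then have "1 - \<eta> < Re (R.hsip E X A)" by auto
    then have "2 * (N - Re (R.hsip E X A)) < c\<^sup>2 / 4" using N2 \<eta> by auto
    also have "\<dots> \<le> c\<^sup>2 * N" using N1 mult_left_mono[OF N1, of "c\<^sup>2"] by simp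
    finally show "2 * (R.hs2 E A - Re (R.hsip E (limit_rep \<pi> g \<circ> A \<circ> limit_rep \<pi> (inv g)) A)) < c\<^sup>2 * R.hs2 E A"
      by (simp add: N_def X_def)
  qed
qed

text \<open>What amenability asks of an operator at one unit, expressed through \<open>gram\<close>.
  The form \<open>frank\<close> is assumed at this unit only, because the operators built below are
  of different kinds at different levels.\<close>

lemma frank_localization:
  assumes T: "adjointable HLS B T" and u: "u \<in> gunits HLS" and I: "finite I"
    and a: "\<And>i. i \<in> I \<Longrightarrow> a i \<in> vecs (fib B u)"
    and fr: "\<And>\<xi>. \<xi> \<in> sect B \<Longrightarrow> T \<xi> u = hilb.frank (fib B u) s I a (\<xi> u)"
  shows "has_finite_trace (fib B u) (abs_square (fib B u) (localization HLS B T u))"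
    "op_trace (fib B u) (abs_square (fib B u) (localization HLS B T u)) =
       of_real (s\<^sup>2 * hilb.gram (fib B u) I a a)"
    "hs_norm (fib B u) (localization HLS B T u) = sqrt (s\<^sup>2 * hilb.gram (fib B u) I a a)"
    "\<And>x. x \<in> arrows HLS \<Longrightarrow> hls_unit \<Gamma> K x = u \<Longrightarrow>
       hs_inner (fib B u) (translate_op HLS \<pi> x (localization HLS B T u)) (localization HLS B T u) =
       of_real (s\<^sup>2 * hilb.gram (fib B u) I (\<lambda>i. \<pi> x (a i)) a)"
proof -
  interpret L: hilb "fib B u" by (rule fib_hilb[OF u])
  define A where "A = localization HLS B T u"
  define E where "E = chosen_basis (fib B u)"
  have E: "orthonormal_basis (fib B u) E" unfolding E_def by (rule L.chosen_basis[OF fib_sep[OF u]])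
  have Av: "A v = L.frank s I a v" if v: "v \<in> vecs (fib B u)" for v
  proof -
    obtain \<xi> where \<xi>: "\<xi> \<in> sect B" "\<xi> u = v" using sect_at[OF u v] by blast
    show ?thesis using localization_eq[OF T u \<xi>(1)] fr[OF \<xi>(1)] by (simp add: A_def \<xi>(2))
  qed
  have AA: "L.adj A A" by (rule L.adj_cong[OF L.frank_adj Av Av]) (rule a)
  have Ae: "A e = L.frank s I a e" if "e \<in> E" for e by (rule Av[OF L.basis_in[OF E that]])
  have sm: "L.hs_sm E A"
    using L.frank_hs(1)[OF E I a] unfolding L.hs_sm_def by (subst summable_on_cong[where g = "\<lambda>e. (hnorm (fib B u) (L.frank s I a e))\<^sup>2"]) (simp_all add: Ae)
  have h2: "L.hs2 E A = s\<^sup>2 * L.gram I a a"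
    using L.frank_hs(2)[OF E I a] unfolding L.hs2_def by (subst infsum_cong[where g = "\<lambda>e. (hnorm (fib B u) (L.frank s I a e))\<^sup>2"]) (simp_all add: Ae)
  note tr = L.trace_abs_square[OF fib_sep[OF u] AA, folded E_def]
  show "has_finite_trace (fib B u) (abs_square (fib B u) (localization HLS B T u))"
    unfolding A_def[symmetric] tr(1) by (rule sm)
  show "op_trace (fib B u) (abs_square (fib B u) (localization HLS B T u)) =
       of_real (s\<^sup>2 * L.gram I a a)"
    unfolding A_def[symmetric] tr(2) h2 ..
  show "hs_norm (fib B u) (localization HLS B T u) = sqrt (s\<^sup>2 * L.gram I a a)"
    unfolding A_def[symmetric] tr(3) h2 ..
  fix x assume x: "x \<in> arrows HLS" "hls_unit \<Gamma> K x = u"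
  define X where "X = translate_op HLS \<pi> x A"
  note U = rep_adj[OF x(1), unfolded x(2)]
  have b: "\<pi> x (a i) \<in> vecs (fib B u)" if "i \<in> I" for i by (rule L.adj_in[OF U a[OF that]])
  have Xv: "X v = L.frank s I (\<lambda>i. \<pi> x (a i)) v" if v: "v \<in> vecs (fib B u)" for v
    using L.frank_conj[OF U a v] Av[OF L.adj_in'[OF U v]]
    by (simp add: X_def translate_op_def comp_def)
  have "X v \<in> vecs (fib B u)" if "v \<in> vecs (fib B u)" for v
    unfolding Xv[OF that] by (rule L.frank_in[OF b])
  then have "hs_inner (fib B u) X A = L.hsip E X A"
    unfolding E_def by (rule L.hs_inner_hsip[OF fib_sep[OF u] AA])
  also have "\<dots> = (\<Sum>\<^sub>\<infinity>e\<in>E. ip (fib B u) (L.frank s I (\<lambda>i. \<pi> x (a i)) e) (L.frank s I a e))"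
    unfolding L.hsip_def by (rule infsum_cong) (simp only: Ae Xv[OF L.basis_in[OF E]])
  also have "\<dots> = of_real (s\<^sup>2 * L.gram I (\<lambda>i. \<pi> x (a i)) a)"
    by (rule infsumI[OF L.frank_has_sum[OF E I b a]])
  finally show "hs_inner (fib B u) (translate_op HLS \<pi> x (localization HLS B T u)) (localization HLS B T u) =
       of_real (s\<^sup>2 * L.gram I (\<lambda>i. \<pi> x (a i)) a)"
    by (simp add: X_def A_def)
qed

text \<open>At a finite level the rank-one operators along the orbit of a nonzero vector add up to an
  operator commuting with the representation.\<close>

lemma level_invariant:
  obtains s :: real and I :: "'a set set" and a where "finite I"
    "\<And>i. i \<in> I \<Longrightarrow> a i \<in> vecs (fib B (lev n))"
    "\<And>X. X \<in> carrier (\<Gamma> Mod K n) \<Longrightarrow>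
       s\<^sup>2 * hilb.gram (fib B (lev n)) I (\<lambda>i. \<pi> (Level n X) (a i)) a = 1"
    "s\<^sup>2 * hilb.gram (fib B (lev n)) I a a = 1"
proof -
  interpret L: hilb "fib B (lev n)" by (rule fib_hilb[OF lev_unit])
  interpret Q: group "\<Gamma> Mod K n" using K_normal by (rule normal.factorgroup_is_group)
  have "vecs (fib B (lev n)) \<noteq> {0}" using rep_axioms(1) lev_unit by blast
  then obtain v where v: "v \<in> vecs (fib B (lev n))" "v \<noteq> 0" using L.zero_in by blast
  define I where "I = carrier (\<Gamma> Mod K n)"
  define a where "a A = \<pi> (Level n A) v" for A
  have I: "finite I" using K_finite_index by (simp add: I_def FactGroup_def)
  have arr: "Level n A \<in> arrows HLS" if "A \<in> I" for A using that by (simp add: arrows_def Level_arrow I_def)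
  have un: "hls_unit \<Gamma> K (Level n A) = lev n" for A by simp
  have a: "a A \<in> vecs (fib B (lev n))" if "A \<in> I" for A
    unfolding a_def using rep_unitary(1)[OF arr[OF that], unfolded un, OF v(1)] .
  have mult: "\<pi> (Level n X) (a A) = a (X \<otimes>\<^bsub>\<Gamma> Mod K n\<^esub> A)" if "X \<in> I" "A \<in> I" for X A
    using rep_axioms(4)[rule_format, OF arr[OF that(1)] arr[OF that(2)], of v] v(1) by (simp add: a_def)
  have K1: "K n \<in> I" unfolding I_def by (rule K_Mod)
  have aK: "a (K n) = v" unfolding a_def using rep_axioms(3) lev_unit v(1) by blast
  define G where "G = L.gram I a a"
  have G: "G > 0" unfolding G_def by (rule L.gram_self_pos[OF I K1 a]) (use aK v(2) in auto)
  have inv: "L.gram I (\<lambda>i. \<pi> (Level n X) (a i)) a = G" if X: "X \<in> I" for X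
  proof -
    \<comment> \<open>Left translation by \<open>X\<close> permutes the orbit index, so translating
      the operator merely reindexes the outer sum of \<open>gram\<close>.\<close>
    have bij: "bij_betw (\<lambda>A. X \<otimes>\<^bsub>\<Gamma> Mod K n\<^esub> A) I I"
      using X unfolding I_def by (intro bij_betw_imageI Q.inj_on_cmult Q.surj_const_mult)
    have "L.gram I (\<lambda>i. \<pi> (Level n X) (a i)) a = (\<Sum>i\<in>I. \<Sum>j\<in>I. (cmod (ip (fib B (lev n)) (a (X \<otimes>\<^bsub>\<Gamma> Mod K n\<^esub> i)) (a j)))\<^sup>2)"
      unfolding L.gram_def using mult[OF X] by simp
    also have "\<dots> = G"
      unfolding G_def L.gram_def by (rule sum.reindex_bij_betw[OF bij])
    finally show ?thesis .
  qed
  show ?thesis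
    by (rule that[of I a "1 / sqrt G"])
      (use I a inv G in \<open>simp_all add: power_divide flip: G_def, simp_all add: I_def\<close>)
qed

text \<open>\<open>F\<close> is an orthonormal basis of the invariant subspace. As
  \<open>\<pi> (Limit g) e\<close> stays in its span, Parseval makes every row of
  \<open>gram\<close> sum to the squared norm 1.\<close>

lemma limit_family:
  assumes "has_finite_dim_subrep \<Gamma> (limit_fiber \<Gamma> B) (limit_rep \<pi>)"
  obtains F :: "'v set" and \<xi> where "finite F" "F \<noteq> {}" "\<And>e. e \<in> F \<Longrightarrow> \<xi> e \<in> sect B"
    "\<And>g. g \<in> carrier \<Gamma> \<Longrightarrow>
       hilb.gram (fib B lim) F (\<lambda>e. \<pi> (Limit g) (\<xi> e lim)) (\<lambda>e. \<xi> e lim) = real (card F)"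
proof -
  interpret L: hilb "fib B lim" by (rule fib_hilb[OF lim_unit])
  obtain V E where V: "V \<subseteq> vecs (fib B lim)" "V \<noteq> {0}" "finite E" "V = complex_vector.span E"
    "\<And>g. g \<in> carrier \<Gamma> \<Longrightarrow> \<pi> (Limit g) ` V \<subseteq> V"
    using assms unfolding has_finite_dim_subrep_def limit_fiber_def limit_rep_def by blast
  have "E \<subseteq> vecs (fib B lim)" using V(1,4) complex_vector.span_superset by blast
  then obtain F where F: "finite F" "L.ortho F" "complex_vector.span F = V"
    using L.finite_ortho_basis[OF V(3)] V(4) by blast
  have FV: "e \<in> V" if "e \<in> F" for e using F(3) that complex_vector.span_base by blast
  have FH: "e \<in> vecs (fib B lim)" if "e \<in> F" for e using FV[OF that] V(1) by blast
  have "\<forall>e\<in>F. \<exists>\<zeta>\<in>sect B. \<zeta> lim = e" using sect_at_lim FH by blast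
  then obtain \<xi> where \<xi>: "\<And>e. e \<in> F \<Longrightarrow> \<xi> e \<in> sect B" "\<And>e. e \<in> F \<Longrightarrow> \<xi> e lim = e" by metis
  have "F \<noteq> {}" using F(3) V(2) complex_vector.span_empty by blast
  moreover have "L.gram F (\<lambda>e. \<pi> (Limit g) (\<xi> e lim)) (\<lambda>e. \<xi> e lim) = real (card F)"
    if g: "g \<in> carrier \<Gamma>" for g
  proof -
    have arr: "Limit g \<in> arrows HLS" using g by (simp add: arrows_def Limit_arrow)
    have "(\<Sum>f\<in>F. (cmod (ip (fib B lim) (\<pi> (Limit g) (\<xi> e lim)) (\<xi> f lim)))\<^sup>2) = 1" if e: "e \<in> F" for e
    proof -
      have "(\<Sum>f\<in>F. (cmod (ip (fib B lim) (\<pi> (Limit g) (\<xi> e lim)) (\<xi> f lim)))\<^sup>2) =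
          (\<Sum>f\<in>F. (cmod (ip (fib B lim) (\<pi> (Limit g) e) f))\<^sup>2)"
        using \<xi>(2) e by simp
      also have "\<dots> = (hnorm (fib B lim) (\<pi> (Limit g) e))\<^sup>2"
        by (rule L.parseval_finite[OF F(2,1)]) (use V(5)[OF g] FV[OF e] F(3) in blast)
      also have "\<dots> = 1"
        using rep_unitary(4)[OF arr, of e e] FH[OF e] L.ortho_ip[OF F(2) e e] by (simp add: hnorm_def)
      finally show ?thesis .
    qed
    then show ?thesis unfolding L.gram_def by simp
  qed
  ultimately show ?thesis using that F(1) \<xi>(1) by blast
qed

text \<open>Freezing the coefficients at their limit values gives a section \<open>\<theta>\<close>
  that agrees with \<open>\<zeta>\<close> at the limit; along the levels the coefficients converge,
  and so do the norms of the \<open>\<xi> e\<close>. The finitely many levels up to \<open>N\<close>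
  are isolated, so any fiber vectors are allowed there.\<close>

lemma frank_sect:
  assumes \<zeta>: "\<zeta> \<in> all_sections HLS B" and F: "finite F" "\<And>e. e \<in> F \<Longrightarrow> \<xi> e \<in> sect B"
    and \<eta>: "\<eta> \<in> sect B" and s: "(\<lambda>n. s (lev n)) \<longlonglongrightarrow> s lim"
    and z: "\<zeta> lim = hilb.frank (fib B lim) (s lim) F (\<lambda>e. \<xi> e lim) (\<eta> lim)"
      "\<And>n. n > N \<Longrightarrow> \<zeta> (lev n) = hilb.frank (fib B (lev n)) (s (lev n)) F (\<lambda>e. \<xi> e (lev n)) (\<eta> (lev n))"
  shows "\<zeta> \<in> sect B"
proof (rule sectI[OF \<zeta>])
  interpret L: hilb "fib B lim" by (rule fib_hilb[OF lim_unit])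
  define c where "c e u = of_real (s u) * ip (fib B u) (\<eta> u) (\<xi> e u)" for e u
  define \<theta> where "\<theta> = (\<Sum>e\<in>F. c e lim *\<^sub>C \<xi> e)"
  have \<theta>: "\<theta> \<in> sect B" unfolding \<theta>_def by (intro sect_sum sect_scale F)
  have \<theta>u: "\<theta> u = (\<Sum>e\<in>F. c e lim *\<^sub>C \<xi> e u)" for u
    unfolding \<theta>_def using F(1) by (induction F) (auto simp: scaleC_fun_def)
  have "\<zeta> lim = \<theta> lim" unfolding z(1) L.frank_def \<theta>u c_def ..
  have c: "(\<lambda>n. c e (lev n)) \<longlonglongrightarrow> c e lim" if "e \<in> F" for e
    unfolding c_def by (intro tendsto_mult tendsto_of_real s sect_ip_tendsto \<eta> F(2)[OF that])
  have "(\<lambda>n. \<Sum>e\<in>F. cmod (c e (lev n) - c e lim) * hnorm (fib B (lev n)) (\<xi> e (lev n))) \<longlonglongrightarrow>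
      (\<Sum>e\<in>F. cmod (c e lim - c e lim) * hnorm (fib B lim) (\<xi> e lim))"
    by (intro tendsto_sum tendsto_mult tendsto_norm tendsto_diff c tendsto_const sect_norm_tendsto F(2))
  then have lim0: "(\<lambda>n. \<Sum>e\<in>F. cmod (c e (lev n) - c e lim) * hnorm (fib B (lev n)) (\<xi> e (lev n))) \<longlonglongrightarrow> 0"
    by simp
  have le: "hnorm (fib B (lev n)) (\<zeta> (lev n) - \<theta> (lev n)) \<le>
      (\<Sum>e\<in>F. cmod (c e (lev n) - c e lim) * hnorm (fib B (lev n)) (\<xi> e (lev n)))" if n: "n > N" for n
  proof -
    interpret M: hilb "fib B (lev n)" by (rule fib_hilb[OF lev_unit])
    have x: "\<xi> e (lev n) \<in> vecs (fib B (lev n))" if "e \<in> F" for e by (rule sect_in[OF F(2)[OF that] lev_unit])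
    have "\<zeta> (lev n) - \<theta> (lev n) = (\<Sum>e\<in>F. (c e (lev n) - c e lim) *\<^sub>C \<xi> e (lev n))"
      unfolding z(2)[OF n] M.frank_def \<theta>u c_def
      by (simp add: sum_subtractf complex_vector.scale_left_diff_distrib)
    then have "hnorm (fib B (lev n)) (\<zeta> (lev n) - \<theta> (lev n)) \<le>
        (\<Sum>e\<in>F. hnorm (fib B (lev n)) ((c e (lev n) - c e lim) *\<^sub>C \<xi> e (lev n)))"
      using M.norm_sum_le[of F "\<lambda>e. (c e (lev n) - c e lim) *\<^sub>C \<xi> e (lev n)"] x by simp
    also have "\<dots> = (\<Sum>e\<in>F. cmod (c e (lev n) - c e lim) * hnorm (fib B (lev n)) (\<xi> e (lev n)))"
      using x by (intro sum.cong refl M.norm_scale)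
    finally show ?thesis .
  qed
  fix \<epsilon> :: real assume \<epsilon>: "\<epsilon> > 0"
  obtain M where M: "\<And>n. n \<ge> M \<Longrightarrow>
      (\<Sum>e\<in>F. cmod (c e (lev n) - c e lim) * hnorm (fib B (lev n)) (\<xi> e (lev n))) < \<epsilon>"
    using order_tendstoD(2)[OF lim0 \<epsilon>] unfolding eventually_sequentially by blast
  show "\<exists>\<eta>\<in>sect B. hnorm (fib B lim) (\<zeta> lim - \<eta> lim) < \<epsilon> \<and>
      (\<exists>N. \<forall>n>N. hnorm (fib B (lev n)) (\<zeta> (lev n) - \<eta> (lev n)) < \<epsilon>)"
  proof (intro bexI[OF _ \<theta>] conjI exI[of _ "max M N"] allI impI)
    show "hnorm (fib B lim) (\<zeta> lim - \<theta> lim) < \<epsilon>" using \<open>\<zeta> lim = \<theta> lim\<close> \<epsilon> by simp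
    fix n assume "n > max M N"
    then show "hnorm (fib B (lev n)) (\<zeta> (lev n) - \<theta> (lev n)) < \<epsilon>"
      using le[of n] M[of n] by simp
  qed
qed

lemma amenable_of_finite_dim_subrep:
  assumes fd: "has_finite_dim_subrep \<Gamma> (limit_fiber \<Gamma> B) (limit_rep \<pi>)"
  shows "amenable_rep HLS B \<pi>"
proof -
  obtain F :: "'v set" and \<xi> where F: "finite F" "F \<noteq> {}" and \<xi>: "\<And>e. e \<in> F \<Longrightarrow> \<xi> e \<in> sect B"
    and gl: "\<And>g. g \<in> carrier \<Gamma> \<Longrightarrow>
       hilb.gram (fib B lim) F (\<lambda>e. \<pi> (Limit g) (\<xi> e lim)) (\<lambda>e. \<xi> e lim) = real (card F)"
    using limit_family[OF fd] by metis
  define d where "d = real (card F)"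
  have d: "d > 0" using F by (simp add: d_def card_gt_0_iff)
  have "\<forall>n. \<exists>(s :: real) (I :: 'a set set) a. finite I \<and> (\<forall>i\<in>I. a i \<in> vecs (fib B (lev n))) \<and>
     (\<forall>X\<in>carrier (\<Gamma> Mod K n). s\<^sup>2 * hilb.gram (fib B (lev n)) I (\<lambda>i. \<pi> (Level n X) (a i)) a = 1) \<and>
     s\<^sup>2 * hilb.gram (fib B (lev n)) I a a = 1"
  proof
    fix n
    show "\<exists>(s :: real) (I :: 'a set set) a. finite I \<and> (\<forall>i\<in>I. a i \<in> vecs (fib B (lev n))) \<and>
     (\<forall>X\<in>carrier (\<Gamma> Mod K n). s\<^sup>2 * hilb.gram (fib B (lev n)) I (\<lambda>i. \<pi> (Level n X) (a i)) a = 1) \<and>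
     s\<^sup>2 * hilb.gram (fib B (lev n)) I a a = 1"
      using level_invariant[of n] by metis
  qed
  then obtain sL :: "nat \<Rightarrow> real" and IL :: "nat \<Rightarrow> 'a set set" and aL where
    L: "\<And>n. finite (IL n)" "\<And>n i. i \<in> IL n \<Longrightarrow> aL n i \<in> vecs (fib B (lev n))"
     "\<And>n X. X \<in> carrier (\<Gamma> Mod K n) \<Longrightarrow>
        (sL n)\<^sup>2 * hilb.gram (fib B (lev n)) (IL n) (\<lambda>i. \<pi> (Level n X) (aL n i)) (aL n) = 1"
     "\<And>n. (sL n)\<^sup>2 * hilb.gram (fib B (lev n)) (IL n) (aL n) (aL n) = 1"
    by metis
  \<comment> \<open>\<open>R x\<close> pairs the rank-one sum along the sections with its translate
    by \<open>x\<close>, \<open>q u\<close> is its squared norm, and \<open>s u\<close> normalizes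
    it. At limit arrows \<open>R\<close> has the constant value \<open>d\<close>.\<close>
  define R where "R x = hilb.gram (fib B (hls_unit \<Gamma> K x)) F
    (\<lambda>e. \<pi> x (\<xi> e (hls_unit \<Gamma> K x))) (\<lambda>e. \<xi> e (hls_unit \<Gamma> K x))" for x
  define q where "q u = hilb.gram (fib B u) F (\<lambda>e. \<xi> e u) (\<lambda>e. \<xi> e u)" for u
  define s where "s u = 1 / sqrt (q u)" for u
  have RL: "R (Level n A) = hilb.gram (fib B (lev n)) F (\<lambda>e. \<pi> (Level n A) (\<xi> e (lev n))) (\<lambda>e. \<xi> e (lev n))" for n A
    by (simp add: R_def)
  have Rl: "R (Limit g) = d" if "g \<in> carrier \<Gamma>" for g
    using gl[OF that] by (simp add: R_def d_def)
  have Rt: "(\<lambda>n. R (Level n (K n #> g))) \<longlonglongrightarrow> d" if g: "g \<in> carrier \<Gamma>" for g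
  proof -
    have "(\<lambda>n. R (Level n (K n #> g))) \<longlonglongrightarrow> R (Limit g)"
      unfolding RL hilb.gram_def[OF fib_hilb[OF lev_unit]]
      unfolding R_def hls_unit.simps hilb.gram_def[OF fib_hilb[OF lim_unit]]
      by (intro tendsto_sum tendsto_power tendsto_norm rep_tendsto g \<xi>)
    then show ?thesis using Rl[OF g] by simp
  qed
  have qR: "q u = R u" if "u = lev n \<or> u = lim" for u n
  proof -
    have u: "u \<in> gunits HLS" "hls_unit \<Gamma> K u = u" using that lev_unit lim_unit by auto
    have "\<pi> u (\<xi> e u) = \<xi> e u" if "e \<in> F" for e
      using rep_axioms(3) u(1) sect_in[OF \<xi>[OF that] u(1)] by blast
    then show ?thesis unfolding q_def R_def u(2) hilb.gram_def[OF fib_hilb[OF u(1)]] by simp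
  qed
  have qlim: "q lim = d" using qR[of lim] Rl[OF one_closed] by simp
  have qt: "(\<lambda>n. q (lev n)) \<longlonglongrightarrow> d" using Rt[OF one_closed] qR by simp
  have st: "(\<lambda>n. s (lev n)) \<longlonglongrightarrow> s lim"
    unfolding s_def qlim using d by (intro tendsto_divide tendsto_const tendsto_real_sqrt qt) simp
  \<comment> \<open>At low levels the sections may vanish, and \<open>s\<close> would not normalize.
    For \<open>N \<ge> N0\<close> those levels are served by the invariant operators.\<close>
  obtain N0 where N0: "\<And>n. n \<ge> N0 \<Longrightarrow> q (lev n) > 0"
    using order_tendstoD(1)[OF qt d] unfolding eventually_sequentially by blast
  have sq: "(s u)\<^sup>2 * q u = 1" if "q u > 0" for u using that by (simp add: s_def power_divide)
  define T where "T N \<eta> u = (case u of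
      Level n A \<Rightarrow> if A = K n then
          if n \<le> N then hilb.frank (fib B (lev n)) (sL n) (IL n) (aL n) (\<eta> (lev n))
          else hilb.frank (fib B (lev n)) (s (lev n)) F (\<lambda>e. \<xi> e (lev n)) (\<eta> (lev n))
        else 0
    | Limit g \<Rightarrow> if g = \<one> then hilb.frank (fib B lim) (s lim) F (\<lambda>e. \<xi> e lim) (\<eta> lim) else 0)"
    for N \<eta> u
  have T1: "T N \<eta> (lev n) = hilb.frank (fib B (lev n)) (sL n) (IL n) (aL n) (\<eta> (lev n))" if "n \<le> N" for N \<eta> n
    using that by (simp add: T_def)
  have T2: "T N \<eta> (lev n) = hilb.frank (fib B (lev n)) (s (lev n)) F (\<lambda>e. \<xi> e (lev n)) (\<eta> (lev n))"
    if "N < n" for N \<eta> n using that by (simp add: T_def)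
  have T3: "T N \<eta> lim = hilb.frank (fib B lim) (s lim) F (\<lambda>e. \<xi> e lim) (\<eta> lim)" for N \<eta>
    by (simp add: T_def)
  have xin: "\<xi> e u \<in> vecs (fib B u)" if "e \<in> F" "u \<in> gunits HLS" for e u
    using sect_in[OF \<xi>] that by blast
  have adjT: "hilb.adj (fib B u) (hilb.frank (fib B u) t I a) (hilb.frank (fib B u) t I a)"
    if "u \<in> gunits HLS" "\<And>i. i \<in> I \<Longrightarrow> a i \<in> vecs (fib B u)" for u t and I :: "'i set" and a
    using hilb.frank_adj[OF fib_hilb[OF that(1)] that(2)] .
  have Tin: "T N \<eta> u \<in> vecs (fib B u)" if "u \<in> gunits HLS" for N \<eta> u
    using that
  proof (cases rule: unit_cases)
    case (level n)
    show ?thesis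
    proof (cases "n \<le> N")
      case True
      then show ?thesis unfolding level T1[OF True]
        by (intro hilb.frank_in[OF fib_hilb[OF lev_unit]] L(2))
    next
      case False
      then show ?thesis unfolding level T2[OF False[unfolded not_le]]
        by (intro hilb.frank_in[OF fib_hilb[OF lev_unit]] xin lev_unit)
    qed
  next
    case limit
    show ?thesis unfolding limit T3
      by (intro hilb.frank_in[OF fib_hilb[OF lim_unit]] xin lim_unit)
  qed
  have T0: "T N \<eta> u = 0" if "u \<notin> gunits HLS" for N \<eta> u
    using that by (cases u) (simp_all add: T_def unit_Level unit_Limit)
  have Tsect: "T N \<eta> \<in> sect B" if "\<eta> \<in> sect B" for N \<eta>
  proof (rule frank_sect[where s = s and \<xi> = \<xi> and \<eta> = \<eta> and N = N and F = F])
    show "T N \<eta> \<in> all_sections HLS B" using Tin T0 by (simp add: all_sections_def)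
  qed (fact F(1) \<xi> that st T3 T2)+
  have Tadj: "ip (fib B u) (T N \<eta> u) (\<theta> u) = ip (fib B u) (\<eta> u) (T N \<theta> u)"
    if s: "\<eta> \<in> sect B" "\<theta> \<in> sect B" and u: "u \<in> gunits HLS" for N \<eta> \<theta> u
    using u
  proof (cases rule: unit_cases)
    case (level n)
    note v = sect_in[OF s(1) u] sect_in[OF s(2) u]
    show ?thesis
    proof (cases "n \<le> N")
      case True
      show ?thesis unfolding level T1[OF True]
        by (rule hilb.adj_ip[OF fib_hilb[OF lev_unit] adjT[OF lev_unit L(2)] v[unfolded level]])
    next
      case False
      show ?thesis unfolding level T2[OF False[unfolded not_le]]
        by (rule hilb.adj_ip[OF fib_hilb[OF lev_unit] adjT[OF lev_unit xin[OF _ lev_unit]] v[unfolded level]])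
    qed
  next
    case limit
    note v = sect_in[OF s(1) u] sect_in[OF s(2) u]
    show ?thesis unfolding limit T3
      by (rule hilb.adj_ip[OF fib_hilb[OF lim_unit] adjT[OF lim_unit xin[OF _ lim_unit]] v[unfolded limit]])
  qed
  have ad: "adjointable HLS B (T N)" for N
    unfolding adjointable_def C0_sect using Tsect Tadj
    by (intro conjI exI[of _ "T N"] ballI image_subsetI)
  {
    fix n N :: nat
    assume n: "n \<le> N"
    note frank_localization[where T = "T N" and u = "lev n" and s = "sL n" and I = "IL n" and a = "aL n",
        OF ad lev_unit L(1,2) T1[OF n]]
  } note loc1 = this
  {
    fix n N :: nat
    assume n: "N < n"
    note frank_localization[where T = "T N" and u = "lev n" and s = "s (lev n)" and I = F
        and a = "\<lambda>e. \<xi> e (lev n)", OF ad lev_unit F(1) xin[OF _ lev_unit] T2[OF n]]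
  } note loc2 = this
  {
    fix N :: nat
    note frank_localization[where T = "T N" and u = lim and s = "s lim" and I = F
        and a = "\<lambda>e. \<xi> e lim", OF ad lim_unit F(1) xin[OF _ lim_unit] T3]
  } note loc3 = this
  \<comment> \<open>The trace is exactly 1 at every unit, which settles the
    \<open>C0_function\<close> condition and the norm conditions at once.\<close>
  have norm1: "has_finite_trace (fib B u) (abs_square (fib B u) (localization HLS B (T N) u)) \<and>
      op_trace (fib B u) (abs_square (fib B u) (localization HLS B (T N) u)) = 1 \<and>
      hs_norm (fib B u) (localization HLS B (T N) u) = 1"
    if "u \<in> gunits HLS" and N: "N \<ge> N0" for u N
    using that(1)
  proof (cases rule: unit_cases)
    case (level n)
    show ?thesis
    proof (cases "n \<le> N")
      case True
      note l = loc1(1-3)[OF True, unfolded L(4)]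
      show ?thesis unfolding level by (intro conjI l(1)) (simp_all add: l(2,3))
    next
      case False
      then have "(s (lev n))\<^sup>2 * q (lev n) = 1" using sq N0 N by simp
      then have q1: "(s (lev n))\<^sup>2 * hilb.gram (fib B (lev n)) F (\<lambda>e. \<xi> e (lev n)) (\<lambda>e. \<xi> e (lev n)) = 1"
        by (simp add: q_def)
      note l = loc2(1-3)[OF False[unfolded not_le], unfolded q1]
      show ?thesis unfolding level by (intro conjI l(1)) (simp_all add: l(2,3))
    qed
  next
    case limit
    have "(s lim)\<^sup>2 * q lim = 1" using sq[of lim] d qlim by simp
    then have q1: "(s lim)\<^sup>2 * hilb.gram (fib B lim) F (\<lambda>e. \<xi> e lim) (\<lambda>e. \<xi> e lim) = 1"
      by (simp add: q_def)
    note l = loc3(1-3)[unfolded q1]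
    show ?thesis unfolding limit by (intro conjI l(1)) (simp_all add: l(2,3))
  qed
  define r where "r x = (s (hls_unit \<Gamma> K x))\<^sup>2 * R x" for x
  have rl: "r (Limit g) = 1" if "g \<in> carrier \<Gamma>" for g
    using Rl[OF that] sq[of lim] qlim d by (simp add: r_def)
  have rc: "continuous_map (hls_topology \<Gamma> K) euclideanreal r"
    unfolding continuous_map_HLS
  proof
    fix g assume g: "g \<in> carrier \<Gamma>"
    have "(\<lambda>n. (s (lev n))\<^sup>2 * R (Level n (K n #> g))) \<longlonglongrightarrow> (s lim)\<^sup>2 * d"
      by (intro tendsto_mult tendsto_power st Rt g)
    then show "(\<lambda>n. r (Level n (K n #> g))) \<longlonglongrightarrow> r (Limit g)"
      using Rl[OF g] by (simp add: r_def)
  qed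
  define h where "h N x = hs_inner (fib B (hls_unit \<Gamma> K x))
      (translate_op HLS \<pi> x (localization HLS B (T N) (hls_unit \<Gamma> K x)))
      (localization HLS B (T N) (hls_unit \<Gamma> K x))" for N x
  \<comment> \<open>Deviations from 1 occur only above level \<open>N\<close>, where they are
    governed by \<open>r\<close>, a continuous function that is independent of \<open>N\<close> and
    equals 1 at limit arrows.\<close>
  have h: "h N x = 1 \<or> (\<exists>n A. x = Level n A \<and> N < n \<and> h N x = of_real (r x))"
    if x: "x \<in> arrows HLS" for x N
  proof (cases x)
    case (Level n A)
    then have A: "A \<in> carrier (\<Gamma> Mod K n)" using x by (simp add: arrows_def Level_arrow)
    have u: "hls_unit \<Gamma> K x = lev n" by (simp add: Level)
    show ?thesis
    proof (cases "n \<le> N")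
      case True
      have "h N x = of_real ((sL n)\<^sup>2 * hilb.gram (fib B (lev n)) (IL n) (\<lambda>i. \<pi> x (aL n i)) (aL n))"
        unfolding h_def u by (rule loc1(4)[OF True _ x u])
      then show ?thesis using L(3)[OF A] by (simp add: Level)
    next
      case False
      then have n: "N < n" by simp
      have "h N x = of_real ((s (lev n))\<^sup>2 *
          hilb.gram (fib B (lev n)) F (\<lambda>e. \<pi> x (\<xi> e (lev n))) (\<lambda>e. \<xi> e (lev n)))"
        unfolding h_def u by (rule loc2(4)[OF n _ x u])
      then have "h N x = of_real (r x)" by (simp only: r_def R_def u)
      then show ?thesis using Level n by blast
    qed
  next
    case (Limit g)
    then have g: "g \<in> carrier \<Gamma>" using x by (simp add: arrows_def Limit_arrow)
    have u: "hls_unit \<Gamma> K x = lim" by (simp add: Limit)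
    have "h N x = of_real ((s lim)\<^sup>2 *
        hilb.gram (fib B lim) F (\<lambda>e. \<pi> x (\<xi> e lim)) (\<lambda>e. \<xi> e lim))"
      unfolding h_def u by (rule loc3(4)[OF _ x u])
    then have "h N x = of_real (r x)" by (simp only: r_def R_def u)
    then show ?thesis using rl[OF g] by (simp add: Limit)
  qed
  show ?thesis
    unfolding amenable_rep_def
  proof (intro exI[of _ "filtermap T sequentially"] conjI allI impI)
    show "filtermap T sequentially \<noteq> bot" by (simp add: filtermap_bot_iff)
    show "\<forall>\<^sub>F T in filtermap T sequentially. hilbert_schmidt HLS B T \<and> hs_sup_norm HLS B T \<le> 1"
      unfolding eventually_filtermap
    proof (rule eventually_sequentiallyI[of N0])
      fix N assume N: "N \<ge> N0"
      note n1 = norm1[OF _ N]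
      have "hilbert_schmidt HLS B (T N)"
        unfolding hilbert_schmidt_def C0_function_units
        using n1 ad lev_unit lim_unit by simp
      moreover have "hs_sup_norm HLS B (T N) \<le> 1"
        unfolding hs_sup_norm_def by (rule cSUP_least) (use n1 lim_unit in auto)
      ultimately show "hilbert_schmidt HLS B (T N) \<and> hs_sup_norm HLS B (T N) \<le> 1" ..
    qed
  next
    fix C assume "compactin (unit_top HLS) C"
    then have C: "C \<subseteq> gunits HLS" using compactin_subset_topspace topspace_units by blast
    show "uniform_limit C (\<lambda>T u. hs_norm (fib B u) (localization HLS B T u)) (\<lambda>_. 1) (filtermap T sequentially)"
      unfolding uniform_limit_iff eventually_filtermap
    proof (intro allI impI eventually_sequentiallyI[of N0] ballI)
      fix e :: real and N u assume "e > 0" "N \<ge> N0" "u \<in> C"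
      then show "dist (hs_norm (fib B u) (localization HLS B (T N) u)) 1 < e"
        using norm1[of u N] C by auto
    qed
  next
    fix C assume "compactin (gtop HLS) C"
    then have C: "compactin (hls_topology \<Gamma> K) C" by simp
    have Ca: "C \<subseteq> topspace (hls_topology \<Gamma> K)" by (rule compactin_subset_topspace[OF C])
    show "uniform_limit C
             (\<lambda>T x. hs_inner (fib B (grng HLS x))
                (translate_op HLS \<pi> x (localization HLS B T (gsrc HLS x)))
                (localization HLS B T (grng HLS x)))
             (\<lambda>_. 1) (filtermap T sequentially)"
      unfolding uniform_limit_iff eventually_filtermap gsrc_HLS grng_HLS h_def[symmetric]
    proof (intro allI impI)
      fix e :: real assume e: "e > 0"
      \<comment> \<open>\<open>V\<close> is open by continuity of \<open>r\<close> and contains the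
        limit arrows of \<open>C\<close>, so the levels of \<open>C - V\<close> do not exceed some
        \<open>N1\<close>; for \<open>N \<ge> N1\<close> these arrows meet only the exactly
        invariant operators.\<close>
      define V where "V = {x \<in> topspace (hls_topology \<Gamma> K). r x \<in> ball 1 e}"
      have V: "openin (hls_topology \<Gamma> K) V"
        unfolding V_def by (rule openin_continuous_map_preimage[OF rc]) simp
      have LV: "Limit g \<in> V" if "Limit g \<in> C" for g
      proof -
        have "g \<in> carrier \<Gamma>" using that Ca Limit_arrow by blast
        then show ?thesis using rl e by (simp add: V_def Limit_arrow)
      qed
      obtain N1 where N1: "\<forall>n A. Level n A \<in> C - V \<longrightarrow> n \<le> N1"
        using compact_minus_open[OF C V LV] by blast
      show "\<forall>\<^sub>F N in sequentially. \<forall>x\<in>C. dist (h N x) 1 < e"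
      proof (intro eventually_sequentiallyI[of N1] ballI)
        fix N x assume N: "N \<ge> N1" and x: "x \<in> C"
        have "x \<in> arrows HLS" using x Ca by (auto simp: arrows_def)
        from h[OF this, of N] show "dist (h N x) 1 < e"
        proof (elim disjE exE conjE)
          assume "h N x = 1"
          then show ?thesis using e by simp
        next
          fix n A assume l: "x = Level n A" "N < n" and hx: "h N x = of_real (r x)"
          then have "x \<in> V" using N1 N x by force
          then have "\<bar>r x - 1\<bar> < e" by (simp add: V_def dist_real_def abs_minus_commute)
          then have "cmod (complex_of_real (r x - 1)) < e" by (simp only: norm_of_real)
          then show ?thesis unfolding hx dist_norm by simp
        qed
      qed
    qed
  qed
qed

end

theorem corollary5p4:
  fixes \<Gamma> :: "('a, 'm) monoid_scheme"
    and K :: "nat \<Rightarrow> 'a set"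
    and B :: "('a hls, 'v::complex_vector) hilbert_bundle"
    and \<pi> :: "'a hls \<Rightarrow> 'v \<Rightarrow> 'v"
  assumes "approximated_group \<Gamma> K"
    and "countable (carrier \<Gamma>)"
    and "topological_property_T (hls_groupoid \<Gamma> K)"
    and "continuous_unitary_rep (hls_groupoid \<Gamma> K) B \<pi>"
  shows "amenable_rep (hls_groupoid \<Gamma> K) B \<pi> \<longleftrightarrow>
         has_finite_dim_subrep \<Gamma> (limit_fiber \<Gamma> B) (limit_rep \<pi>)"
proof -
  interpret approximated_group \<Gamma> K by fact
  interpret HLS_bundle \<Gamma> K B \<pi> by unfold_locales fact
  obtain F c where "kazhdan_pair \<Gamma> F c" using kazhdan_pair_of_topological[OF assms(3)] by blast
  then show ?thesis
    using finite_dim_subrep_of_amenable amenable_of_finite_dim_subrep by blast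
qed

end
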